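(* Let $d\ge 2$, let $p_1,\ldots,p_d$ be integers with $|p_i|\ge 2$ for $1\le i\le d$, and let $\boldsymbol s=(s_1,\ldots,s_{d-1})\in\mathbb R^{d-1}$. Let $$A=\begin{pmatrix}\operatorname{diag}(p_1,\ldots,p_{d-1}) & -\boldsymbol s\\ 0& p_d\end{pmatrix}\in\mathbb R^{d\times d},\qquad \mathcal D=\{(i_1,\ldots,i_d)\in\mathbb Z^d:\ 0\le i_j<|p_j|,\ 1\le j\le d\},$$ where $-\boldsymbol s$ is written as a column, and let $T=T(A,\mathcal D)$ be the corresponding self-affine tile. Then the following statements are equivalent. (1) The interior $T^\circ$ of $T$ is connected. (2) $T$ is a $d$-dimensional tame ball. (3) $$\max_{1\le j\le d-1}\left|\frac{s_j}{p_j\,(p_j-\operatorname{sign}(p_d))}\right|<1.$$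
   Context: For an expanding matrix $A\in\mathbb R^{d\times d}$ (all eigenvalues have modulus greater than $1$) and a finite set $\mathcal D\subset\mathbb R^d$, $T(A,\mathcal D)$ denotes the unique nonempty compact set $T\subset\mathbb R^d$ with $AT=T+\mathcal D$, that is, $T=\{\sum_{k\ge1}A^{-k}d_k:\ d_k\in\mathcal D\}$ (elements of $\mathcal D$ are regarded as column vectors). $\operatorname{sign}(x)$ is $1$, $0$ or $-1$ according to $x>0$, $x=0$ or $x<0$. A set $E\subset\mathbb R^d$ is a ($d$-dimensional) tame ball if there is a homeomorphism from $E$ onto the closed $d$-dimensional unit ball that extends to a homeomorphism of $\mathbb R^d$ onto itself. *)

theory Defs
  imports "HOL-Analysis.Analysis"
begin

text \<open>The coordinates of \<open>\<real>\<^sup>d\<close> are indexed by a finite linearly ordered type with \<open>d\<close> elements;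
  its largest element plays the role of the index \<open>d\<close>.\<close>

definition last_index :: "'n::{finite,linorder}" where
  "last_index = Max UNIV"

text \<open>The vector \<open>(s\<^sub>1, \<dots>, s\<^sub>d\<^sub>-\<^sub>1)\<close> is a function on the full index type whose value at
  \<open>last_index\<close> is never used.\<close>

definition tile_matrix :: "('n::{finite,linorder} \<Rightarrow> int) \<Rightarrow> ('n \<Rightarrow> real) \<Rightarrow>
    real^('n::{finite,linorder})^('n::{finite,linorder})" where
  "tile_matrix p s =
     (\<chi> i j. if i = j then of_int (p i)
            else if j = last_index then - s i
            else 0)"

definition digit_box :: "('n::finite \<Rightarrow> int) \<Rightarrow> (real^'n) set" where
  "digit_box p = {\<chi> j. of_int (i j) |i. \<forall>j. 0 \<le> i j \<and> i j < \<bar>p j\<bar>}"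

text \<open>Meaningful for expanding \<open>A\<close> and finite nonempty \<open>D\<close>, where existence and uniqueness hold
  (Hutchinson's theorem for the maps \<open>x \<mapsto> A\<^sup>-\<^sup>1 (x + d)\<close>). The matrices \<open>tile_matrix p s\<close> with all
  \<open>\<bar>p i\<bar> \<ge> 2\<close> are expanding, being triangular with diagonal \<open>p\<close>.\<close>

definition self_affine_set :: "real^'n^'n \<Rightarrow> (real^'n) set \<Rightarrow> (real^'n) set" where
  "self_affine_set A D =
     (THE T. T \<noteq> {} \<and> compact T \<and> (\<lambda>x. A *v x) ` T = {t + d |t d. t \<in> T \<and> d \<in> D})"

definition tame_ball :: "'a::euclidean_space set \<Rightarrow> bool" where
  "tame_ball E \<longleftrightarrow>
     (\<exists>f g F G. homeomorphism E (cball (0::'a) 1) f g \<and>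
                homeomorphism UNIV UNIV F G \<and> (\<forall>x\<in>E. F x = f x))"

end

theory Submission
  imports Defs
begin

text \<open>
  Since the digit box is symmetric, replacing \<open>A\<close> by \<open>- A\<close> only translates the tile, so assume that the
  last diagonal entry is \<open>q > 0\<close>.  Then the horizontal section of the tile at height \<open>t\<close> is a unit cube
  placed at a point \<open>f t\<close>, where \<open>f\<close> is continuous except at the \<open>q\<close>-adic rationals; there the section
  is the union of the cubes placed at the two one-sided limits, and condition (3) says precisely that
  these overlap in their interiors.  If two such cubes do not overlap at height \<open>1 / q\<close>, that height is
  missing from the interior of the tile, which is therefore disconnected.

  Otherwise the tile is approximated by stacks of finitely many prisms with straight pieces, refined at
  finer and finer \<open>q\<close>-adic scales.  A homeomorphism of the space turns each stack into the preceding one: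
  it tilts the interfaces where new jumps occur and then adjusts every coordinate separately.  The
  vertical size of this move can be chosen arbitrarily small; horizontally it is only as small as the
  oscillation of \<open>f\<close> at that scale, but its horizontal Lipschitz constant does not depend on the scale.
  If consecutive scales are far enough apart, the compositions and their inverses are uniformly Cauchy,
  and the limit carries the tile to a cube.
\<close>

section \<open>Tame balls and limits of homeomorphisms\<close>

text \<open>In coordinates, \<open>A x = x' + d\<close> reads
  \<open>x_j = (x'_j + d_j + s_j t) / p_j\<close>, where \<open>t\<close> is the last coordinate of
  \<open>x\<close>. Iterating, the digits \<open>d_j\<close> sweep out a unit interval, while the
  tails \<open>t_n\<close> of the q-adic expansion of \<open>t\<close> contribute \<open>s_j\<close>
  times the sum of \<open>t_n / p_j^(n+1)\<close>; this is the moving part of \<open>f\<close>. At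
  \<open>t = m / q\<close> with 0 < m < q the two expansions have equal first tails and then only 0s
  or only 1s, so \<open>f_j\<close> jumps by \<open>|s_j| / |p_j (p_j - 1)|\<close>; jumps first
  appearing at later levels are smaller by further factors \<open>|p_j|\<close>. Hence the
  denominators in (3), and one bound \<open>vb < 1\<close> for all jumps. The obstacle in the limit
  is that the k-th move is seen through all earlier maps, whose Lipschitz constants multiply. The
  vertical constants are uncontrolled, but the vertical size of the move is chosen after them. The
  horizontal size is dictated by \<open>f\<close>, so each step must cost a fixed horizontal factor
  \<open>\<kappa>\<close>, depending only on the dimension and \<open>vb\<close>; then
  \<open>q\<close> is replaced by a power \<open>q^N\<close> for which the oscillation decay
  \<open>(2/3)^N\<close> beats \<open>\<kappa>\<close>.\<close>

definition autohomeo :: "('a::topological_space \<Rightarrow> 'a) \<Rightarrow> bool" where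
  "autohomeo f \<longleftrightarrow> (\<exists>g. homeomorphism UNIV UNIV f g)"

lemma autohomeo_comp:
  assumes "autohomeo f" "autohomeo g"
  shows "autohomeo (\<lambda>x. f (g x))"
proof -
  obtain f' g' where "homeomorphism UNIV UNIV f f'" "homeomorphism UNIV UNIV g g'"
    using assms by (auto simp: autohomeo_def)
  then have "homeomorphism UNIV UNIV (f \<circ> g) (g' \<circ> f')"
    using homeomorphism_compose by blast
  then show ?thesis by (auto simp: autohomeo_def o_def)
qed

text \<open>Invariance of domain supplies the continuity of the inverse, so no inverse has to be
  exhibited.\<close>

lemma autohomeoI:
  fixes f :: "'a::euclidean_space \<Rightarrow> 'a"
  assumes "continuous_on UNIV f" "inj f" "surj f"
  shows "autohomeo f"
proof -
  obtain g where "homeomorphism UNIV (f ` UNIV) f g"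
    using invariance_of_domain_homeomorphism[of UNIV f] assms by auto
  then show ?thesis using assms(3) by (auto simp: autohomeo_def)
qed

lemma autohomeo_add: "autohomeo (\<lambda>x. x + (c::'a::euclidean_space))"
  by (rule autohomeoI) (auto intro!: continuous_intros injI surjI[where f = "\<lambda>x. x - c"])

text \<open>The intermediate value theorem between \<open>y - M\<close> and \<open>y + M\<close>. It
  makes the straightening maps onto, one coordinate at a time.\<close>

lemma real_surj_if_bounded_displacement:
  fixes g :: "real \<Rightarrow> real"
  assumes "continuous_on UNIV g" "\<And>x. \<bar>g x - x\<bar> \<le> M"
  shows "surj g"
unfolding surj_def
proof
  fix y
  have "g (y - M) \<le> y" "y \<le> g (y + M)"
    using assms(2)[of "y - M"] assms(2)[of "y + M"] by auto
  moreover have "y - M \<le> y + M" using assms(2)[of 0] by linarith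
  ultimately have "\<exists>x. y - M \<le> x \<and> x \<le> y + M \<and> g x = y"
    by (intro IVT') (auto intro: continuous_on_subset[OF assms(1)])
  then show "\<exists>x. y = g x" by auto
qed

lemma interior_autohomeo_image:
  fixes F :: "'a::topological_space \<Rightarrow> 'a"
  assumes "autohomeo F"
  shows "interior (F ` T) = F ` interior T"
proof -
  obtain G where G: "homeomorphism UNIV UNIV F G" using assms by (auto simp: autohomeo_def)
  have op: "open (F ` S)" if "open S" for S
    using homeomorphism_imp_open_map[OF G, of S] that by auto
  have G': "homeomorphism UNIV UNIV G F" using G homeomorphism_symD by blast
  have opG: "open (G ` S)" if "open S" for S
    using homeomorphism_imp_open_map[OF G', of S] that by auto
  have FG: "F (G y) = y" "G (F x) = x" for x y
    using G by (auto simp: homeomorphism_def)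
  show ?thesis
  proof
    show "F ` interior T \<subseteq> interior (F ` T)"
      by (intro interior_maximal op open_interior image_mono interior_subset)
    have "G ` interior (F ` T) \<subseteq> interior T"
    proof (intro interior_maximal opG open_interior)
      show "G ` interior (F ` T) \<subseteq> T"
        using interior_subset[of "F ` T"] FG by force
    qed
    then show "interior (F ` T) \<subseteq> F ` interior T"
      using FG by (metis (no_types, opaque_lifting) image_eqI image_subset_iff subsetI)
  qed
qed

text \<open>The homeomorphism onto the ball in \<open>tame_ball\<close> is the restriction of the
  global one, so a single map of the whole space carries all the information.\<close>

lemma tame_ball_iff:
  fixes T :: "'a::euclidean_space set"
  shows "tame_ball T \<longleftrightarrow> (\<exists>F. autohomeo F \<and> F ` T = cball 0 1)"
proof
  assume "tame_ball T"
  then obtain f g F G where *: "homeomorphism T (cball (0::'a) 1) f g" "homeomorphism UNIV UNIV F G"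
      "\<forall>x\<in>T. F x = f x" unfolding tame_ball_def by blast
  then have "F ` T = cball 0 1" by (metis homeomorphism_image1 image_cong)
  with * show "\<exists>F. autohomeo F \<and> F ` T = cball 0 1" unfolding autohomeo_def by metis
next
  assume "\<exists>F. autohomeo F \<and> F ` T = cball 0 1"
  then obtain F G where "homeomorphism UNIV UNIV F G" "F ` T = cball (0::'a) 1"
    by (auto simp: autohomeo_def)
  then have "homeomorphism T (cball 0 1) F G"
    using homeomorphism_of_subsets[of UNIV UNIV F G T "cball 0 1"] by auto
  with \<open>homeomorphism UNIV UNIV F G\<close> show "tame_ball T" unfolding tame_ball_def by blast
qed

lemma tame_ball_autohomeo_image:
  assumes "autohomeo H"
  shows "tame_ball (H ` T) \<longleftrightarrow> tame_ball T"
proof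
  assume "tame_ball (H ` T)"
  then obtain F where "autohomeo F" "F ` H ` T = cball 0 1" by (auto simp: tame_ball_iff)
  then show "tame_ball T"
    using autohomeo_comp[OF _ assms, of F] unfolding tame_ball_iff by (auto simp: image_image)
next
  assume "tame_ball T"
  then obtain F where F: "autohomeo F" "F ` T = cball 0 1" by (auto simp: tame_ball_iff)
  obtain K where K: "homeomorphism UNIV UNIV H K" using assms by (auto simp: autohomeo_def)
  then have "autohomeo K" using homeomorphism_symD autohomeo_def by blast
  moreover have "K (H x) = x" for x using K by (auto simp: homeomorphism_def)
  ultimately show "tame_ball (H ` T)"
    using autohomeo_comp[OF F(1), of K] F(2) unfolding tame_ball_iff
    by (intro exI[of _ "\<lambda>x. F (K x)"]) (simp add: image_image)
qed

lemma tame_ball_connected_interior: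
  assumes "tame_ball T"
  shows "connected (interior T)"
proof -
  obtain F where F: "autohomeo F" "F ` T = cball 0 1" using assms by (auto simp: tame_ball_iff)
  obtain G where G: "homeomorphism UNIV UNIV F G" using F by (auto simp: autohomeo_def)
  have "F ` interior T = ball 0 1"
    using interior_autohomeo_image[OF F(1), of T] F(2) by auto
  moreover have "G (F x) = x" for x using G by (simp add: homeomorphism_def)
  ultimately have "interior T = G ` ball 0 1"
    by (metis (no_types, lifting) image_cong image_ident image_image)
  moreover have "continuous_on (ball 0 1) G"
    using G continuous_on_subset homeomorphism_def by blast
  ultimately show ?thesis using connected_continuous_image connected_ball by metis
qed

text \<open>The radial rescaling \<open>F\<close> keeps directions and turns the maximum norm into
  the Euclidean one; its continuity needs a separate argument only at the origin.\<close>

lemma tame_ball_infnorm_cball: "tame_ball {x::'a::euclidean_space. infnorm x \<le> 1}"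
proof -
  define F where "F = (\<lambda>x::'a. (infnorm x / norm x) *\<^sub>R x)"
  have nF: "norm (F x) = infnorm x" for x
    by (cases "x = 0") (auto simp: F_def infnorm_0 infnorm_pos_le)
  have F0: "F 0 = 0" by (simp add: F_def)
  have "continuous_on UNIV F"
  proof (rule continuous_at_imp_continuous_on, intro ballI)
    fix x :: 'a
    show "isCont F x"
    proof (cases "x = 0")
      case True
      have "(F \<longlongrightarrow> 0) (at 0)"
      proof (rule Lim_null_comparison)
        show "\<forall>\<^sub>F x in at 0. norm (F x) \<le> norm x"
          using infnorm_le_norm by (intro always_eventually allI) (simp add: nF)
        show "(norm \<longlongrightarrow> 0) (at (0::'a))"
          by (rule tendsto_norm_zero[OF tendsto_ident_at])
      qed
      then show ?thesis using True F0 by (simp add: isCont_def)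
    next
      case False
      then show ?thesis unfolding F_def by (intro continuous_intros) auto
    qed
  qed
  moreover have "inj F"
  proof (rule injI)
    fix x y assume e: "F x = F y"
    then have i: "infnorm x = infnorm y" using nF by metis
    show "x = y"
    proof (cases "x = 0")
      case True then show ?thesis using i by (metis infnorm_0 infnorm_eq_0)
    next
      case False
      then have y: "y \<noteq> 0" and ix: "infnorm x \<noteq> 0" using i by (metis infnorm_eq_0)+
      have "(1 / norm x) *\<^sub>R x = (1 / norm y) *\<^sub>R y"
      proof -
        have "infnorm x *\<^sub>R ((1 / norm x) *\<^sub>R x) = infnorm x *\<^sub>R ((1 / norm y) *\<^sub>R y)"
          using e i by (simp add: F_def)
        then show ?thesis using ix by (simp only: scaleR_cancel_left) simp
      qed
      then have xy: "x = (norm x / norm y) *\<^sub>R y"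
      proof -
        have "x = norm x *\<^sub>R ((1 / norm x) *\<^sub>R x)" using False by simp
        also have "\<dots> = norm x *\<^sub>R ((1 / norm y) *\<^sub>R y)"
          using \<open>(1 / norm x) *\<^sub>R x = (1 / norm y) *\<^sub>R y\<close> by (rule arg_cong)
        finally show ?thesis by simp
      qed
      have "infnorm x = \<bar>norm x / norm y\<bar> * infnorm y" by (metis xy infnorm_mul)
      then have "norm x / norm y = 1" using i ix y False by (simp add: field_simps)
      then show ?thesis using xy by (metis scaleR_one)
    qed
  qed
  moreover have "surj F"
  unfolding surj_def
  proof
    fix y :: 'a
    show "\<exists>x. y = F x"
    proof (cases "y = 0")
      case True then show ?thesis using F0 by metis
    next
      case False
      then have "infnorm y > 0" by (simp add: infnorm_pos_lt)
      then have "y = F ((norm y / infnorm y) *\<^sub>R y)"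
        using False by (simp add: F_def infnorm_mul)
      then show ?thesis by blast
    qed
  qed
  ultimately have F: "autohomeo F" by (rule autohomeoI)
  have "F ` {x. infnorm x \<le> 1} = cball 0 1"
  proof -
    have "y \<in> F ` {x. infnorm x \<le> 1}" if "norm y \<le> 1" for y
    proof -
      obtain x where "y = F x" using \<open>surj F\<close> by (metis surjD)
      then show ?thesis using that nF by auto
    qed
    then show ?thesis by (auto simp: nF)
  qed
  then show ?thesis using F tame_ball_iff by blast
qed

lemma autohomeo_scale: "c \<noteq> 0 \<Longrightarrow> autohomeo (\<lambda>x. c *\<^sub>R (x::'a::euclidean_space))"
  by (rule autohomeoI)
     (auto intro!: continuous_intros injI surjI[where f = "\<lambda>x. (1/c) *\<^sub>R x"])

lemma infnorm_le_iff_cart: "infnorm (x::real^'n) \<le> r \<longleftrightarrow> (\<forall>i. \<bar>x$i\<bar> \<le> r)"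
proof
  assume "infnorm x \<le> r"
  then show "\<forall>i. \<bar>x$i\<bar> \<le> r" using component_le_infnorm_cart order_trans by blast
next
  assume "\<forall>i. \<bar>x$i\<bar> \<le> r"
  then show "infnorm x \<le> r" unfolding infnorm_cart by (intro cSup_least) auto
qed

lemma tame_ball_unit_cube: "tame_ball {z::real^'n. \<forall>i. 0 \<le> z$i \<and> z$i \<le> 1}"
proof -
  let ?c = "(\<chi> i. 1/2) :: real^'n"
  have "{z::real^'n. \<forall>i. 0 \<le> z$i \<and> z$i \<le> 1}
    = (\<lambda>x. x + ?c) ` (\<lambda>x. (1/2) *\<^sub>R x) ` {x. infnorm x \<le> 1}"
  proof (intro equalityI subsetI)
    fix z :: "real^'n" assume z: "z \<in> {z. \<forall>i. 0 \<le> z$i \<and> z$i \<le> 1}"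
    have "infnorm (2 *\<^sub>R (z - ?c)) \<le> 1"
      using z by (auto simp: infnorm_le_iff_cart abs_le_iff)
    moreover have "z = (1/2) *\<^sub>R (2 *\<^sub>R (z - ?c)) + ?c" by simp
    ultimately show "z \<in> (\<lambda>x. x + ?c) ` (\<lambda>x. (1/2) *\<^sub>R x) ` {x. infnorm x \<le> 1}"
      by blast
  next
    fix z assume "z \<in> (\<lambda>x. x + ?c) ` (\<lambda>x. (1/2) *\<^sub>R x) ` {x. infnorm x \<le> 1}"
    then obtain x where x: "\<And>i. \<bar>x$i\<bar> \<le> 1" "z = (1/2) *\<^sub>R x + ?c"
      by (auto simp: infnorm_le_iff_cart)
    have "0 \<le> z$i \<and> z$i \<le> 1" for i using x(1)[of i] x(2) by (auto simp: abs_le_iff)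
    then show "z \<in> {z. \<forall>i. 0 \<le> z$i \<and> z$i \<le> 1}" by blast
  qed
  then show ?thesis
    by (simp add: tame_ball_autohomeo_image autohomeo_add autohomeo_scale tame_ball_infnorm_cball)
qed

lemma summable_telescope_uniform_limit:
  fixes E :: "nat \<Rightarrow> 'a \<Rightarrow> 'b::banach"
  assumes "\<And>k x. norm (E (Suc k) x - E k x) \<le> M k" "summable M"
  obtains E' where "uniform_limit UNIV E E' sequentially"
proof -
  have "uniformly_convergent_on UNIV (\<lambda>n x. \<Sum>i<n. (E (Suc i) x - E i x))"
    by (rule Weierstrass_m_test'[OF assms])
  then obtain h where h: "uniform_limit UNIV (\<lambda>n x. \<Sum>i<n. (E (Suc i) x - E i x)) h sequentially"
    unfolding uniformly_convergent_on_def by blast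
  have "uniform_limit UNIV (\<lambda>n x. (\<Sum>i<n. (E (Suc i) x - E i x)) + E 0 x) (\<lambda>x. h x + E 0 x) sequentially"
    by (intro uniform_limit_add h uniform_limit_const)
  moreover have "(\<Sum>i<n. (E (Suc i) x - E i x)) + E 0 x = E n x" for n x
    by (simp add: sum_lessThan_telescope[of "\<lambda>i. E i x"])
  ultimately show ?thesis using that by simp
qed

lemma tendsto_dist_zero_transform:
  fixes a b :: "nat \<Rightarrow> 'a::metric_space"
  assumes "b \<longlonglongrightarrow> l" "(\<lambda>k. dist (a k) (b k)) \<longlonglongrightarrow> 0"
  shows "a \<longlonglongrightarrow> l"
proof -
  have "(\<lambda>k. dist (b k) l) \<longlonglongrightarrow> 0" using assms(1) tendsto_dist_iff by blast
  then have s: "(\<lambda>k. dist (a k) (b k) + dist (b k) l) \<longlonglongrightarrow> 0"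
    using tendsto_add[OF assms(2)] by fastforce
  have "(\<lambda>k. dist (a k) l) \<longlonglongrightarrow> 0"
    by (rule tendsto_sandwich[OF _ _ tendsto_const s]) (auto simp: dist_triangle)
  then show ?thesis using tendsto_dist_iff by blast
qed

lemma uniform_limit_apply:
  fixes F :: "nat \<Rightarrow> 'a::metric_space \<Rightarrow> 'b::metric_space"
  assumes "uniform_limit UNIV F F' sequentially" "continuous_on UNIV F'" "y \<longlonglongrightarrow> y'"
  shows "(\<lambda>k. F k (y k)) \<longlonglongrightarrow> F' y'"
proof -
  have "(\<lambda>k. F' (y k)) \<longlonglongrightarrow> F' y'"
    using assms(2,3) continuous_on_tendsto_compose by fastforce
  moreover have "(\<lambda>k. dist (F k (y k)) (F' (y k))) \<longlonglongrightarrow> 0"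
  proof (rule metric_LIMSEQ_I)
    fix r :: real assume "0 < r"
    then have "\<forall>\<^sub>F k in sequentially. \<forall>x\<in>UNIV. dist (F k x) (F' x) < r"
      using uniform_limitD[OF assms(1)] by blast
    then show "\<exists>no. \<forall>n\<ge>no. dist (dist (F n (y n)) (F' (y n))) 0 < r"
      by (auto simp: eventually_sequentially)
  qed
  ultimately show ?thesis by (rule tendsto_dist_zero_transform)
qed

text \<open>A sequence of homeomorphisms may converge uniformly to a non-injective map;
  control of the inverses excludes that.\<close>

lemma limit_of_autohomeos:
  fixes E F :: "nat \<Rightarrow> 'a::euclidean_space \<Rightarrow> 'a"
  assumes hom: "\<And>k. homeomorphism UNIV UNIV (E k) (F k)"
    and E: "\<And>k x. norm (E (Suc k) x - E k x) \<le> M k" and F: "\<And>k x. norm (F (Suc k) x - F k x) \<le> M k"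
    and M: "summable M"
    and Tk: "\<And>k z. z \<in> T k \<longleftrightarrow> E k z \<in> Q" and Q: "closed Q" and T: "closed U"
    and e: "e \<longlonglongrightarrow> 0"
    and close1: "\<And>k z. z \<in> U \<Longrightarrow> \<exists>z'\<in>T k. dist z z' \<le> e k"
    and close2: "\<And>k z. z \<in> T k \<Longrightarrow> \<exists>z'\<in>U. dist z z' \<le> e k"
  obtains H where "autohomeo H" "H ` U = Q"
proof -
  obtain E' where E': "uniform_limit UNIV E E' sequentially"
    using summable_telescope_uniform_limit[of E M] E M by blast
  obtain F' where F': "uniform_limit UNIV F F' sequentially"
    using summable_telescope_uniform_limit[of F M] F M by blast
  have contE: "continuous_on UNIV E'"
    by (rule uniform_limit_theorem[OF always_eventually E'])
       (use hom in \<open>auto simp: homeomorphism_def\<close>)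
  have contF: "continuous_on UNIV F'"
    by (rule uniform_limit_theorem[OF always_eventually F'])
       (use hom in \<open>auto simp: homeomorphism_def\<close>)
  have ptE: "(\<lambda>k. E k x) \<longlonglongrightarrow> E' x" for x by (rule tendsto_uniform_limitI[OF E']) auto
  have ptF: "(\<lambda>k. F k x) \<longlonglongrightarrow> F' x" for x by (rule tendsto_uniform_limitI[OF F']) auto
  have inv: "F k (E k x) = x" "E k (F k x) = x" for k x
    using hom[of k] by (auto simp: homeomorphism_def)
  \<comment> \<open>Evaluating a uniform limit along a convergent sequence lets the identities
    \<open>F k (E k x) = x\<close> and \<open>E k (F k x) = x\<close> pass to the limit.\<close>
  have FE: "F' (E' x) = x" for x
    using uniform_limit_apply[OF F' contF ptE[of x]] inv LIMSEQ_unique by (simp add: LIMSEQ_const_iff)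
  have EF: "E' (F' x) = x" for x
    using uniform_limit_apply[OF E' contE ptF[of x]] inv LIMSEQ_unique by (simp add: LIMSEQ_const_iff)
  have "homeomorphism UNIV UNIV E' F'"
    using FE EF contE contF by (intro homeomorphismI) auto
  moreover have "E' ` U = Q"
  proof (intro equalityI subsetI)
    fix w assume "w \<in> E' ` U"
    then obtain z where z: "z \<in> U" "w = E' z" by blast
    obtain z' where z': "\<And>k. z' k \<in> T k" "\<And>k. dist z (z' k) \<le> e k" using close1[OF z(1)] by metis
    have "(\<lambda>k. dist (z' k) z) \<longlonglongrightarrow> 0"
      by (rule tendsto_sandwich[OF _ _ tendsto_const e]) (use z'(2) in \<open>auto simp: dist_commute\<close>)
    then have "z' \<longlonglongrightarrow> z" using tendsto_dist_iff by blast
    then have "(\<lambda>k. E k (z' k)) \<longlonglongrightarrow> w" using uniform_limit_apply[OF E' contE] z by blast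
    then show "w \<in> Q" using Q z'(1) Tk closed_sequentially by metis
  next
    fix w assume w: "w \<in> Q"
    then have "\<exists>z. z \<in> U \<and> dist (F k w) z \<le> e k" for k using Tk inv close2[of "F k w" k] by auto
    then obtain z where z: "\<And>k. z k \<in> U" "\<And>k. dist (F k w) (z k) \<le> e k" by metis
    have "(\<lambda>k. dist (z k) (F k w)) \<longlonglongrightarrow> 0"
      by (rule tendsto_sandwich[OF _ _ tendsto_const e]) (use z(2) in \<open>auto simp: dist_commute\<close>)
    then have "z \<longlonglongrightarrow> F' w" by (rule tendsto_dist_zero_transform[OF ptF])
    then have "F' w \<in> U" using T z(1) closed_sequentially by metis
    then show "w \<in> E' ` U" using EF by (metis image_eqI)
  qed
  ultimately show ?thesis using that by (auto simp: autohomeo_def)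
qed

section \<open>Straightening a single interface\<close>

text \<open>Maximum-norm distance of the horizontal part of \<open>x\<close> from the unit cube:
  clamping each coordinate to [0, 1] gives a nearest point, and coordinate \<open>l\<close> is
  ignored.\<close>

definition boxdist :: "'n::finite \<Rightarrow> real^'n \<Rightarrow> real" where
  "boxdist l x = infnorm (\<chi> j. if j = l then 0 else x$j - max 0 (min 1 (x$j)))"

lemma boxdist_nonneg: "0 \<le> boxdist l x"
  by (simp add: boxdist_def infnorm_pos_le)

lemma boxdist_le_iff:
  assumes "0 \<le> a"
  shows "boxdist l x \<le> a \<longleftrightarrow> (\<forall>j. j \<noteq> l \<longrightarrow> - a \<le> x$j \<and> x$j \<le> 1 + a)"
proof -
  have "\<bar>y - max 0 (min 1 y)\<bar> \<le> a \<longleftrightarrow> - a \<le> y \<and> y \<le> 1 + a" for y :: real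
    using assms by (auto simp: max_def min_def abs_le_iff)
  then show ?thesis using assms by (auto simp: boxdist_def infnorm_le_iff_cart)
qed

lemma boxdist_diff_le:
  fixes x y :: "real^'n" and l :: 'n
  assumes "\<And>j. j \<noteq> l \<Longrightarrow> \<bar>x$j - y$j\<bar> \<le> b" "0 \<le> b"
  shows "\<bar>boxdist l x - boxdist l y\<bar> \<le> b"
proof -
  have r: "\<bar>(u - max 0 (min 1 u)) - (w - max 0 (min 1 w))\<bar> \<le> \<bar>u - w\<bar>" for u w :: real
    by (auto simp: max_def min_def abs_le_iff)
  have "\<bar>boxdist l x - boxdist l y\<bar> \<le>
     infnorm ((\<chi> j. if j = l then 0 else x$j - max 0 (min 1 (x$j)))
        - (\<chi> j. if j = l then 0 else y$j - max 0 (min 1 (y$j))) :: real^'n)"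
    unfolding boxdist_def by (rule absdiff_infnorm)
  also have "\<dots> \<le> b"
    using assms by (auto simp: infnorm_le_iff_cart intro: order_trans[OF r])
  finally show ?thesis .
qed

lemma boxdist_le_0_iff: "boxdist l x \<le> 0 \<longleftrightarrow> (\<forall>j. j \<noteq> l \<longrightarrow> 0 \<le> x$j \<and> x$j \<le> 1)"
  using boxdist_le_iff[of 0 l x] by simp

text \<open>With \<open>T\<^sup>\<plusminus> = max 0 (\<plusminus>T)\<close>, the intersection of the \<open>T\<^sup>+\<close>-neighbourhood of
  \<open>[0, 1]\<close> and the \<open>T\<^sup>-\<close>-neighbourhood of \<open>[v, v + 1]\<close> is
  \<open>[lower_edge v T, 1 + upper_edge v T]\<close>.  The increasing map \<open>x \<mapsto> x + edge_shift v x T\<close> carries it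
  onto \<open>[0, 1]\<close>; its middle piece does not depend on \<open>T\<close> and maps \<open>[0, 1] \<inter> [v, v + 1]\<close> onto \<open>[0, 1]\<close>.\<close>

definition lower_edge :: "real \<Rightarrow> real \<Rightarrow> real" where
  "lower_edge v T = max (- max 0 T) (v - max 0 (- T))"

definition upper_edge :: "real \<Rightarrow> real \<Rightarrow> real" where
  "upper_edge v T = min (max 0 T) (v + max 0 (- T))"

definition edge_shift :: "real \<Rightarrow> real \<Rightarrow> real \<Rightarrow> real" where
  "edge_shift v x T =
     max (- lower_edge v T) (min (- upper_edge v T) ((x - max 0 v) / (1 - \<bar>v\<bar>) - x))"

lemma upper_edge_le_lower_edge: "upper_edge v T \<le> lower_edge v T"
  unfolding upper_edge_def lower_edge_def by linarith

lemma edge_bounds: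
  "min 0 v \<le> upper_edge v T" "lower_edge v T \<le> max 0 v"
  "- \<bar>v\<bar> \<le> lower_edge v T" "upper_edge v T \<le> \<bar>v\<bar>"
  unfolding upper_edge_def lower_edge_def by linarith+

text \<open>Once \<open>\<bar>T\<bar>\<close> reaches \<open>\<bar>v\<bar>\<close>, one
  neighbourhood contains the other interval entirely, so the intersection is that other interval:
  [0, 1] for low \<open>T\<close>, [v, v + 1] for high \<open>T\<close>.\<close>

lemma edge_left: "T \<le> - \<bar>v\<bar> \<Longrightarrow> lower_edge v T = 0" "T \<le> - \<bar>v\<bar> \<Longrightarrow> upper_edge v T = 0"
  unfolding upper_edge_def lower_edge_def by linarith+

lemma edge_right: "\<bar>v\<bar> \<le> T \<Longrightarrow> lower_edge v T = v" "\<bar>v\<bar> \<le> T \<Longrightarrow> upper_edge v T = v"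
  unfolding upper_edge_def lower_edge_def by linarith+

lemma edge_lip:
  "\<bar>lower_edge v T - lower_edge v U\<bar> \<le> \<bar>T - U\<bar>"
  "\<bar>upper_edge v T - upper_edge v U\<bar> \<le> \<bar>T - U\<bar>"
  unfolding upper_edge_def lower_edge_def by linarith+

lemma edge_shift_left: "T \<le> - \<bar>v\<bar> \<Longrightarrow> edge_shift v x T = 0"
  unfolding edge_shift_def by (simp add: edge_left)

lemma edge_shift_right: "\<bar>v\<bar> \<le> T \<Longrightarrow> edge_shift v x T = - v"
  unfolding edge_shift_def by (simp add: edge_right)

lemma edge_shift_zero: "edge_shift 0 x T = 0"
  using edge_shift_left[of T 0 x] edge_shift_right[of 0 T x] by (cases "T \<le> 0") auto

lemma max_min_bound:
  fixes a c m t :: real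
  assumes "\<bar>a\<bar> \<le> t" "\<bar>c\<bar> \<le> t"
  shows "\<bar>max (- a) (min (- c) m)\<bar> \<le> t"
  using assms by (auto simp: max_def min_def abs_le_iff)

lemma max_min_lip:
  fixes a c m t :: real
  assumes "\<bar>a - a'\<bar> \<le> t" "\<bar>c - c'\<bar> \<le> t" "\<bar>m - m'\<bar> \<le> t"
  shows "\<bar>max (- a) (min (- c) m) - max (- a') (min (- c') m')\<bar> \<le> t"
  using assms by (auto simp: max_def min_def abs_le_iff)

text \<open>Below \<open>a\<close> both \<open>x - a\<close> and \<open>L\<close> are negative;
  above \<open>1 + c\<close> both \<open>x - c\<close> and \<open>L\<close> exceed 1. In between,
  \<open>x - a\<close> keeps the clamped value nonnegative and \<open>x - c\<close> keeps it at most
  1.\<close>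

lemma max_min_unit:
  fixes a c L x :: real
  assumes "c \<le> a" "x < a \<Longrightarrow> L < 0" "1 + c < x \<Longrightarrow> 1 < L"
  shows "a \<le> x \<and> x \<le> 1 + c \<longleftrightarrow> 0 \<le> max (x - a) (min (x - c) L) \<and> max (x - a) (min (x - c) L) \<le> 1"
proof (cases "x < a \<or> 1 + c < x")
  case True
  then show ?thesis using assms by (auto simp: max_def min_def)
next
  case False
  then show ?thesis using assms(1) by (auto simp: max_def min_def)
qed

lemma edge_shift_bound: "\<bar>edge_shift v x T\<bar> \<le> \<bar>v\<bar>"
proof -
  have "\<bar>lower_edge v T\<bar> \<le> \<bar>v\<bar>" "\<bar>upper_edge v T\<bar> \<le> \<bar>v\<bar>"
    using edge_bounds[of v T] by linarith+
  then show ?thesis unfolding edge_shift_def by (rule max_min_bound)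
qed

lemma edge_shift_slope:
  fixes v x y :: real
  assumes "\<bar>v\<bar> < 1"
  shows "(x - max 0 v) / (1 - \<bar>v\<bar>) - x - ((y - max 0 v) / (1 - \<bar>v\<bar>) - y) = \<bar>v\<bar> / (1 - \<bar>v\<bar>) * (x - y)"
proof -
  have "\<bar>v\<bar> / (1 - \<bar>v\<bar>) = 1 / (1 - \<bar>v\<bar>) - 1" using assms by (simp add: field_simps)
  moreover have "(x - m) / D - x - ((y - m) / D - y) = (1 / D - 1) * (x - y)" for m D :: real
    by (simp add: algebra_simps diff_divide_distrib)
  ultimately show ?thesis by simp
qed

lemma edge_shift_mono:
  assumes "\<bar>v\<bar> < 1" "x \<le> y"
  shows "edge_shift v x T \<le> edge_shift v y T"
proof -
  have "0 \<le> \<bar>v\<bar> / (1 - \<bar>v\<bar>) * (y - x)" using assms by simp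
  then have "(x - max 0 v) / (1 - \<bar>v\<bar>) - x \<le> (y - max 0 v) / (1 - \<bar>v\<bar>) - y"
    using edge_shift_slope[OF assms(1), of y x] by linarith
  then show ?thesis unfolding edge_shift_def by (intro max.mono min.mono order_refl)
qed

text \<open>The edges move with at most unit speed in \<open>T\<close>, and the middle piece of the
  shift has slope \<open>\<bar>v\<bar> / (1 - \<bar>v\<bar>)\<close> in \<open>x\<close>. This is
  where the overlap of the cubes in their interiors enters: the slope stays bounded because
  \<open>\<bar>v\<bar> \<le> b < 1\<close>.\<close>

lemma edge_shift_lip:
  assumes "\<bar>v\<bar> \<le> b" "b < 1"
  shows "\<bar>edge_shift v x T - edge_shift v y U\<bar> \<le> \<bar>T - U\<bar> + 1 / (1 - b) * \<bar>x - y\<bar>"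
proof -
  have "\<bar>v\<bar> / (1 - \<bar>v\<bar>) \<le> 1 / (1 - b)" using assms by (intro frac_le) auto
  moreover have "\<bar>\<bar>v\<bar> / (1 - \<bar>v\<bar>) * (x - y)\<bar> = \<bar>v\<bar> / (1 - \<bar>v\<bar>) * \<bar>x - y\<bar>"
    using assms by (simp add: abs_mult)
  ultimately have "\<bar>\<bar>v\<bar> / (1 - \<bar>v\<bar>) * (x - y)\<bar> \<le> 1 / (1 - b) * \<bar>x - y\<bar>"
    using mult_right_mono by (metis abs_ge_zero)
  then have "\<bar>(x - max 0 v) / (1 - \<bar>v\<bar>) - x - ((y - max 0 v) / (1 - \<bar>v\<bar>) - y)\<bar> \<le> 1 / (1 - b) * \<bar>x - y\<bar>"
    using edge_shift_slope[of v x y] assms by simp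
  moreover have "0 \<le> 1 / (1 - b) * \<bar>x - y\<bar>" using assms by simp
  ultimately show ?thesis
    unfolding edge_shift_def
    by (intro max_min_lip order_trans[OF edge_lip(1)] order_trans[OF edge_lip(2)]) linarith+
qed

lemma edge_shift_box:
  assumes "\<bar>v\<bar> < 1"
  shows "lower_edge v T \<le> x \<and> x \<le> 1 + upper_edge v T \<longleftrightarrow>
     0 \<le> x + edge_shift v x T \<and> x + edge_shift v x T \<le> 1"
proof -
  define L where "L = (x - max 0 v) / (1 - \<bar>v\<bar>)"
  have e: "x + edge_shift v x T = max (x - lower_edge v T) (min (x - upper_edge v T) L)"
    unfolding edge_shift_def L_def by (simp add: max_def min_def)
  \<comment> \<open>The middle piece vanishes at \<open>max 0 v\<close>, which is not below the
    lower edge, and equals 1 at \<open>1 + min 0 v\<close>, which is not above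
    \<open>1 + upper_edge v T\<close>.\<close>
  have 1: "L < 0" if "x < max 0 v"
    using that assms unfolding L_def by (simp add: divide_neg_pos)
  have 2: "L > 1" if "x > 1 + min 0 v"
  proof -
    have "x - max 0 v > 1 - \<bar>v\<bar>" using that by linarith
    then show ?thesis using assms unfolding L_def by simp
  qed
  show ?thesis unfolding e
    using edge_bounds[of v T] 1 2 by (intro max_min_unit upper_edge_le_lower_edge) linarith+
qed

text \<open>Put the unit box at \<open>a\<close> below and its translate by \<open>w\<close> above a common horizontal plane, and
  tilt that plane to height \<open>dm - dp\<close>: then all horizontal sections become boxes.\<close>

lemma tilted_section:
  fixes x a w :: "real^'n" and l :: 'n
  defines "dm \<equiv> boxdist l (x - a)" and "dp \<equiv> boxdist l (x - a - w)"
  shows "(T \<le> dm - dp \<and> dm \<le> 0) \<or> (dm - dp \<le> T \<and> dp \<le> 0) \<longleftrightarrow>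
     (\<forall>j. j \<noteq> l \<longrightarrow> lower_edge (w$j) T \<le> x$j - a$j \<and> x$j - a$j \<le> 1 + upper_edge (w$j) T)"
proof -
  have nn: "0 \<le> dm" "0 \<le> dp" by (simp_all add: dm_def dp_def boxdist_nonneg)
  \<comment> \<open>On the lower cube the tilted plane has height \<open>- dp\<close>, on the upper
    one height \<open>dm\<close>. Being on the correct side of it thus compares the distance to the
    other cube with \<open>T\<close>, and this decouples into two neighbourhoods of cubes.\<close>
  have "(T \<le> dm - dp \<and> dm \<le> 0) \<or> (dm - dp \<le> T \<and> dp \<le> 0) \<longleftrightarrow> dm \<le> max 0 T \<and> dp \<le> max 0 (- T)"
    using nn by linarith
  also have "\<dots> \<longleftrightarrow> (\<forall>j. j \<noteq> l \<longrightarrow> (- max 0 T \<le> x$j - a$j \<and> x$j - a$j \<le> 1 + max 0 T)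
      \<and> (- max 0 (- T) \<le> x$j - a$j - w$j \<and> x$j - a$j - w$j \<le> 1 + max 0 (- T)))"
    unfolding dm_def dp_def by (subst (1 2) boxdist_le_iff) auto
  also have "\<dots> \<longleftrightarrow> (\<forall>j. j \<noteq> l \<longrightarrow> lower_edge (w$j) T \<le> x$j - a$j \<and> x$j - a$j \<le> 1 + upper_edge (w$j) T)"
  proof -
    have "((- max 0 T \<le> y \<and> y \<le> 1 + max 0 T) \<and> (- max 0 (- T) \<le> y - v \<and> y - v \<le> 1 + max 0 (- T)))
      \<longleftrightarrow> lower_edge v T \<le> y \<and> y \<le> 1 + upper_edge v T" for y v
    proof -
      have "lower_edge v T \<le> y \<longleftrightarrow> - max 0 T \<le> y \<and> v - max 0 (- T) \<le> y"
        unfolding lower_edge_def by (rule max.bounded_iff)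
      moreover have "y - 1 \<le> upper_edge v T \<longleftrightarrow> y - 1 \<le> max 0 T \<and> y - 1 \<le> v + max 0 (- T)"
        unfolding upper_edge_def by (rule min.bounded_iff)
      ultimately show ?thesis by auto
    qed
    then show ?thesis by simp
  qed
  finally show ?thesis .
qed

section \<open>Refining a stack of slabs\<close>

definition lip :: "('a::real_normed_vector \<Rightarrow> real) \<Rightarrow> bool" where
  "lip f \<longleftrightarrow> (\<exists>B\<ge>0. \<forall>x y. \<bar>f x - f y\<bar> \<le> B * norm (x - y))"

lemma lipI: "0 \<le> B \<Longrightarrow> (\<And>x y. \<bar>f x - f y\<bar> \<le> B * norm (x - y)) \<Longrightarrow> lip f"
  unfolding lip_def by blast

lemma lip_const: "lip (\<lambda>x. a)"
  by (rule lipI[of 0]) auto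

lemma lip_component: "lip (\<lambda>z::real^'n. z$j)"
  by (rule lipI[of 1]) (use component_le_norm_cart[of "_ - _" j] in auto)

lemma lip_combine:
  assumes "lip f" "lip g" "0 \<le> a" "0 \<le> b"
    "\<And>x y. \<bar>h x - h y\<bar> \<le> a * \<bar>f x - f y\<bar> + b * \<bar>g x - g y\<bar>"
  shows "lip h"
proof -
  obtain B where B: "B \<ge> 0" "\<And>x y. \<bar>f x - f y\<bar> \<le> B * norm (x - y)" using assms(1) lip_def by blast
  obtain C where C: "C \<ge> 0" "\<And>x y. \<bar>g x - g y\<bar> \<le> C * norm (x - y)" using assms(2) lip_def by blast
  have "\<bar>h x - h y\<bar> \<le> (a * B + b * C) * norm (x - y)" for x y
    using assms(5)[of x y] mult_left_mono[OF B(2)[of x y] assms(3)] mult_left_mono[OF C(2)[of x y] assms(4)]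
    by (simp add: algebra_simps)
  then show ?thesis using B C assms by (intro lipI[of "a * B + b * C"]) auto
qed

lemma lip_add: "lip f \<Longrightarrow> lip g \<Longrightarrow> lip (\<lambda>x. f x + g x)"
  by (rule lip_combine[of f g 1 1]) auto

lemma lip_diff: "lip f \<Longrightarrow> lip g \<Longrightarrow> lip (\<lambda>x. f x - g x)"
  by (rule lip_combine[of f g 1 1]) auto

lemma lip_cmult: "lip f \<Longrightarrow> lip (\<lambda>x. a * f x)"
  by (rule lip_combine[of f f "\<bar>a\<bar>" 0]) (auto simp flip: abs_mult right_diff_distrib)

lemma lip_mult:
  assumes "lip f" "lip g" "\<And>x. \<bar>f x\<bar> \<le> a" "\<And>x. \<bar>g x\<bar> \<le> b"
  shows "lip (\<lambda>x. f x * g x)"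
proof (rule lip_combine[OF assms(1,2)])
  show "0 \<le> b" "0 \<le> a" using assms(3,4) abs_ge_zero order_trans by blast+
  fix x y
  have "f x * g x - f y * g y = (f x - f y) * g x + f y * (g x - g y)" by (simp add: algebra_simps)
  then have "\<bar>f x * g x - f y * g y\<bar> \<le> \<bar>f x - f y\<bar> * \<bar>g x\<bar> + \<bar>f y\<bar> * \<bar>g x - g y\<bar>"
    by (metis abs_mult abs_triangle_ineq)
  also have "\<dots> \<le> \<bar>f x - f y\<bar> * b + a * \<bar>g x - g y\<bar>"
    using assms(3,4) by (intro add_mono mult_mono) (auto intro: order_trans[OF abs_ge_zero])
  finally show "\<bar>f x * g x - f y * g y\<bar> \<le> b * \<bar>f x - f y\<bar> + a * \<bar>g x - g y\<bar>"
    by (simp add: mult.commute)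
qed

lemma lip_sum: "(\<And>i. i \<in> I \<Longrightarrow> lip (f i)) \<Longrightarrow> lip (\<lambda>x. \<Sum>i\<in>I. f i x)"
  by (induction I rule: infinite_finite_induct) (auto intro: lip_const lip_add)

lemma lip_vector:
  fixes F :: "real^'n \<Rightarrow> real^'n"
  assumes "\<And>j. lip (\<lambda>z. F z $ j)"
  shows "\<exists>B. B-lipschitz_on UNIV F"
proof -
  have "\<exists>B. B \<ge> 0 \<and> (\<forall>x y. \<bar>F x $ j - F y $ j\<bar> \<le> B * norm (x - y))" for j
    using assms[of j] unfolding lip_def by blast
  then obtain B where B: "\<And>j. B j \<ge> 0" "\<And>j x y. \<bar>F x $ j - F y $ j\<bar> \<le> B j * norm (x - y)" by metis
  have "(\<Sum>j\<in>UNIV. B j)-lipschitz_on UNIV F"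
  proof (rule lipschitz_onI)
    show "0 \<le> (\<Sum>j\<in>UNIV. B j)" using B by (simp add: sum_nonneg)
    fix x y
    have "dist (F x) (F y) \<le> (\<Sum>j\<in>UNIV. \<bar>(F x - F y) $ j\<bar>)" unfolding dist_norm by (rule norm_le_l1_cart)
    also have "\<dots> \<le> (\<Sum>j\<in>UNIV. B j * norm (x - y))" by (rule sum_mono) (use B in simp)
    finally show "dist (F x) (F y) \<le> (\<Sum>j\<in>UNIV. B j) * dist x y" by (simp add: dist_norm sum_distrib_right)
  qed
  then show ?thesis by blast
qed

text \<open>Both bounds on the height are weak, so at an interface the stack contains the cubes of
  the slab below and of the slab above, as the tile does.\<close>

definition stack :: "'n::finite \<Rightarrow> nat \<Rightarrow> (nat \<Rightarrow> 'n \<Rightarrow> real \<Rightarrow> real) \<Rightarrow> (real^'n) set" where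
  "stack l N P = {z. \<exists>i<N. real i \<le> real N * z$l \<and> real N * z$l \<le> real i + 1 \<and>
     (\<forall>j. j \<noteq> l \<longrightarrow> P i j (z$l) \<le> z$j \<and> z$j \<le> P i j (z$l) + 1)}"

text \<open>Between the heights \<open>i / N\<close> and \<open>(i + 1) / N\<close> the two stacks follow the paths \<open>P i\<close> and
  \<open>R i\<close>.  Only at the interfaces in \<open>new\<close> does the displacement \<open>P - R\<close> jump, and near these the
  paths are constant on either side.\<close>

locale slab_step =
  fixes l :: "'n::finite" and N :: nat and e vb \<delta> Lc :: real
    and P R :: "nat \<Rightarrow> 'n \<Rightarrow> real \<Rightarrow> real" and c :: "'n \<Rightarrow> real \<Rightarrow> real"
    and v A B :: "nat \<Rightarrow> 'n \<Rightarrow> real" and new :: "nat set"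
  assumes N: "0 < N" and e: "0 < e" "e \<le> 1/4" and vb: "0 \<le> vb" "vb < 1"
    and c_lip: "\<And>j s t. \<bar>c j s - c j t\<bar> \<le> Lc * \<bar>s - t\<bar>"
    and c_out: "\<And>j t. t \<le> 0 \<Longrightarrow> c j t = c j 0" "\<And>j t. 1 \<le> t \<Longrightarrow> c j t = c j 1"
    and new: "new \<subseteq> {1..<N}"
    and v_old: "\<And>i j. i \<notin> new \<Longrightarrow> v i j = 0"
    and v_bound: "\<And>i j. \<bar>v i j\<bar> \<le> vb"
    and path: "\<And>i j t. i < N \<Longrightarrow> real i \<le> real N * t \<Longrightarrow> real N * t \<le> real i + 1 \<Longrightarrow>
        P i j t = R i j t + c j t + (\<Sum>k=1..i. v k j)"
    and path_bound: "\<And>i j t. i < N \<Longrightarrow> real i \<le> real N * t \<Longrightarrow> real N * t \<le> real i + 1 \<Longrightarrow> \<bar>P i j t - R i j t\<bar> \<le> \<delta>"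
    and left: "\<And>i j t. i \<in> new \<Longrightarrow> \<bar>real N * t - real i\<bar> \<le> e \<Longrightarrow> real N * t \<le> i \<Longrightarrow>
        P (i - 1) j t = A i j \<and> R (i - 1) j t = B i j"
    and right: "\<And>i j t. i \<in> new \<Longrightarrow> \<bar>real N * t - real i\<bar> \<le> e \<Longrightarrow> i \<le> real N * t \<Longrightarrow>
        P i j t = A i j + v i j \<and> R i j t = B i j"
begin

section \<open>The straightening map: tilting interfaces, then shifting coordinates\<close>

definition bump :: "nat \<Rightarrow> real \<Rightarrow> real" where
  "bump i t = max 0 (1 - \<bar>real N * t - real i\<bar> / e)"

text \<open>The height of the tilted plane in \<open>tilted_section\<close>, for the cube at
  \<open>A i\<close> and its translate by \<open>v i\<close>, before division by
  \<open>S\<close>.\<close>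

definition tau :: "nat \<Rightarrow> real^'n \<Rightarrow> real" where
  "tau i x = boxdist l (x - (\<chi> j. A i j)) - boxdist l (x - (\<chi> j. A i j) - (\<chi> j. v i j))"

definition tilt :: "real \<Rightarrow> real^'n \<Rightarrow> real \<Rightarrow> real" where
  "tilt S x t = t + 1 / S * (\<Sum>i\<in>{1..<N}. bump i t * tau i x)"

text \<open>Multiplying the height above the interface by \<open>S\<close> undoes the division in
  \<open>tilt\<close>, so each term sees the geometry of \<open>tilted_section\<close>. Well above
  interface \<open>i\<close> the term is \<open>- v i j\<close>, well below it is 0: the sum removes
  the accumulated jumps.\<close>

definition shift :: "real \<Rightarrow> 'n \<Rightarrow> real \<Rightarrow> real \<Rightarrow> real" where
  "shift S j y u = (\<Sum>i\<in>{1..<N}. edge_shift (v i j) (y - A i j) (S * (u - real i / real N)))"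

text \<open>Shift and drift are read off at the new height \<open>u\<close>. For fixed
  \<open>u\<close> every horizontal coordinate is then moved independently of the others, which is
  what makes the map invertible by one-dimensional arguments.\<close>

definition straighten :: "real \<Rightarrow> real^'n \<Rightarrow> real^'n" where
  "straighten S z = (\<chi> j. let u = tilt S z (z$l) in if j = l then u else z$j + shift S j (z$j) u - c j u)"

lemma v_less: "\<bar>v i j\<bar> < 1"
  using v_bound[of i j] vb by linarith

lemma tau_bound: "\<bar>tau i x\<bar> \<le> vb"
proof -
  have "\<bar>boxdist l (x - (\<chi> j. A i j)) - boxdist l (x - (\<chi> j. A i j) - (\<chi> j. v i j))\<bar> \<le> vb"
    by (rule boxdist_diff_le) (use v_bound vb in auto)
  then show ?thesis by (simp add: tau_def)
qed

lemma tau_old: "i \<notin> new \<Longrightarrow> tau i x = 0"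
proof -
  assume "i \<notin> new"
  then have "(\<chi> j. v i j) = 0" using v_old by (simp add: vec_eq_iff)
  then show ?thesis by (simp add: tau_def)
qed

lemma tau_diff:
  assumes "\<And>j. j \<noteq> l \<Longrightarrow> \<bar>x$j - y$j\<bar> \<le> b" "0 \<le> b"
  shows "\<bar>tau i x - tau i y\<bar> \<le> 2 * b"
proof -
  have "\<bar>boxdist l (x - (\<chi> j. A i j)) - boxdist l (y - (\<chi> j. A i j))\<bar> \<le> b"
    by (rule boxdist_diff_le) (use assms in auto)
  moreover have "\<bar>boxdist l (x - (\<chi> j. A i j) - (\<chi> j. v i j)) - boxdist l (y - (\<chi> j. A i j) - (\<chi> j. v i j))\<bar> \<le> b"
    by (rule boxdist_diff_le) (use assms in auto)
  ultimately show ?thesis unfolding tau_def by linarith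
qed

lemma tau_cong: "(\<And>j. j \<noteq> l \<Longrightarrow> x$j = y$j) \<Longrightarrow> tau i x = tau i y"
  using tau_diff[of x y 0 i] by simp

lemma bump_range: "0 \<le> bump i t" "bump i t \<le> 1"
  using e by (auto simp: bump_def)

lemma bump_far: "e \<le> \<bar>real N * t - real i\<bar> \<Longrightarrow> bump i t = 0"
  using e by (simp add: bump_def)

lemma bump_lip: "\<bar>bump i s - bump i t\<bar> \<le> real N / e * \<bar>s - t\<bar>"
proof -
  have "\<bar>\<bar>real N * s - real i\<bar> / e - \<bar>real N * t - real i\<bar> / e\<bar> = \<bar>\<bar>real N * s - real i\<bar> - \<bar>real N * t - real i\<bar>\<bar> / e"
    using e by (simp add: diff_divide_distrib[symmetric])
  also have "\<dots> \<le> \<bar>real N * s - real N * t\<bar> / e" using e by (intro divide_right_mono) auto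
  also have "\<dots> = real N / e * \<bar>s - t\<bar>" using N by (simp add: abs_mult flip: right_diff_distrib)
  finally show ?thesis unfolding bump_def by (auto simp: max_def abs_le_iff)
qed

text \<open>Interfaces are one unit apart and \<open>e \<le> 1/4\<close>, so the tents
  \<open>bump\<close> do not overlap and each height feels at most one interface.\<close>

lemma near_unique:
  assumes "\<bar>real N * t - real i\<bar> \<le> e" "i' \<noteq> i"
  shows "e \<le> \<bar>real N * t - real i'\<bar>"
proof -
  have "1 \<le> \<bar>real i - real i'\<bar>" using assms(2) by linarith
  then show ?thesis using assms(1) e by linarith
qed

lemma tilt_near:
  assumes "i \<in> new" "\<bar>real N * t - real i\<bar> \<le> e"
  shows "tilt S x t = t + 1 / S * (bump i t * tau i x)"
proof -
  have "(\<Sum>k\<in>{1..<N}. bump k t * tau k x) = (\<Sum>k\<in>{1..<N}. if k = i then bump i t * tau i x else 0)"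
    by (rule sum.cong) (use near_unique[OF assms(2)] bump_far in auto)
  then show ?thesis using assms(1) new unfolding tilt_def by auto
qed

lemma tilt_far:
  assumes "\<And>i. i \<in> new \<Longrightarrow> e \<le> \<bar>real N * t - real i\<bar>"
  shows "tilt S x t = t"
proof -
  have "bump k t * tau k x = 0" for k
    using bump_far[of t k] assms tau_old by (cases "k \<in> new") auto
  then show ?thesis unfolding tilt_def by (simp only: sum.neutral_const mult_zero_right add_0_right)
qed

lemma tilt_bound:
  assumes "0 < S"
  shows "\<bar>tilt S x t - t\<bar> \<le> real N / S"
proof -
  have "\<bar>\<Sum>i\<in>{1..<N}. bump i t * tau i x\<bar> \<le> (\<Sum>i\<in>{1..<N}. 1)"
  proof (rule order_trans[OF sum_abs], rule sum_mono)
    fix i show "\<bar>bump i t * tau i x\<bar> \<le> 1"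
      using bump_range[of i t] tau_bound[of i x] vb by (simp add: abs_mult mult_le_one)
  qed
  also have "\<dots> \<le> N" by simp
  finally show ?thesis using assms by (simp add: tilt_def abs_mult divide_right_mono)
qed

text \<open>Fewer than \<open>N\<close> tents of slope at most \<open>N / e\<close>, with weights at
  most 1, are divided by \<open>S\<close>; the factor 2 in the hypothesis leaves slope at most 1/2.
  Adding the identity therefore gives an increasing function of the height.\<close>

lemma tilt_contract:
  assumes "2 * real N * real N / e \<le> S"
  shows "\<bar>(tilt S x t - t) - (tilt S x s - s)\<bar> \<le> \<bar>t - s\<bar> / 2"
proof -
  have S: "0 < S" using assms N e by (meson divide_pos_pos less_le_trans mult_pos_pos of_nat_0_less_iff zero_less_numeral)
  have "\<bar>(\<Sum>i\<in>{1..<N}. bump i t * tau i x) - (\<Sum>i\<in>{1..<N}. bump i s * tau i x)\<bar>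
     \<le> (\<Sum>i\<in>{1..<N}. real N / e * \<bar>t - s\<bar>)"
    unfolding sum_subtractf[symmetric]
  proof (rule order_trans[OF sum_abs], rule sum_mono)
    fix i
    have "\<bar>bump i t * tau i x - bump i s * tau i x\<bar> = \<bar>bump i t - bump i s\<bar> * \<bar>tau i x\<bar>"
      by (simp add: abs_mult flip: left_diff_distrib)
    also have "\<dots> \<le> (real N / e * \<bar>t - s\<bar>) * 1"
      using bump_lip[of i t s] tau_bound[of i x] vb by (intro mult_mono) auto
    finally show "\<bar>bump i t * tau i x - bump i s * tau i x\<bar> \<le> real N / e * \<bar>t - s\<bar>" by simp
  qed
  also have "\<dots> \<le> real N * (real N / e * \<bar>t - s\<bar>)"
    using e by (simp add: mult_right_mono divide_right_mono)
  also have "\<dots> = (real N * real N / e) * \<bar>t - s\<bar>" by simp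
  also have "\<dots> \<le> (S / 2) * \<bar>t - s\<bar>"
  proof (rule mult_right_mono)
    have "2 * real N * real N / e = 2 * (real N * real N / e)" by simp
    then show "real N * real N / e \<le> S / 2" using assms by linarith
  qed simp
  finally have "1 / S * \<bar>(\<Sum>i\<in>{1..<N}. bump i t * tau i x) - (\<Sum>i\<in>{1..<N}. bump i s * tau i x)\<bar>
     \<le> 1 / S * ((S / 2) * \<bar>t - s\<bar>)" using S by (intro mult_left_mono) auto
  then show ?thesis using S by (simp add: tilt_def abs_mult flip: right_diff_distrib diff_divide_distrib)
qed

lemma tilt_mono:
  assumes "2 * real N * real N / e \<le> S"
  shows "tilt S x s \<le> tilt S x t \<longleftrightarrow> s \<le> t"
  using tilt_contract[OF assms, of x t s] by (auto simp: abs_le_iff abs_if split: if_splits)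

text \<open>At distance \<open>e / N\<close> from the interface the rescaled height is at least 1 in
  modulus, hence beyond \<open>\<bar>v i j\<bar>\<close>, where the edge shift is constant.\<close>

lemma edge_term_far:
  assumes "real N / e \<le> S" "e \<le> \<bar>real N * u - real i\<bar>"
  shows "edge_shift (v i j) y (S * (u - real i / real N)) = (if real i \<le> real N * u then - v i j else 0)"
proof -
  have Ne: "0 < real N / e" using N e by simp
  have eq: "S * (u - real i / real N) = S / real N * (real N * u - real i)"
    using N by (simp add: field_simps)
  have "1 \<le> S / real N * e" using assms(1) N e by (simp add: field_simps)
  also have "\<dots> \<le> S / real N * \<bar>real N * u - real i\<bar>"
    using assms Ne by (intro mult_left_mono) auto
  finally have "1 \<le> \<bar>S * (u - real i / real N)\<bar>"
    using assms(1) Ne by (simp add: eq abs_mult)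
  moreover have "0 \<le> S * (u - real i / real N) \<longleftrightarrow> real i \<le> real N * u"
    using assms(1) Ne N unfolding eq by (simp add: zero_le_mult_iff zero_le_divide_iff)
  ultimately show ?thesis
    using edge_shift_left[of "S * (u - real i / real N)" "v i j"] edge_shift_right[of "v i j" "S * (u - real i / real N)"]
      v_less[of i j] by (cases "real i \<le> real N * u") auto
qed

lemma S_large: "2 * real N * real N / e \<le> S \<Longrightarrow> real N / e \<le> S" "2 * real N * real N / e \<le> S \<Longrightarrow> 0 < S"
proof -
  assume *: "2 * real N * real N / e \<le> S"
  have "real N * 1 \<le> real N * (2 * real N)" using N by (intro mult_left_mono) auto
  then have "real N / e \<le> 2 * real N * real N / e" using e by (intro divide_right_mono) auto
  then show "real N / e \<le> S" using * by linarith
  moreover have "0 < real N / e" using N e by simp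
  ultimately show "0 < S" by linarith
qed

text \<open>The alternatives \<open>m = 0\<close> and \<open>Suc m = N\<close> extend the lowest and
  the highest slab to infinity, because the map must be controlled on the whole space.\<close>

lemma shift_far:
  assumes "real N / e \<le> S" "m < N" "real m \<le> real N * u \<or> m = 0" "real N * u \<le> real m + 1 \<or> Suc m = N"
    and far: "\<And>i. i \<in> new \<Longrightarrow> e \<le> \<bar>real N * u - real i\<bar>"
  shows "shift S j y u = - (\<Sum>k=1..m. v k j)"
proof -
  have "edge_shift (v i j) (y - A i j) (S * (u - real i / real N)) = (if i \<le> m then - v i j else 0)"
    if "i \<in> {1..<N}" for i
  proof (cases "i \<in> new")
    case True
    have "real i \<le> real N * u \<longleftrightarrow> i \<le> m"
    proof
      assume "i \<le> m"
      then show "real i \<le> real N * u" using assms(3) that by auto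
    next
      assume "real i \<le> real N * u"
      then have "real i < real N * u" using far[OF True] e by linarith
      then show "i \<le> m" using assms(4) that by auto
    qed
    then show ?thesis using edge_term_far[OF assms(1) far[OF True]] by simp
  next
    case False
    then show ?thesis by (simp add: v_old edge_shift_zero)
  qed
  then have "shift S j y u = (\<Sum>i\<in>{1..<N}. if i \<le> m then - v i j else 0)"
    unfolding shift_def by (rule sum.cong[OF refl])
  also have "\<dots> = (\<Sum>i\<in>{1..<N} \<inter> {i. i \<le> m}. - v i j)" by (simp add: sum.If_cases)
  also have "{1..<N} \<inter> {i. i \<le> m} = {1..m}" using assms(2) by auto
  finally show ?thesis by (simp add: sum_negf)
qed

lemma shift_near:
  assumes "real N / e \<le> S" "i \<in> new" "\<bar>real N * u - real i\<bar> \<le> e"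
  shows "shift S j y u = edge_shift (v i j) (y - A i j) (S * (u - real i / real N)) - (\<Sum>k=1..<i. v k j)"
proof -
  have i: "i \<in> {1..<N}" using assms(2) new by auto
  have t: "edge_shift (v k j) (y - A k j) (S * (u - real k / real N)) = (if k < i then - v k j else 0)"
    if "k \<in> {1..<N} - {i}" for k
  proof -
    have "k \<noteq> i" using that by auto
    then have "e \<le> \<bar>real N * u - real k\<bar>" by (rule near_unique[OF assms(3)])
    moreover have "real k \<le> real N * u \<longleftrightarrow> k < i"
    proof (cases "k < i")
      case True
      then have "real k + 1 \<le> real i" by linarith
      then show ?thesis using True assms(3) e by linarith
    next
      case False
      then have "real i + 1 \<le> real k" using \<open>k \<noteq> i\<close> by linarith
      then show ?thesis using False assms(3) e by linarith
    qed
    ultimately show ?thesis using edge_term_far[OF assms(1)] by simp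
  qed
  have "shift S j y u = edge_shift (v i j) (y - A i j) (S * (u - real i / real N))
      + (\<Sum>k\<in>{1..<N} - {i}. edge_shift (v k j) (y - A k j) (S * (u - real k / real N)))"
    unfolding shift_def using i by (simp add: sum.remove)
  also have "(\<Sum>k\<in>{1..<N} - {i}. edge_shift (v k j) (y - A k j) (S * (u - real k / real N)))
      = (\<Sum>k\<in>{1..<N} - {i}. if k < i then - v k j else 0)"
    by (rule sum.cong[OF refl t])
  also have "\<dots> = (\<Sum>k\<in>({1..<N} - {i}) \<inter> {k. k < i}. - v k j)" by (simp add: sum.If_cases)
  also have "({1..<N} - {i}) \<inter> {k. k < i} = {1..<i}" using i by auto
  finally show ?thesis by (simp add: sum_negf)
qed

text \<open>On either side of a new interface \<open>P\<close> and \<open>R\<close> are constant by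
  \<open>left\<close> and \<open>right\<close>, and the jump \<open>v i j\<close> on the right is
  counted in the sum for slab \<open>i\<close>; what remains of \<open>path\<close> is the same
  constant on both sides.\<close>

lemma c_near:
  assumes "i \<in> new" "\<bar>real N * u - real i\<bar> \<le> e"
  shows "c j u = A i j - B i j - (\<Sum>k=1..<i. v k j)"
proof -
  have i: "1 \<le> i" "i < N" using assms(1) new by auto
  show ?thesis
  proof (cases "real N * u \<le> real i")
    case True
    have "P (i - 1) j u = R (i - 1) j u + c j u + (\<Sum>k=1..i - 1. v k j)"
      by (rule path) (use i True assms(2) e in \<open>auto simp: of_nat_diff\<close>)
    moreover have "{1..i - 1} = {1..<i}" using i by auto
    ultimately show ?thesis using left[OF assms True, of j] by simp
  next
    case False
    then have F: "real i \<le> real N * u" by simp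
    have "P i j u = R i j u + c j u + (\<Sum>k=1..i. v k j)"
      by (rule path) (use i F assms(2) e in auto)
    moreover have "{1..i} = insert i {1..<i}" using i by auto
    ultimately show ?thesis using right[OF assms F, of j] by simp
  qed
qed

text \<open>All tents vanish at both ends of the window around the interface, so the monotone tilt
  fixes these ends and preserves the window.\<close>

lemma tilt_range:
  assumes S: "2 * real N * real N / e \<le> S" and i: "i \<in> new" "\<bar>real N * t - real i\<bar> \<le> e"
  shows "\<bar>real N * tilt S x t - real i\<bar> \<le> e"
proof -
  have fx: "tilt S x s = s" if s: "\<bar>real N * s - real i\<bar> = e" for s
  proof (rule tilt_far)
    fix k show "e \<le> \<bar>real N * s - real k\<bar>"
      using near_unique[of s i k] s by (cases "k = i") auto
  qed
  define s1 where "s1 = (real i - e) / real N"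
  define s2 where "s2 = (real i + e) / real N"
  have "tilt S x s1 = s1" "tilt S x s2 = s2" using N e by (auto intro!: fx simp: s1_def s2_def)
  moreover have "s1 \<le> t" "t \<le> s2" using i(2) N by (auto simp: s1_def s2_def field_simps)
  ultimately have "s1 \<le> tilt S x t" "tilt S x t \<le> s2" using tilt_mono[OF S] by metis+
  then show ?thesis using N by (auto simp: s1_def s2_def field_simps)
qed

lemma straighten_l [simp]: "straighten S z $ l = tilt S z (z$l)"
  by (simp add: straighten_def Let_def)

lemma straighten_j: "j \<noteq> l \<Longrightarrow> straighten S z $ j =
    z$j + shift S j (z$j) (tilt S z (z$l)) - c j (tilt S z (z$l))"
  by (simp add: straighten_def Let_def)

text \<open>The accumulated jumps in \<open>shift_near\<close> and in \<open>c_near\<close> cancel,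
  leaving the shift of this one interface and a change of frame from \<open>A i\<close> to
  \<open>B i\<close>.\<close>

lemma straighten_near:
  assumes S: "2 * real N * real N / e \<le> S" and i: "i \<in> new" "\<bar>real N * z$l - real i\<bar> \<le> e" and j: "j \<noteq> l"
  shows "straighten S z $ j = z$j - A i j +
     edge_shift (v i j) (z$j - A i j) (S * (tilt S z (z$l) - real i / real N)) + B i j"
  using shift_near[OF S_large(1)[OF S] i(1) tilt_range[OF S i]] c_near[OF i(1) tilt_range[OF S i]] j
  by (simp add: straighten_j)

lemma straighten_far:
  assumes S: "2 * real N * real N / e \<le> S"
    and "m < N" "real m \<le> real N * z$l \<or> m = 0" "real N * z$l \<le> real m + 1 \<or> Suc m = N"
    and far: "\<And>i. i \<in> new \<Longrightarrow> e \<le> \<bar>real N * z$l - real i\<bar>" and j: "j \<noteq> l"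
  shows "straighten S z $ j = z$j - (c j (z$l) + (\<Sum>k=1..m. v k j))"
  using shift_far[OF S_large(1)[OF S] assms(2-5)] tilt_far[OF far] j by (simp add: straighten_j)

lemma stack_near:
  assumes i: "i \<in> new" "\<bar>real N * z$l - real i\<bar> \<le> e"
  shows "z \<in> stack l N P \<longleftrightarrow>
      (real N * z$l \<le> real i \<and> (\<forall>j. j \<noteq> l \<longrightarrow> 0 \<le> z$j - A i j \<and> z$j - A i j \<le> 1)) \<or>
      (real i \<le> real N * z$l \<and> (\<forall>j. j \<noteq> l \<longrightarrow> 0 \<le> z$j - A i j - v i j \<and> z$j - A i j - v i j \<le> 1))"
    "z \<in> stack l N R \<longleftrightarrow> (\<forall>j. j \<noteq> l \<longrightarrow> 0 \<le> z$j - B i j \<and> z$j - B i j \<le> 1)"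
proof -
  have iN: "1 \<le> i" "i < N" using i(1) new by auto
  have st: "z \<in> stack l N Q \<longleftrightarrow>
    (real N * z$l \<le> real i \<and> (\<forall>j. j \<noteq> l \<longrightarrow> Q (i - 1) j (z$l) \<le> z$j \<and> z$j \<le> Q (i - 1) j (z$l) + 1)) \<or>
    (real i \<le> real N * z$l \<and> (\<forall>j. j \<noteq> l \<longrightarrow> Q i j (z$l) \<le> z$j \<and> z$j \<le> Q i j (z$l) + 1))" (is "_ \<longleftrightarrow> ?r")
    for Q :: "nat \<Rightarrow> 'n \<Rightarrow> real \<Rightarrow> real"
  proof
    assume "z \<in> stack l N Q"
    then obtain k where k: "k < N" "real k \<le> real N * z$l" "real N * z$l \<le> real k + 1"
      "\<forall>j. j \<noteq> l \<longrightarrow> Q k j (z$l) \<le> z$j \<and> z$j \<le> Q k j (z$l) + 1" by (auto simp: stack_def)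
    \<comment> \<open>As \<open>e \<le> 1/4\<close>, only the two slabs adjacent to the interface
      reach this height.\<close>
    have "k < i + 1" "i < k + 2"
      using k(2,3) i(2) e(2) by linarith+
    then consider "k = i" | "k = i - 1" by linarith
    then show ?r
    proof cases
      case 1 then show ?thesis using k by auto
    next
      case 2 then show ?thesis using k iN by (auto simp: of_nat_diff)
    qed
  next
    assume ?r
    then show "z \<in> stack l N Q"
    proof
      assume *: "real N * z$l \<le> real i \<and> (\<forall>j. j \<noteq> l \<longrightarrow> Q (i - 1) j (z$l) \<le> z$j \<and> z$j \<le> Q (i - 1) j (z$l) + 1)"
      moreover have "real (i - 1) \<le> real N * z$l" "real N * z$l \<le> real (i - 1) + 1"
        using * i(2) e(2) iN by (auto simp: of_nat_diff)
      ultimately show ?thesis using iN unfolding stack_def by (auto intro!: exI[of _ "i - 1"])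
    next
      assume *: "real i \<le> real N * z$l \<and> (\<forall>j. j \<noteq> l \<longrightarrow> Q i j (z$l) \<le> z$j \<and> z$j \<le> Q i j (z$l) + 1)"
      moreover have "real N * z$l \<le> real i + 1" using i(2) e(2) by linarith
      ultimately show ?thesis using iN unfolding stack_def by (auto intro!: exI[of _ i])
    qed
  qed
  have box: "q \<le> y \<and> y \<le> q + 1 \<longleftrightarrow> 0 \<le> y - q \<and> y - q \<le> 1" for q y :: real by auto
  show "z \<in> stack l N P \<longleftrightarrow>
      (real N * z$l \<le> real i \<and> (\<forall>j. j \<noteq> l \<longrightarrow> 0 \<le> z$j - A i j \<and> z$j - A i j \<le> 1)) \<or>
      (real i \<le> real N * z$l \<and> (\<forall>j. j \<noteq> l \<longrightarrow> 0 \<le> z$j - A i j - v i j \<and> z$j - A i j - v i j \<le> 1))"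
    unfolding st box using left[OF i] right[OF i] by (auto simp: diff_diff_eq)
  show "z \<in> stack l N R \<longleftrightarrow> (\<forall>j. j \<noteq> l \<longrightarrow> 0 \<le> z$j - B i j \<and> z$j - B i j \<le> 1)"
    unfolding st box using left[OF i] right[OF i] linear[of "real N * z$l" "real i"] by auto
qed

text \<open>Near a new interface, lying above or below it becomes a comparison of the rescaled new
  height with \<open>tau\<close>; \<open>tilted_section\<close> makes the section a box and
  \<open>edge_shift_box\<close> sends that box to the cube at \<open>B i\<close>. Elsewhere the map
  translates each section horizontally by \<open>R - P\<close>.\<close>

lemma straighten_stack:
  assumes S: "2 * real N * real N / e \<le> S"
  shows "z \<in> stack l N P \<longleftrightarrow> straighten S z \<in> stack l N R"
proof (cases "\<exists>i\<in>new. \<bar>real N * z$l - real i\<bar> \<le> e")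
  case True
  then obtain i where i: "i \<in> new" "\<bar>real N * z$l - real i\<bar> \<le> e" by blast
  define u where "u = tilt S z (z$l)"
  define T where "T = S * (u - real i / real N)"
  have S0: "0 < S" by (rule S_large(2)[OF S])
  have gi: "\<bar>real N * (real i / real N) - real i\<bar> \<le> e" using N e by simp
  have bi: "bump i (real i / real N) = 1" using N by (simp add: bump_def)
  have top: "tilt S z (real i / real N) = real i / real N + tau i z / S"
    using tilt_near[OF i(1) gi, of S z] bi by simp
  have le: "real N * z$l \<le> real i \<longleftrightarrow> T \<le> tau i z"
  proof -
    have "real N * z$l \<le> real i \<longleftrightarrow> z$l \<le> real i / real N" using N by (simp add: field_simps)
    also have "\<dots> \<longleftrightarrow> u \<le> real i / real N + tau i z / S"
      unfolding u_def using tilt_mono[OF S, of z "z$l" "real i / real N"] top by simp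
    also have "\<dots> \<longleftrightarrow> u - real i / real N \<le> tau i z / S" by linarith
    also have "\<dots> \<longleftrightarrow> T \<le> tau i z" unfolding T_def using S0 by (simp add: pos_le_divide_eq mult.commute)
    finally show ?thesis .
  qed
  have ge: "real i \<le> real N * z$l \<longleftrightarrow> tau i z \<le> T"
  proof -
    have "real i \<le> real N * z$l \<longleftrightarrow> real i / real N \<le> z$l" using N by (simp add: field_simps)
    also have "\<dots> \<longleftrightarrow> real i / real N + tau i z / S \<le> u"
      unfolding u_def using tilt_mono[OF S, of z "real i / real N" "z$l"] top by simp
    also have "\<dots> \<longleftrightarrow> tau i z / S \<le> u - real i / real N" by linarith
    also have "\<dots> \<longleftrightarrow> tau i z \<le> T" unfolding T_def using S0 by (simp add: pos_divide_le_eq mult.commute)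
    finally show ?thesis .
  qed
  have near': "\<bar>real N * straighten S z $ l - real i\<bar> \<le> e" using tilt_range[OF S i] by simp
  have "z \<in> stack l N P \<longleftrightarrow> (T \<le> tau i z \<and> boxdist l (z - (\<chi> j. A i j)) \<le> 0) \<or>
     (tau i z \<le> T \<and> boxdist l (z - (\<chi> j. A i j) - (\<chi> j. v i j)) \<le> 0)"
    unfolding stack_near(1)[OF i] le ge boxdist_le_0_iff by simp
  also have "\<dots> \<longleftrightarrow> (\<forall>j. j \<noteq> l \<longrightarrow> lower_edge (v i j) T \<le> z$j - A i j \<and> z$j - A i j \<le> 1 + upper_edge (v i j) T)"
    unfolding tau_def tilted_section by simp
  also have "\<dots> \<longleftrightarrow> (\<forall>j. j \<noteq> l \<longrightarrow> 0 \<le> straighten S z $ j - B i j \<and> straighten S z $ j - B i j \<le> 1)"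
    using straighten_near[OF S i] edge_shift_box[OF v_less] by (simp add: T_def u_def)
  also have "\<dots> \<longleftrightarrow> straighten S z \<in> stack l N R"
    using stack_near(2)[OF i(1) near'] by simp
  finally show ?thesis .
next
  case False
  then have far: "e \<le> \<bar>real N * z$l - real i\<bar>" if "i \<in> new" for i using that by force
  have l: "straighten S z $ l = z$l" using tilt_far[OF far] by simp
  have eq: "(\<forall>j. j \<noteq> l \<longrightarrow> P m j (z$l) \<le> z$j \<and> z$j \<le> P m j (z$l) + 1) \<longleftrightarrow>
     (\<forall>j. j \<noteq> l \<longrightarrow> R m j (z$l) \<le> straighten S z $ j \<and> straighten S z $ j \<le> R m j (z$l) + 1)"
    if m: "m < N" "real m \<le> real N * z$l" "real N * z$l \<le> real m + 1" for m
  proof -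
    have "P m j (z$l) \<le> z$j \<and> z$j \<le> P m j (z$l) + 1 \<longleftrightarrow>
      R m j (z$l) \<le> straighten S z $ j \<and> straighten S z $ j \<le> R m j (z$l) + 1" if "j \<noteq> l" for j
      using path[OF m, of j] straighten_far[OF S m(1) _ _ far that] m by auto
    then show ?thesis by blast
  qed
  show ?thesis unfolding stack_def mem_Collect_eq l by (intro ex_cong1 conj_cong refl eq; simp)
qed

end

section \<open>Bijectivity and metric estimates of the straightening map\<close>

context slab_step begin

lemma Lc_nonneg: "0 \<le> Lc"
  using c_lip[of undefined 1 0] by simp

lemma lip_bump: "lip (\<lambda>z::real^'n. bump i (z$l))"
  by (rule lip_combine[OF lip_component[of l] lip_const[of 0], of "real N / e" 0])
     (use bump_lip e in auto)

lemma lip_tau: "lip (tau i)"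
proof (rule lipI[of 2])
  fix x y :: "real^'n"
  show "\<bar>tau i x - tau i y\<bar> \<le> 2 * norm (x - y)"
    by (rule tau_diff) (use component_le_norm_cart[of "x - y"] in auto)
qed simp

lemma lip_tilt: "lip (\<lambda>z. tilt S z (z$l))"
  unfolding tilt_def
proof (intro lip_add lip_component lip_cmult lip_sum lip_mult[where a = 1 and b = 1] lip_bump lip_tau)
  fix i :: nat and x :: "real^'n"
  show "\<bar>bump i (x$l)\<bar> \<le> 1" using bump_range[of i "x$l"] by simp
  show "\<bar>tau i x\<bar> \<le> 1" using tau_bound[of i x] vb by simp
qed

lemma lip_shift: "lip (\<lambda>z. shift S j (z$j) (tilt S z (z$l)))"
  unfolding shift_def
proof (rule lip_sum)
  fix i
  show "lip (\<lambda>z. edge_shift (v i j) (z$j - A i j) (S * (tilt S z (z$l) - real i / real N)))"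
  proof (rule lip_combine[OF lip_cmult[OF lip_tilt[of S], of S] lip_component[of j], of 1 "1 / (1 - vb)"])
    fix x y
    show "\<bar>edge_shift (v i j) (x$j - A i j) (S * (tilt S x (x$l) - real i / real N))
      - edge_shift (v i j) (y$j - A i j) (S * (tilt S y (y$l) - real i / real N))\<bar>
      \<le> 1 * \<bar>S * tilt S x (x$l) - S * tilt S y (y$l)\<bar> + 1 / (1 - vb) * \<bar>x$j - y$j\<bar>"
      using edge_shift_lip[OF v_bound vb(2), of i j "x$j - A i j" "S * (tilt S x (x$l) - real i / real N)"
          "y$j - A i j" "S * (tilt S y (y$l) - real i / real N)"]
      by (simp add: algebra_simps)
  qed (use vb in auto)
qed

lemma straighten_lipschitz: "\<exists>L. L-lipschitz_on UNIV (straighten S)"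
proof (rule lip_vector)
  fix j
  show "lip (\<lambda>z. straighten S z $ j)"
  proof (cases "j = l")
    case True then show ?thesis using lip_tilt by simp
  next
    case False
    have "lip (\<lambda>z. c j (tilt S z (z$l)))"
      by (rule lip_combine[OF lip_tilt[of S] lip_const[of 0], of Lc 0]) (use c_lip Lc_nonneg in auto)
    then show ?thesis unfolding straighten_j[OF False]
      by (intro lip_diff lip_add lip_component lip_shift)
  qed
qed

lemma shift_mono: "x \<le> y \<Longrightarrow> shift S j x u \<le> shift S j y u"
  unfolding shift_def by (rule sum_mono) (simp add: edge_shift_mono[OF v_less])

lemma shift_bound: "\<bar>shift S j y u\<bar> \<le> N"
proof -
  have "\<bar>shift S j y u\<bar> \<le> (\<Sum>i\<in>{1..<N}. 1)"
    unfolding shift_def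
  proof (rule order_trans[OF sum_abs], rule sum_mono)
    fix i show "\<bar>edge_shift (v i j) (y - A i j) (S * (u - real i / real N))\<bar> \<le> 1"
      using edge_shift_bound[of "v i j"] v_less[of i j] by (meson less_imp_le order_trans)
  qed
  then show ?thesis by simp
qed

lemma shift_continuous: "continuous_on UNIV (\<lambda>y. shift S j y u)"
  unfolding shift_def
proof (rule continuous_on_sum)
  fix i
  have "(1 / (1 - vb))-lipschitz_on UNIV (\<lambda>y. edge_shift (v i j) (y - A i j) (S * (u - real i / real N)))"
  proof (rule lipschitz_onI)
    fix x y
    show "dist (edge_shift (v i j) (x - A i j) (S * (u - real i / real N)))
       (edge_shift (v i j) (y - A i j) (S * (u - real i / real N))) \<le> 1 / (1 - vb) * dist x y"
      using edge_shift_lip[OF v_bound vb(2), of i j "x - A i j" "S * (u - real i / real N)"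
          "y - A i j" "S * (u - real i / real N)"] by (simp add: dist_real_def)
  qed (use vb in auto)
  then show "continuous_on UNIV (\<lambda>y. edge_shift (v i j) (y - A i j) (S * (u - real i / real N)))"
    by (rule lipschitz_on_continuous_on)
qed

text \<open>At a fixed new height each coordinate map is the identity plus a nondecreasing shift, so
  the horizontal coordinates agree. Then so do all \<open>tau\<close>, and the monotone tilt
  recovers the old height.\<close>

lemma straighten_inj:
  assumes S: "2 * real N * real N / e \<le> S"
  shows "inj (straighten S)"
proof (rule injI)
  fix z w assume eq: "straighten S z = straighten S w"
  have u: "tilt S z (z$l) = tilt S w (w$l)"
    using arg_cong[OF eq, of "\<lambda>x. x$l"] by simp
  have j: "z$j = w$j" if "j \<noteq> l" for j
  proof -
    have "z$j + shift S j (z$j) (tilt S w (w$l)) = w$j + shift S j (w$j) (tilt S w (w$l))"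
      using arg_cong[OF eq, of "\<lambda>x. x$j"] that u by (simp add: straighten_j)
    then show ?thesis
      using shift_mono[of "z$j" "w$j" S j "tilt S w (w$l)"] shift_mono[of "w$j" "z$j" S j "tilt S w (w$l)"]
      by linarith
  qed
  then have "tau i z = tau i w" for i using tau_cong by blast
  then have "tilt S z t = tilt S w t" for t by (simp add: tilt_def)
  then have "z$l = w$l" using u tilt_mono[OF S, of z "z$l" "w$l"] tilt_mono[OF S, of z "w$l" "z$l"] by simp
  then show "z = w" using j by (metis vec_eq_iff)
qed

text \<open>The order of the definition is reversed: horizontal coordinates are found at the
  prescribed new height, then the old height from the tilt. This works because \<open>tau\<close>
  ignores coordinate \<open>l\<close>.\<close>

lemma straighten_surj:
  assumes S: "2 * real N * real N / e \<le> S"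
  shows "surj (straighten S)"
  unfolding surj_def
proof
  fix y :: "real^'n"
  define u where "u = y$l"
  have "\<exists>x. x + shift S j x u = y$j + c j u" for j
  proof -
    have sj: "surj (\<lambda>x. x + shift S j x u)"
    proof (rule real_surj_if_bounded_displacement)
      show "continuous_on UNIV (\<lambda>x. x + shift S j x u)"
        by (intro continuous_on_add continuous_on_id shift_continuous)
      show "\<bar>x + shift S j x u - x\<bar> \<le> real N" for x using shift_bound[of S j x u] by simp
    qed
    show ?thesis using surjD[OF sj, of "y$j + c j u"] by (auto intro: sym)
  qed
  then have "\<forall>j. \<exists>x. x + shift S j x u = y$j + c j u" ..
  from choice[OF this] obtain x where x: "\<And>j. x j + shift S j (x j) u = y$j + c j u" by blast
  define z0 :: "real^'n" where "z0 = (\<chi> j. x j)"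
  have st: "surj (tilt S z0)"
  proof (rule real_surj_if_bounded_displacement)
    show "\<bar>tilt S z0 t - t\<bar> \<le> N / S" for t by (rule tilt_bound[OF S_large(2)[OF S]])
    have "2-lipschitz_on UNIV (tilt S z0)"
    proof (rule lipschitz_onI)
      fix s t show "dist (tilt S z0 s) (tilt S z0 t) \<le> 2 * dist s t"
      proof -
        have "\<bar>a - b\<bar> \<le> 2 * \<bar>p - q\<bar>" if "\<bar>a - p - (b - q)\<bar> \<le> \<bar>p - q\<bar> / 2" for a b p q :: real
          using that by (auto simp: abs_if split: if_splits)
        then show ?thesis using tilt_contract[OF S, of z0 s t] unfolding dist_real_def by blast
      qed
    qed simp
    then show "continuous_on UNIV (tilt S z0)" by (rule lipschitz_on_continuous_on)
  qed
  obtain t where t: "u = tilt S z0 t" using surjD[OF st, of u] by blast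
  define z :: "real^'n" where "z = (\<chi> j. if j = l then t else x j)"
  have "tau i z = tau i z0" for i by (rule tau_cong) (simp add: z_def z0_def)
  then have tz: "tilt S z (z$l) = u" by (simp add: tilt_def t z_def)
  have "straighten S z $ j = y$j" for j
    using x[of j] tz by (cases "j = l") (auto simp: straighten_j u_def, simp add: z_def)
  then have "y = straighten S z" by (simp add: vec_eq_iff)
  then show "\<exists>z. y = straighten S z" by blast
qed

lemma straighten_autohomeo:
  assumes S: "2 * real N * real N / e \<le> S"
  shows "autohomeo (straighten S)"
proof (rule autohomeoI)
  show "continuous_on UNIV (straighten S)"
    using straighten_lipschitz lipschitz_on_continuous_on by blast
qed (simp_all add: straighten_inj straighten_surj S)

lemma slab_index: "\<exists>m<N. (real m \<le> real N * u \<or> m = 0) \<and> (real N * u \<le> real m + 1 \<or> Suc m = N)"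
proof (cases "real N * u \<le> 0")
  case True
  then show ?thesis using N by (intro exI[of _ 0]) auto
next
  case pos: False
  show ?thesis
  proof (cases "real N * u \<ge> N")
    case True
    then have "real (N - 1) \<le> real N * u" by linarith
    then show ?thesis using N by (intro exI[of _ "N - 1"]) auto
  next
    case False
    define x where "x = real N * u"
    have "0 < x" "x < real N" using pos False unfolding x_def by linarith+
    then have "nat \<lfloor>x\<rfloor> < N" by (simp add: nat_less_iff floor_less_iff)
    moreover have "real (nat \<lfloor>x\<rfloor>) \<le> x" "x \<le> real (nat \<lfloor>x\<rfloor>) + 1" using \<open>0 < x\<close> by linarith+
    ultimately show ?thesis unfolding x_def by blast
  qed
qed

text \<open>Heights outside [0, 1] are clamped: \<open>c\<close> is constant there by
  \<open>c_out\<close>, and the extended end slabs keep their jump sums.\<close>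

lemma path_shift_bound:
  assumes "m < N" "real m \<le> real N * u \<or> m = 0" "real N * u \<le> real m + 1 \<or> Suc m = N"
  shows "\<bar>c j u + (\<Sum>k=1..m. v k j)\<bar> \<le> \<delta>"
proof -
  define w where "w = max 0 (min 1 u)"
  have w: "c j u = c j w"
    using c_out[of u j] by (auto simp: w_def max_def min_def)
  have r: "real m \<le> real N * w \<and> real N * w \<le> real m + 1"
  proof -
    have mN: "real m + 1 \<le> real N" using assms(1) by linarith
    consider "u \<le> 0" | "1 \<le> u" | "0 < u" "u < 1" by linarith
    then show ?thesis
    proof cases
      case 1
      then have "real N * u \<le> 0" using N by (simp add: mult_nonneg_nonpos)
      then have "m = 0" using assms(2) by auto
      then show ?thesis using 1 by (simp add: w_def)
    next
      case 2
      then have "real N \<le> real N * u" using N by simp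
      have "Suc m = N"
      proof (rule ccontr)
        assume "Suc m \<noteq> N"
        then have "real N * u \<le> real m + 1" using assms(3) by simp
        then have "real N \<le> real (Suc m)" using \<open>real N \<le> real N * u\<close> by simp
        then show False using \<open>Suc m \<noteq> N\<close> assms(1) by simp
      qed
      then show ?thesis using 2 by (auto simp: w_def)
    next
      case 3
      define x where "x = real N * u"
      have "0 \<le> x" "x \<le> real N" using N 3 unfolding x_def by auto
      then have "real m \<le> x \<and> x \<le> real m + 1"
        using assms(2,3) unfolding x_def[symmetric] by auto
      then show ?thesis using 3 by (simp add: w_def x_def)
    qed
  qed
  show ?thesis using path[OF assms(1), of w j] path_bound[OF assms(1), of w j] r w by simp
qed

text \<open>Across the interface \<open>P - R\<close> changes from \<open>A i j - B i j\<close> to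
  the same value plus \<open>v i j\<close>, and both are bounded by
  \<open>path_bound\<close>.\<close>

lemma v_le:
  assumes "i \<in> new" shows "\<bar>v i j\<bar> \<le> 2 * \<delta>" "\<bar>A i j - B i j\<bar> \<le> \<delta>"
proof -
  have i: "1 \<le> i" "i < N" using assms new by auto
  let ?t = "real i / real N"
  have t: "real N * ?t = real i" using N by simp
  have n: "\<bar>real N * ?t - real i\<bar> \<le> e" using t e by simp
  have "\<bar>P (i - 1) j ?t - R (i - 1) j ?t\<bar> \<le> \<delta>"
    by (rule path_bound) (use i t in \<open>auto simp: of_nat_diff\<close>)
  moreover have "\<bar>P i j ?t - R i j ?t\<bar> \<le> \<delta>"
    by (rule path_bound) (use i t in auto)
  ultimately show "\<bar>v i j\<bar> \<le> 2 * \<delta>" "\<bar>A i j - B i j\<bar> \<le> \<delta>"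
    using left[OF assms n, of j] right[OF assms n, of j] t by auto
qed

text \<open>Near a new interface, \<open>\<delta>\<close> comes from the change of frame and
  \<open>2 * \<delta>\<close> from the edge shift; elsewhere the displacement is a value of
  \<open>R - P\<close>, hence at most \<open>\<delta>\<close>.\<close>

lemma straighten_displacement:
  assumes S: "2 * real N * real N / e \<le> S" and j: "j \<noteq> l"
  shows "\<bar>straighten S z $ j - z$j\<bar> \<le> 3 * \<delta>"
proof (cases "\<exists>i\<in>new. \<bar>real N * z$l - real i\<bar> \<le> e")
  case True
  then obtain i where i: "i \<in> new" "\<bar>real N * z$l - real i\<bar> \<le> e" by blast
  show ?thesis
    using straighten_near[OF S i j] v_le[OF i(1), of j]
      edge_shift_bound[of "v i j" "z$j - A i j" "S * (tilt S z (z$l) - real i / real N)"]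
    by linarith
next
  case False
  then have far: "e \<le> \<bar>real N * z$l - real i\<bar>" if "i \<in> new" for i using that by force
  obtain m where m: "m < N" "real m \<le> real N * z$l \<or> m = 0" "real N * z$l \<le> real m + 1 \<or> Suc m = N"
    using slab_index by blast
  show ?thesis
    using straighten_far[OF S m far j] path_shift_bound[OF m, of j] by linarith
qed

text \<open>The scale \<open>S\<close> cancels: it divides the horizontal variation of the tilt and
  multiplies the height in the edge shift. In the constant, 1 comes from the coordinate itself, 2
  from \<open>tau\<close>, and \<open>1 / (1 - vb)\<close> from the middle piece of the edge shift;
  neither \<open>S\<close> nor \<open>N\<close> nor \<open>e\<close> survives.\<close>

lemma straighten_horizontal:
  assumes S: "2 * real N * real N / e \<le> S" and zw: "z$l = w$l"
  shows "j \<noteq> l \<Longrightarrow> \<bar>straighten S z $ j - straighten S w $ j\<bar> \<le> (3 + 1 / (1 - vb)) * norm (z - w)"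
    "\<bar>straighten S z $ l - straighten S w $ l\<bar> \<le> 2 / S * norm (z - w)"
proof -
  have S0: "0 < S" by (rule S_large(2)[OF S])
  have cmp: "\<bar>z$j - w$j\<bar> \<le> norm (z - w)" for j
    using component_le_norm_cart[of "z - w" j] by simp
  have k: "0 \<le> 1 / (1 - vb)" using vb by simp
  have "(j \<noteq> l \<longrightarrow> \<bar>straighten S z $ j - straighten S w $ j\<bar> \<le> (3 + 1 / (1 - vb)) * norm (z - w)) \<and>
    \<bar>straighten S z $ l - straighten S w $ l\<bar> \<le> 2 / S * norm (z - w)" for j
  proof (cases "\<exists>i\<in>new. \<bar>real N * z$l - real i\<bar> \<le> e")
    case True
    then obtain i where i: "i \<in> new" "\<bar>real N * z$l - real i\<bar> \<le> e" by blast
    have i': "\<bar>real N * w$l - real i\<bar> \<le> e" using i(2) zw by simp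
    have "\<bar>tau i z - tau i w\<bar> \<le> 2 * norm (z - w)" by (rule tau_diff) (use cmp in auto)
    then have "\<bar>bump i (w$l) * tau i z - bump i (w$l) * tau i w\<bar> \<le> 1 * (2 * norm (z - w))"
      unfolding right_diff_distrib[symmetric] abs_mult
      using bump_range[of i "w$l"] by (intro mult_mono) auto
    then have "1 / S * \<bar>bump i (w$l) * tau i z - bump i (w$l) * tau i w\<bar> \<le> 1 / S * (2 * norm (z - w))"
      using S0 by (intro mult_left_mono) auto
    moreover have "tilt S z (z$l) - tilt S w (w$l) = 1 / S * (bump i (w$l) * tau i z - bump i (w$l) * tau i w)"
      using tilt_near[OF i] tilt_near[OF i(1) i'] zw by (simp add: algebra_simps diff_divide_distrib)
    ultimately have t: "\<bar>tilt S z (z$l) - tilt S w (w$l)\<bar> \<le> 2 / S * norm (z - w)"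
      using S0 by (simp add: abs_mult)
    have "S * \<bar>tilt S z (z$l) - tilt S w (w$l)\<bar> \<le> S * (2 / S * norm (z - w))"
      using t S0 by (intro mult_left_mono) auto
    then have t2: "\<bar>S * (tilt S z (z$l) - real i / real N) - S * (tilt S w (w$l) - real i / real N)\<bar> \<le> 2 * norm (z - w)"
      using S0 by (simp add: abs_mult flip: right_diff_distrib)
    have "\<bar>straighten S z $ j - straighten S w $ j\<bar> \<le> (3 + 1 / (1 - vb)) * norm (z - w)" if j: "j \<noteq> l"
    proof -
      have "\<bar>edge_shift (v i j) (z$j - A i j) (S * (tilt S z (z$l) - real i / real N))
         - edge_shift (v i j) (w$j - A i j) (S * (tilt S w (w$l) - real i / real N))\<bar>
         \<le> 2 * norm (z - w) + 1 / (1 - vb) * norm (z - w)"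
        using edge_shift_lip[OF v_bound vb(2), of i j "z$j - A i j" "S * (tilt S z (z$l) - real i / real N)"
           "w$j - A i j" "S * (tilt S w (w$l) - real i / real N)"] t2
           mult_left_mono[OF cmp[of j] k] by simp
      then show ?thesis
        using straighten_near[OF S i j] straighten_near[OF S i(1) i' j] cmp[of j]
        by (simp add: distrib_right)
    qed
    then show ?thesis using t by simp
  next
    case False
    then have far: "e \<le> \<bar>real N * z$l - real i\<bar>" if "i \<in> new" for i using that by force
    then have far': "e \<le> \<bar>real N * w$l - real i\<bar>" if "i \<in> new" for i using that zw by simp
    obtain m where m: "m < N" "real m \<le> real N * z$l \<or> m = 0" "real N * z$l \<le> real m + 1 \<or> Suc m = N"
      using slab_index by blast
    have "straighten S z $ j - straighten S w $ j = z$j - w$j" if "j \<noteq> l"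
      using straighten_far[OF S m far that] straighten_far[OF S m(1) _ _ far' that] m(2,3) zw by simp
    moreover have "norm (z - w) \<le> (3 + 1 / (1 - vb)) * norm (z - w)"
      using mult_right_mono[of 1 "3 + 1 / (1 - vb)" "norm (z - w)"] k by simp
    moreover have "straighten S z $ l = straighten S w $ l"
      using tilt_far[OF far] tilt_far[OF far'] zw by simp
    ultimately show ?thesis using cmp[of j] S0 by fastforce
  qed
  then show "j \<noteq> l \<Longrightarrow> \<bar>straighten S z $ j - straighten S w $ j\<bar> \<le> (3 + 1 / (1 - vb)) * norm (z - w)"
    "\<bar>straighten S z $ l - straighten S w $ l\<bar> \<le> 2 / S * norm (z - w)" by auto
qed

lemma refining_homeo:
  assumes "0 < K"
  obtains H :: "real^'n \<Rightarrow> real^'n" where "autohomeo H" "\<exists>L. L-lipschitz_on UNIV H"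
    "\<And>z. z \<in> stack l N P \<longleftrightarrow> H z \<in> stack l N R"
    "\<And>z j. j \<noteq> l \<Longrightarrow> \<bar>H z $ j - z $ j\<bar> \<le> 3 * \<delta>" "\<And>z. \<bar>H z $ l - z $ l\<bar> \<le> 1 / K"
    "\<And>z w j. z $ l = w $ l \<Longrightarrow> j \<noteq> l \<Longrightarrow> \<bar>H z $ j - H w $ j\<bar> \<le> (3 + 1 / (1 - vb)) * norm (z - w)"
    "\<And>z w. z $ l = w $ l \<Longrightarrow> \<bar>H z $ l - H w $ l\<bar> \<le> 1 / K * norm (z - w)"
proof -
  \<comment> \<open>The first summand makes the tilt monotone; the second gives
    \<open>N / S \<le> 1 / K\<close> for the vertical displacement and
    \<open>2 / S \<le> 1 / K\<close> for its horizontal variation.\<close>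
  define S where "S = 2 * real N * real N / e + 2 * real N * K"
  have p: "0 < 2 * real N * real N / e" "0 < real N * K" using N e assms by auto
  have S: "2 * real N * real N / e \<le> S" unfolding S_def using assms by simp
  have S0: "0 < S" by (rule S_large(2)[OF S])
  have "1 * K \<le> real N * K" using N assms by (intro mult_right_mono) auto
  moreover have "2 * real N * K = 2 * (real N * K)" by simp
  ultimately have K: "real N * K \<le> S" "2 * K \<le> S" unfolding S_def using p by linarith+
  have "\<bar>straighten S z $ l - z $ l\<bar> \<le> 1 / K" for z
  proof -
    have "real N / S \<le> 1 / K" using K S0 assms by (simp add: field_simps)
    then show ?thesis using tilt_bound[OF S0, of z "z$l"] by simp
  qed
  moreover have "\<bar>straighten S z $ l - straighten S w $ l\<bar> \<le> 1 / K * norm (z - w)" if "z$l = w$l" for z w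
  proof -
    have "2 / S \<le> 1 / K" using K S0 assms by (simp add: field_simps)
    then show ?thesis
      using straighten_horizontal(2)[OF S that] mult_right_mono[of "2 / S" "1 / K" "norm (z - w)"] by simp
  qed
  ultimately show ?thesis
    using that[of "straighten S"] straighten_autohomeo[OF S] straighten_lipschitz straighten_stack[OF S]
      straighten_displacement[OF S] straighten_horizontal(1)[OF S] by blast
qed

end

section \<open>Columns with regulated profile\<close>

lemma real_div_bounds:
  fixes i h :: nat
  assumes "0 < h"
  shows "real h * real (i div h) \<le> real i" "real i + 1 \<le> real h * (real (i div h) + 1)"
proof -
  have "h * (i div h) \<le> i" by simp
  then show "real h * real (i div h) \<le> real i" by (metis of_nat_le_iff of_nat_mult)
  have "i + 1 \<le> h * (i div h + 1)"
    using assms dividend_less_div_times[of h i] by (simp add: mult.commute)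
  then have "real (i + 1) \<le> real (h * (i div h + 1))" by (simp only: of_nat_le_iff)
  then show "real i + 1 \<le> real h * (real (i div h) + 1)" by (simp add: algebra_simps)
qed

lemma convex_bound:
  fixes a b r x d :: real
  assumes "0 \<le> r" "r \<le> 1" "\<bar>a - x\<bar> \<le> d" "\<bar>b - x\<bar> \<le> d"
  shows "\<bar>a + r * (b - a) - x\<bar> \<le> d"
proof -
  have "a + r * (b - a) - x = (1 - r) * (a - x) + r * (b - x)" by (simp add: algebra_simps)
  then have "\<bar>a + r * (b - a) - x\<bar> \<le> (1 - r) * \<bar>a - x\<bar> + r * \<bar>b - x\<bar>"
    using assms(1,2) by (metis abs_mult abs_of_nonneg abs_triangle_ineq diff_ge_0_iff_ge)
  also have "\<dots> \<le> (1 - r) * d + r * d" using assms by (intro add_mono mult_left_mono) auto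
  finally show ?thesis by (simp add: algebra_simps)
qed

text \<open>\<open>f\<close> and \<open>g\<close> are the right and left limits of the profile; at a point of continuity they
  agree.\<close>

definition column :: "'n::finite \<Rightarrow> ('n \<Rightarrow> real \<Rightarrow> real) \<Rightarrow> ('n \<Rightarrow> real \<Rightarrow> real) \<Rightarrow> (real^'n) set" where
  "column l f g = {z. (0 \<le> z$l \<and> z$l < 1 \<and> (\<forall>j. j \<noteq> l \<longrightarrow> f j (z$l) \<le> z$j \<and> z$j \<le> f j (z$l) + 1)) \<or>
     (0 < z$l \<and> z$l \<le> 1 \<and> (\<forall>j. j \<noteq> l \<longrightarrow> g j (z$l) \<le> z$j \<and> z$j \<le> g j (z$l) + 1))}"

text \<open>Slabs are closed below for the right limit \<open>f\<close> and closed above for the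
  left limit \<open>g\<close>, since \<open>g\<close> at the top of a slab is still approached from
  inside it. Both are compared with the same value, that of \<open>f\<close> at the bottom.\<close>

locale regulated =
  fixes l :: "'n::finite" and f g :: "'n \<Rightarrow> real \<Rightarrow> real" and q :: nat and \<delta> :: "nat \<Rightarrow> real"
  assumes q: "2 \<le> q"
    and osc_f: "\<And>n m t j. m < q^n \<Longrightarrow> real m \<le> real (q^n) * t \<Longrightarrow> real (q^n) * t < real m + 1 \<Longrightarrow>
       \<bar>f j t - f j (real m / real (q^n))\<bar> \<le> \<delta> n"
    and osc_g: "\<And>n m t j. m < q^n \<Longrightarrow> real m < real (q^n) * t \<Longrightarrow> real (q^n) * t \<le> real m + 1 \<Longrightarrow>
       \<bar>g j t - f j (real m / real (q^n))\<bar> \<le> \<delta> n"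
    and \<delta>_lim: "\<delta> \<longlonglongrightarrow> 0"
begin

lemma qn_pos: "0 < real (q^n)" "0 < q^n"
  using q by auto

lemma \<delta>_nonneg: "0 \<le> \<delta> n"
  using osc_f[of 0 n 0 undefined] qn_pos by simp

lemma slab_f: "0 \<le> t \<Longrightarrow> t < 1 \<Longrightarrow> \<exists>m<q^n. real m \<le> real (q^n) * t \<and> real (q^n) * t < real m + 1"
proof -
  assume t: "0 \<le> t" "t < 1"
  define x where "x = real (q^n) * t"
  have x: "0 \<le> x" "x < real (q^n)" using t qn_pos(1)[of n] by (auto simp: x_def)
  then have "nat \<lfloor>x\<rfloor> < q^n" by (simp add: nat_less_iff floor_less_iff)
  moreover have "real (nat \<lfloor>x\<rfloor>) \<le> x" "x < real (nat \<lfloor>x\<rfloor>) + 1" using x by linarith+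
  ultimately show ?thesis unfolding x_def by blast
qed

lemma slab_g: "0 < t \<Longrightarrow> t \<le> 1 \<Longrightarrow> \<exists>m<q^n. real m < real (q^n) * t \<and> real (q^n) * t \<le> real m + 1"
proof -
  assume t: "0 < t" "t \<le> 1"
  define x where "x = real (q^n) * t"
  have x: "0 < x" "x \<le> real (q^n)" using t qn_pos(1)[of n] by (auto simp: x_def)
  define m where "m = nat (\<lceil>x\<rceil> - 1)"
  have m: "real m < x" "x \<le> real m + 1" using x unfolding m_def by linarith+
  then have "m < q^n" using x by linarith
  then show ?thesis using m unfolding x_def by blast
qed

lemma slab_range:
  shows "real m \<le> real (q^n) * t \<Longrightarrow> 0 \<le> t" "real m < real (q^n) * t \<Longrightarrow> 0 < t"
    "m < q^n \<Longrightarrow> real (q^n) * t \<le> real m + 1 \<Longrightarrow> t \<le> 1"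
    "m < q^n \<Longrightarrow> real (q^n) * t < real m + 1 \<Longrightarrow> t < 1"
proof -
  have "(0 \<le> t \<longleftrightarrow> 0 \<le> Q * t) \<and> (0 < t \<longleftrightarrow> 0 < Q * t) \<and> (t \<le> 1 \<longleftrightarrow> Q * t \<le> Q) \<and> (t < 1 \<longleftrightarrow> Q * t < Q)"
    if "0 < Q" for Q :: real
    using that by (simp add: zero_le_mult_iff zero_less_mult_iff)
  note * = this[OF qn_pos(1)[of n], THEN conjunct1] this[OF qn_pos(1)[of n], THEN conjunct2]
  show "real m \<le> real (q^n) * t \<Longrightarrow> 0 \<le> t" "real m < real (q^n) * t \<Longrightarrow> 0 < t"
    "m < q^n \<Longrightarrow> real (q^n) * t \<le> real m + 1 \<Longrightarrow> t \<le> 1"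
    "m < q^n \<Longrightarrow> real (q^n) * t < real m + 1 \<Longrightarrow> t < 1"
    using * by linarith+
qed

text \<open>At each level the column lies in a finite union of closed boxes, one per slab, thickened
  by \<open>\<delta> n\<close>; these unions shrink to exactly the column.\<close>

lemma closed_column: "closed (column l f g)"
proof -
  define Z where "Z n m = {z::real^'n. real m \<le> real (q^n) * z$l} \<inter> {z. real (q^n) * z$l \<le> real m + 1} \<inter>
     (\<Inter>j\<in>UNIV - {l}. {z. f j (real m / real (q^n)) - \<delta> n \<le> z$j} \<inter> {z. z$j \<le> f j (real m / real (q^n)) + 1 + \<delta> n})" for n m
  have cl: "closed (Z n m)" for n m
    unfolding Z_def by (intro closed_Int closed_INT ballI closed_Collect_le continuous_intros)
  have "column l f g = (\<Inter>n. \<Union>m\<in>{..<q^n}. Z n m)"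
  proof (intro equalityI subsetI)
    fix z assume z: "z \<in> column l f g"
    have "\<exists>m<q^n. z \<in> Z n m" for n
      using z unfolding column_def
    proof (elim CollectE disjE conjE)
      assume t: "0 \<le> z$l" "z$l < 1" and b: "\<forall>j. j \<noteq> l \<longrightarrow> f j (z$l) \<le> z$j \<and> z$j \<le> f j (z$l) + 1"
      obtain m where m: "m < q^n" "real m \<le> real (q^n) * z$l" "real (q^n) * z$l < real m + 1"
        using slab_f[OF t] by blast
      have "f j (real m / real (q^n)) - \<delta> n \<le> z$j \<and> z$j \<le> f j (real m / real (q^n)) + 1 + \<delta> n" if "j \<noteq> l" for j
        using osc_f[OF m, of j] b[rule_format, OF that] by linarith
      then show ?thesis using m unfolding Z_def by (intro exI[of _ m]) auto
    next
      assume t: "0 < z$l" "z$l \<le> 1" and b: "\<forall>j. j \<noteq> l \<longrightarrow> g j (z$l) \<le> z$j \<and> z$j \<le> g j (z$l) + 1"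
      obtain m where m: "m < q^n" "real m < real (q^n) * z$l" "real (q^n) * z$l \<le> real m + 1"
        using slab_g[OF t] by blast
      have "f j (real m / real (q^n)) - \<delta> n \<le> z$j \<and> z$j \<le> f j (real m / real (q^n)) + 1 + \<delta> n" if "j \<noteq> l" for j
        using osc_g[OF m, of j] b[rule_format, OF that] by linarith
      then show ?thesis using m unfolding Z_def by (intro exI[of _ m]) auto
    qed
    then show "z \<in> (\<Inter>n. \<Union>m\<in>{..<q^n}. Z n m)" by auto
  next
    fix z assume "z \<in> (\<Inter>n. \<Union>m\<in>{..<q^n}. Z n m)"
    then have ex: "\<exists>m<q^n. z \<in> Z n m" for n by auto
    define t where "t = z$l"
    define B where "B h r \<longleftrightarrow> (\<forall>j. j \<noteq> l \<longrightarrow> h j t - r \<le> z$j \<and> z$j \<le> h j t + 1 + r)" for h r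
    define F where "F r \<longleftrightarrow> 0 \<le> t \<and> t < 1 \<and> B f r" for r
    define G where "G r \<longleftrightarrow> 0 < t \<and> t \<le> 1 \<and> B g r" for r
    have FG: "F (2 * \<delta> n) \<or> G (2 * \<delta> n)" for n
    proof -
      obtain m where m: "m < q^n" "z \<in> Z n m" using ex by blast
      have sl: "real m \<le> real (q^n) * t" "real (q^n) * t \<le> real m + 1" using m(2) by (auto simp: Z_def t_def)
      have b: "f j (real m / real (q^n)) - \<delta> n \<le> z$j \<and> z$j \<le> f j (real m / real (q^n)) + 1 + \<delta> n" if "j \<noteq> l" for j
        using m(2) that by (auto simp: Z_def)
      have B: "B h (2 * \<delta> n)" if "\<And>j. \<bar>h j t - f j (real m / real (q^n))\<bar> \<le> \<delta> n" for h
        unfolding B_def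
      proof (intro allI impI)
        fix j assume "j \<noteq> l"
        then show "h j t - 2 * \<delta> n \<le> z$j \<and> z$j \<le> h j t + 1 + 2 * \<delta> n" using b[of j] that[of j] by linarith
      qed
      show ?thesis
      proof (cases "real (q^n) * t < real m + 1")
        case True
        then show ?thesis using B[of f, OF osc_f[OF m(1) sl(1)]] slab_range(1)[OF sl(1)] slab_range(4)[OF m(1)]
          unfolding F_def by blast
      next
        case False
        then have "real m < real (q^n) * t" by linarith
        then show ?thesis using B[of g, OF osc_g[OF m(1) _ sl(2)]] slab_range(2) slab_range(3)[OF m(1) sl(2)]
          unfolding G_def by blast
      qed
    qed
    have small: "\<exists>n. 2 * \<delta> n < r" if "0 < r" for r
    proof -
      have "\<forall>\<^sub>F n in sequentially. \<delta> n < r / 2" using order_tendstoD(2)[OF \<delta>_lim, of "r/2"] that by simp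
      then obtain n where "\<delta> n < r / 2" by (auto simp: eventually_sequentially)
      then show ?thesis by (intro exI[of _ n]) simp
    qed
    have mono: "F r \<Longrightarrow> r \<le> r' \<Longrightarrow> F r'" "G r \<Longrightarrow> r \<le> r' \<Longrightarrow> G r'" for r r'
      unfolding F_def G_def B_def by force+
    have FG': "F r \<or> G r" if pos: "0 < r" for r
    proof -
      obtain n where "2 * \<delta> n < r" using small[OF pos] by blast
      then show ?thesis using FG[of n] mono less_imp_le by blast
    qed
    have B0: "B h 0" if B: "\<And>r. 0 < r \<Longrightarrow> B h r" for h
      unfolding B_def
    proof (intro allI impI conjI)
      fix j assume j: "j \<noteq> l"
      have "h j t - r \<le> z$j \<and> z$j \<le> h j t + 1 + r" if "0 < r" for r using B[OF that] j by (simp add: B_def)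
      then show "h j t - 0 \<le> z$j" "z$j \<le> h j t + 1 + 0" by (auto intro: field_le_epsilon simp: algebra_simps)
    qed
    have F0: "F 0" if "\<And>r. 0 < r \<Longrightarrow> F r" using that[of 1] B0[of f] that by (simp add: F_def)
    have G0: "G 0" if "\<And>r. 0 < r \<Longrightarrow> G r" using that[of 1] B0[of g] that by (simp add: G_def)
    \<comment> \<open>If both exact alternatives failed, each would fail at some positive tolerance,
      and then both at the smaller one.\<close>
    have "F 0 \<or> G 0"
    proof (rule ccontr)
      assume "\<not> (F 0 \<or> G 0)"
      then obtain r r' where "0 < r" "\<not> F r" "0 < r'" "\<not> G r'" using F0 G0 by blast
      then show False using FG'[of "min r r'"] mono(1)[of "min r r'" r] mono(2)[of "min r r'" r'] by auto
    qed
    then show "z \<in> column l f g" by (simp add: column_def F_def G_def B_def t_def)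
  qed
  moreover have "closed (\<Inter>n. \<Union>m\<in>{..<q^n}. Z n m)"
    by (intro closed_INT ballI closed_UN) (auto intro: cl)
  ultimately show ?thesis by simp
qed

text \<open>The rise of a ramp is confined to the first \<open>q\<close>-th of its slab and away from the ends of that
  part, so that it is constant near all interfaces of the present and of the next level.\<close>

definition ramp :: "nat \<Rightarrow> nat \<Rightarrow> real \<Rightarrow> real" where
  "ramp k i t = max 0 (min 1 (3 * real q * (real (q^k) * t - real i) - 1))"

definition rise :: "nat \<Rightarrow> nat \<Rightarrow> 'n \<Rightarrow> real" where
  "rise k i j = g j (real (i + 1) / real (q^k)) - f j (real i / real (q^k))"

definition jump :: "nat \<Rightarrow> nat \<Rightarrow> 'n \<Rightarrow> real" where
  "jump k i j = f j (real i / real (q^k)) - g j (real i / real (q^k))"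

text \<open>It leads from the right limit at the bottom of slab \<open>i\<close> to the left limit
  at its top, so at the interfaces of level \<open>k\<close> the stack has the same two cubes as the
  column.\<close>

definition polyline :: "nat \<Rightarrow> nat \<Rightarrow> 'n \<Rightarrow> real \<Rightarrow> real" where
  "polyline k i j t = f j (real i / real (q^k)) + ramp k i t * rise k i j"

lemma ramp_range: "0 \<le> ramp k i t" "ramp k i t \<le> 1"
  by (auto simp: ramp_def)

lemma ramp_1: "2 / (3 * real q) \<le> real (q^k) * t - real i \<Longrightarrow> ramp k i t = 1"
proof -
  assume *: "2 / (3 * real q) \<le> real (q^k) * t - real i"
  have "3 * real q * (2 / (3 * real q)) \<le> 3 * real q * (real (q^k) * t - real i)"
    by (rule mult_left_mono[OF *]) simp
  then have "2 \<le> 3 * real q * (real (q^k) * t - real i)" using q by simp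
  then show ?thesis unfolding ramp_def by simp
qed

lemma ramp_0: "real (q^k) * t - real i \<le> 1 / (3 * real q) \<Longrightarrow> ramp k i t = 0"
proof -
  assume *: "real (q^k) * t - real i \<le> 1 / (3 * real q)"
  have "3 * real q * (real (q^k) * t - real i) \<le> 3 * real q * (1 / (3 * real q))"
    by (rule mult_left_mono[OF *]) simp
  then have "3 * real q * (real (q^k) * t - real i) \<le> 1" using q by simp
  then show ?thesis unfolding ramp_def by simp
qed

lemma third_q: "2 / (3 * real q) \<le> 1 / 3" "0 \<le> 1 / (3 * real q)"
  using q by (auto simp: field_simps)

lemma ramp_lip: "\<bar>ramp k i s - ramp k i t\<bar> \<le> 3 * real q * real (q^k) * \<bar>s - t\<bar>"
proof -
  have "\<bar>ramp k i s - ramp k i t\<bar> \<le> \<bar>3 * real q * (real (q^k) * s - real i) - 3 * real q * (real (q^k) * t - real i)\<bar>"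
    unfolding ramp_def by (auto simp: max_def min_def abs_le_iff)
  also have "\<dots> = \<bar>3 * real q * real (q^k) * (s - t)\<bar>" by (simp add: algebra_simps)
  finally show ?thesis by (simp add: abs_mult)
qed

lemma endpoint_value: "f j (real i / real (q^k)) = f j 0 + (\<Sum>m<i. rise k m j) + (\<Sum>m=1..i. jump k m j)"
  by (induction i) (auto simp: rise_def jump_def)

text \<open>Inside slab \<open>i\<close> the ramps below are complete and those above have not
  begun, so all slab paths are one global continuous function plus accumulated jumps. This matches
  the assumption \<open>path\<close> of \<open>slab_step\<close>: subtracting two levels leaves a
  continuous drift and the new jumps.\<close>

lemma polyline_eq:
  assumes "i < q^k" "real i \<le> real (q^k) * t" "real (q^k) * t \<le> real i + 1"
  shows "polyline k i j t = f j 0 + (\<Sum>m<q^k. ramp k m t * rise k m j) + (\<Sum>m=1..i. jump k m j)"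
proof -
  have "(\<Sum>m<q^k. ramp k m t * rise k m j) =
     (\<Sum>m<q^k. (if m < i then rise k m j else 0) + (if m = i then ramp k i t * rise k i j else 0))"
  proof (rule sum.cong[OF refl])
    fix m
    have "ramp k m t = 1" if "m < i"
    proof (rule ramp_1)
      have "real m + 1 \<le> real i" using that by linarith
      then show "2 / (3 * real q) \<le> real (q^k) * t - real m" using assms(2) third_q(1) by linarith
    qed
    moreover have "ramp k m t = 0" if "i < m"
    proof (rule ramp_0)
      have "real i + 1 \<le> real m" using that by linarith
      then show "real (q^k) * t - real m \<le> 1 / (3 * real q)" using assms(3) third_q(2) by linarith
    qed
    ultimately show "ramp k m t * rise k m j =
       (if m < i then rise k m j else 0) + (if m = i then ramp k i t * rise k i j else 0)"
      by (cases m i rule: linorder_cases) auto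
  qed
  also have "\<dots> = (\<Sum>m\<in>{..<q^k} \<inter> {m. m < i}. rise k m j) + ramp k i t * rise k i j"
    using assms(1) by (simp add: sum.distrib sum.If_cases)
  also have "{..<q^k} \<inter> {m. m < i} = {..<i}" using assms(1) by auto
  finally show ?thesis unfolding polyline_def endpoint_value[where i = i] by linarith
qed

lemma div_q_less: "i < q^Suc k \<Longrightarrow> i div q < q^k"
  using q by (simp add: div_less_iff_less_mult mult.commute)

lemma polyline_close:
  assumes "i < q^k"
  shows "\<bar>polyline k i j t - f j (real i / real (q^k))\<bar> \<le> \<delta> k"
  unfolding polyline_def rise_def
proof (rule convex_bound[OF ramp_range])
  show "\<bar>f j (real i / real (q^k)) - f j (real i / real (q^k))\<bar> \<le> \<delta> k" using \<delta>_nonneg by simp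
  show "\<bar>g j (real (i + 1) / real (q^k)) - f j (real i / real (q^k))\<bar> \<le> \<delta> k"
    by (rule osc_g[OF assms]) (use q in \<open>auto simp: add.commute\<close>)
qed

lemma polyline_Suc_close:
  assumes "i < q^Suc k"
  shows "\<bar>polyline (Suc k) i j t - f j (real (i div q) / real (q^k))\<bar> \<le> \<delta> k"
proof -
  have d: "i div q < q^k" by (rule div_q_less[OF assms])
  have e: "real (q^k) * (real i / real (q^Suc k)) = real i / real q"
    "real (q^k) * (real (i + 1) / real (q^Suc k)) = real (i + 1) / real q"
    using qn_pos(1)[of k] q by (simp_all add: field_simps)
  have b: "real (i div q) * real q \<le> real i" "real i + 1 \<le> (real (i div q) + 1) * real q"
    using real_div_bounds[of q i] q by (simp_all add: mult.commute)
  have q0: "0 < real q" using q by simp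
  show ?thesis
    unfolding polyline_def rise_def
  proof (rule convex_bound[OF ramp_range])
    show "\<bar>f j (real i / real (q^Suc k)) - f j (real (i div q) / real (q^k))\<bar> \<le> \<delta> k"
      by (rule osc_f[OF d]) (use b q0 in \<open>simp_all add: e pos_le_divide_eq pos_divide_less_eq\<close>)
    show "\<bar>g j (real (i + 1) / real (q^Suc k)) - f j (real (i div q) / real (q^k))\<bar> \<le> \<delta> k"
      by (rule osc_g[OF d]) (use b q0 in \<open>simp_all add: e pos_less_divide_eq pos_divide_le_eq\<close>)
  qed
qed

section \<open>Towers: the stacks that approximate the column\<close>

definition tower :: "nat \<Rightarrow> (real^'n) set" where
  "tower k = stack l (q^k) (polyline k)"

lemma move_box:
  fixes z :: "real^'n"
  assumes z: "\<forall>j. j \<noteq> l \<longrightarrow> h j \<le> z$j \<and> z$j \<le> h j + 1" and b: "\<And>j. \<bar>h' j - h j\<bar> \<le> b"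
  obtains w :: "real^'n" where "w$l = z$l" "\<forall>j. j \<noteq> l \<longrightarrow> h' j \<le> w$j \<and> w$j \<le> h' j + 1"
    "dist z w \<le> real CARD('n) * b"
proof
  let ?w = "(\<chi> j. if j = l then z$l else z$j + (h' j - h j)) :: real^'n"
  have "dist z ?w \<le> (\<Sum>j\<in>UNIV. \<bar>(z - ?w)$j\<bar>)" unfolding dist_norm by (rule norm_le_l1_cart)
  also have "\<dots> \<le> (\<Sum>j\<in>(UNIV::'n set). b)"
    by (rule sum_mono) (use b order_trans[OF abs_ge_zero b] in \<open>auto simp: abs_minus_commute\<close>)
  finally show "dist z ?w \<le> real CARD('n) * b" by simp
  show "\<forall>j. j \<noteq> l \<longrightarrow> h' j \<le> ?w$j \<and> ?w$j \<le> h' j + 1" using z by auto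
qed simp

lemma column_near_tower:
  assumes "z \<in> column l f g"
  shows "\<exists>z'\<in>tower k. dist z z' \<le> real CARD('n) * (2 * \<delta> k)"
proof -
  define t where "t = z$l"
  have "\<exists>h m. m < q^k \<and> real m \<le> real (q^k) * t \<and> real (q^k) * t \<le> real m + 1 \<and>
      (\<forall>j. j \<noteq> l \<longrightarrow> h j \<le> z$j \<and> z$j \<le> h j + 1) \<and> (\<forall>j. \<bar>h j - f j (real m / real (q^k))\<bar> \<le> \<delta> k)"
    using assms unfolding column_def t_def[symmetric] mem_Collect_eq
  proof (elim disjE conjE)
    assume t: "0 \<le> t" "t < 1" and b: "\<forall>j. j \<noteq> l \<longrightarrow> f j t \<le> z$j \<and> z$j \<le> f j t + 1"
    obtain m where "m < q^k" "real m \<le> real (q^k) * t" "real (q^k) * t < real m + 1"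
      using slab_f[OF t] by blast
    then show ?thesis using b osc_f less_imp_le by (intro exI[of _ "\<lambda>j. f j t"] exI[of _ m]) auto
  next
    assume t: "0 < t" "t \<le> 1" and b: "\<forall>j. j \<noteq> l \<longrightarrow> g j t \<le> z$j \<and> z$j \<le> g j t + 1"
    obtain m where "m < q^k" "real m < real (q^k) * t" "real (q^k) * t \<le> real m + 1"
      using slab_g[OF t] by blast
    then show ?thesis using b osc_g less_imp_le by (intro exI[of _ "\<lambda>j. g j t"] exI[of _ m]) auto
  qed
  then obtain h m where m: "m < q^k" "real m \<le> real (q^k) * t" "real (q^k) * t \<le> real m + 1"
    and b: "\<forall>j. j \<noteq> l \<longrightarrow> h j \<le> z$j \<and> z$j \<le> h j + 1" and d: "\<And>j. \<bar>h j - f j (real m / real (q^k))\<bar> \<le> \<delta> k" by blast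
  have "\<bar>polyline k m j t - h j\<bar> \<le> 2 * \<delta> k" for j using d[of j] polyline_close[OF m(1), of j t] by linarith
  from move_box[OF b this] obtain w :: "real^'n" where w: "w$l = z$l"
    "\<forall>j. j \<noteq> l \<longrightarrow> polyline k m j t \<le> w$j \<and> w$j \<le> polyline k m j t + 1"
    "dist z w \<le> real CARD('n) * (2 * \<delta> k)" by blast
  then have "w \<in> tower k" unfolding tower_def stack_def w(1) t_def[symmetric] mem_Collect_eq using m
    by (intro exI[of _ m]) (simp add: w(1) t_def[symmetric])
  then show ?thesis using w(3) by blast
qed

lemma tower_near_column:
  assumes "z \<in> tower k"
  shows "\<exists>z'\<in>column l f g. dist z z' \<le> real CARD('n) * (2 * \<delta> k)"
proof -
  define t where "t = z$l"
  obtain m where m: "m < q^k" "real m \<le> real (q^k) * t" "real (q^k) * t \<le> real m + 1"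
    and b: "\<forall>j. j \<noteq> l \<longrightarrow> polyline k m j t \<le> z$j \<and> z$j \<le> polyline k m j t + 1"
    using assms unfolding tower_def stack_def t_def by blast
  have near: "\<exists>w::real^'n. w$l = t \<and> (\<forall>j. j \<noteq> l \<longrightarrow> h j t \<le> w$j \<and> w$j \<le> h j t + 1) \<and>
      dist z w \<le> real CARD('n) * (2 * \<delta> k)" if h: "\<And>j. \<bar>h j t - f j (real m / real (q^k))\<bar> \<le> \<delta> k" for h
  proof -
    have "\<bar>h j t - polyline k m j t\<bar> \<le> 2 * \<delta> k" for j using h[of j] polyline_close[OF m(1), of j t] by linarith
    from move_box[OF b this] show ?thesis unfolding t_def[symmetric] by metis
  qed
  show ?thesis
  proof (cases "real (q^k) * t < real m + 1")
    case True
    then show ?thesis using near[of f, OF osc_f[OF m(1,2)]] slab_range(1)[OF m(2)] slab_range(4)[OF m(1)]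
      unfolding column_def by blast
  next
    case False
    then have "real m < real (q^k) * t" by linarith
    then show ?thesis using near[of g, OF osc_g[OF m(1) _ m(3)]] slab_range(2) slab_range(3)[OF m(1,3)]
      unfolding column_def by blast
  qed
qed

text \<open>Cutting each slab into \<open>q\<close> slabs along the same path changes nothing, and
  allows consecutive towers to be compared as stacks with equally many slabs.\<close>

lemma stack_coarsen: "stack l (q^Suc k) (\<lambda>i. polyline k (i div q)) = tower k"
proof (intro equalityI subsetI)
  fix z assume "z \<in> stack l (q^Suc k) (\<lambda>i. polyline k (i div q))"
  then obtain i where i: "i < q^Suc k" "real i \<le> real (q^Suc k) * z$l" "real (q^Suc k) * z$l \<le> real i + 1"
    and b: "\<forall>j. j \<noteq> l \<longrightarrow> polyline k (i div q) j (z$l) \<le> z$j \<and> z$j \<le> polyline k (i div q) j (z$l) + 1"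
    unfolding stack_def by blast
  have "i div q < q^k" by (rule div_q_less[OF i(1)])
  moreover have "real q * real (i div q) \<le> real i" "real i + 1 \<le> real q * (real (i div q) + 1)"
    using real_div_bounds[of q i] q by simp_all
  then have "real q * real (i div q) \<le> real q * (real (q^k) * z$l)" "real q * (real (q^k) * z$l) \<le> real q * (real (i div q) + 1)"
    using i(2,3) by (auto simp: mult.assoc)
  then have "real (i div q) \<le> real (q^k) * z$l" "real (q^k) * z$l \<le> real (i div q) + 1"
    using q by (auto simp: mult_le_cancel_left_pos)
  ultimately show "z \<in> tower k" using b unfolding tower_def stack_def by blast
next
  fix z assume "z \<in> tower k"
  then obtain m where m: "m < q^k" "real m \<le> real (q^k) * z$l" "real (q^k) * z$l \<le> real m + 1"
    and b: "\<forall>j. j \<noteq> l \<longrightarrow> polyline k m j (z$l) \<le> z$j \<and> z$j \<le> polyline k m j (z$l) + 1"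
    unfolding tower_def stack_def by blast
  define x where "x = real (q^Suc k) * z$l - real (q * m)"
  have q0: "0 < real q" using q by simp
  have x: "0 \<le> x" "x \<le> real q"
    using mult_left_mono[OF m(2), of "real q"] mult_left_mono[OF m(3), of "real q"] q0
    by (auto simp: x_def algebra_simps)
  \<comment> \<open>At the top of the slab the floor would give \<open>q\<close>, so the last
    subslab is taken there.\<close>
  have "\<exists>r<q. real r \<le> x \<and> x \<le> real r + 1"
  proof (cases "x = real q")
    case True
    then show ?thesis using q by (intro exI[of _ "q - 1"]) (auto simp: of_nat_diff)
  next
    case False
    then have "x < real q" using x by linarith
    then have "nat \<lfloor>x\<rfloor> < q" using x by (simp add: nat_less_iff floor_less_iff)
    moreover have "real (nat \<lfloor>x\<rfloor>) \<le> x" "x \<le> real (nat \<lfloor>x\<rfloor>) + 1" using x by linarith+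
    ultimately show ?thesis by blast
  qed
  then obtain r where r: "r < q" "real r \<le> x" "x \<le> real r + 1" by blast
  let ?i = "q * m + r"
  have "?i div q = m" using r(1) by simp
  moreover have "?i < q^Suc k"
  proof -
    have "q * m + r < q * (m + 1)" using r(1) by simp
    also have "\<dots> \<le> q * q^k" using m(1) by (intro mult_left_mono) auto
    finally show ?thesis by simp
  qed
  moreover have "real ?i \<le> real (q^Suc k) * z$l" "real (q^Suc k) * z$l \<le> real ?i + 1"
    using r(2,3) unfolding x_def by auto
  ultimately show "z \<in> stack l (q^Suc k) (\<lambda>i. polyline k (i div q))"
    using b unfolding stack_def by (intro CollectI exI[of _ ?i]) simp
qed

end

section \<open>Straightening all towers and passing to the limit\<close>

locale tame_regulated = regulated l f g q \<delta>
  for l :: "'n::finite" and f g :: "'n \<Rightarrow> real \<Rightarrow> real" and q :: nat and \<delta> :: "nat \<Rightarrow> real" +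
  fixes vb :: real
  assumes vb: "0 \<le> vb" "vb < 1"
    and jump_bound: "\<And>k i j. 0 < i \<Longrightarrow> i < q^k \<Longrightarrow> \<bar>jump k i j\<bar> \<le> vb"
    and \<delta>_summable: "summable (\<lambda>k. (1 + real CARD('n) * (3 + 1 / (1 - vb)))^k * \<delta> k)"
begin

text \<open>Multiples of \<open>q\<close> are the interfaces inherited from level
  \<open>k\<close>.\<close>

definition new :: "nat \<Rightarrow> nat set" where
  "new k = {i\<in>{1..<q^Suc k}. \<not> q dvd i}"

definition new_jump :: "nat \<Rightarrow> nat \<Rightarrow> 'n \<Rightarrow> real" where
  "new_jump k i j = (if i \<in> new k then jump (Suc k) i j else 0)"

definition drift :: "nat \<Rightarrow> 'n \<Rightarrow> real \<Rightarrow> real" where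
  "drift k j t = (\<Sum>m<q^Suc k. ramp (Suc k) m t * rise (Suc k) m j) - (\<Sum>m<q^k. ramp k m t * rise k m j)"

lemma jump_refine: "jump (Suc k) (q * i) j = jump k i j"
proof -
  have "real (q * i) / real (q^Suc k) = real i / real (q^k)" using q by simp
  then show ?thesis unfolding jump_def by presburger
qed

text \<open>The jumps at inherited interfaces, the multiples of \<open>q\<close>, occur at both
  levels and cancel.\<close>

lemma sum_new_jump:
  "i < q^Suc k \<Longrightarrow> (\<Sum>m=1..i. new_jump k m j) = (\<Sum>m=1..i. jump (Suc k) m j) - (\<Sum>m=1..i div q. jump k m j)"
proof (induction i)
  case (Suc i)
  show ?case
  proof (cases "q dvd Suc i")
    case True
    then obtain m where m: "Suc i = q * m" by blast
    then have "Suc i div q = m" using q by simp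
    moreover have "Suc i div q = Suc (i div q)" using True by (simp add: div_Suc dvd_eq_mod_eq_0)
    ultimately have "m = Suc (i div q)" by simp
    then have "jump (Suc k) (Suc i) j = jump k (Suc (i div q)) j" using jump_refine[of k m j] m by simp
    moreover have "new_jump k (Suc i) j = 0" using True by (simp add: new_jump_def new_def)
    ultimately show ?thesis using Suc \<open>Suc i div q = Suc (i div q)\<close> by simp
  next
    case False
    then have "Suc i div q = i div q" by (simp add: div_Suc dvd_eq_mod_eq_0)
    moreover have "new_jump k (Suc i) j = jump (Suc k) (Suc i) j" using False Suc.prems by (simp add: new_jump_def new_def)
    ultimately show ?thesis using Suc by simp
  qed
qed simp

lemma ramp_sum_lip: "\<exists>L. \<forall>j s t. \<bar>(\<Sum>m<q^k. ramp k m s * rise k m j) - (\<Sum>m<q^k. ramp k m t * rise k m j)\<bar> \<le> L * \<bar>s - t\<bar>"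
proof -
  define L where "L = (\<Sum>j\<in>UNIV. \<Sum>m<q^k. 3 * real q * real (q^k) * \<bar>rise k m j\<bar>)"
  have "\<bar>(\<Sum>m<q^k. ramp k m s * rise k m j) - (\<Sum>m<q^k. ramp k m t * rise k m j)\<bar> \<le> L * \<bar>s - t\<bar>" for j s t
  proof -
    have "\<bar>(\<Sum>m<q^k. ramp k m s * rise k m j) - (\<Sum>m<q^k. ramp k m t * rise k m j)\<bar>
       = \<bar>\<Sum>m<q^k. (ramp k m s - ramp k m t) * rise k m j\<bar>"
      by (simp add: sum_subtractf left_diff_distrib)
    also have "\<dots> \<le> (\<Sum>m<q^k. (3 * real q * real (q^k) * \<bar>s - t\<bar>) * \<bar>rise k m j\<bar>)"
      by (rule order_trans[OF sum_abs], rule sum_mono, unfold abs_mult, rule mult_right_mono[OF ramp_lip]) simp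
    also have "\<dots> = (\<Sum>m<q^k. 3 * real q * real (q^k) * \<bar>rise k m j\<bar>) * \<bar>s - t\<bar>"
      unfolding sum_distrib_right by (rule sum.cong) (simp_all add: mult_ac)
    also have "\<dots> \<le> L * \<bar>s - t\<bar>"
    proof (rule mult_right_mono)
      show "(\<Sum>m<q^k. 3 * real q * real (q^k) * \<bar>rise k m j\<bar>) \<le> L" unfolding L_def
        by (rule member_le_sum[of j UNIV "\<lambda>j. \<Sum>m<q^k. 3 * real q * real (q^k) * \<bar>rise k m j\<bar>"])
           (auto intro!: sum_nonneg)
    qed simp
    finally show ?thesis .
  qed
  then show ?thesis by blast
qed

lemma drift_lip: "\<exists>L. \<forall>j s t. \<bar>drift k j s - drift k j t\<bar> \<le> L * \<bar>s - t\<bar>"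
proof -
  obtain L1 where 1: "\<And>j s t. \<bar>(\<Sum>m<q^Suc k. ramp (Suc k) m s * rise (Suc k) m j)
      - (\<Sum>m<q^Suc k. ramp (Suc k) m t * rise (Suc k) m j)\<bar> \<le> L1 * \<bar>s - t\<bar>"
    using ramp_sum_lip[of "Suc k"] by blast
  obtain L2 where 2: "\<And>j s t. \<bar>(\<Sum>m<q^k. ramp k m s * rise k m j)
      - (\<Sum>m<q^k. ramp k m t * rise k m j)\<bar> \<le> L2 * \<bar>s - t\<bar>"
    using ramp_sum_lip[of k] by blast
  have "\<bar>drift k j s - drift k j t\<bar> \<le> (L1 + L2) * \<bar>s - t\<bar>" for j s t
    using 1[where j = j and s = s and t = t] 2[where j = j and s = s and t = t]
    unfolding drift_def distrib_right by linarith
  then show ?thesis by blast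
qed

lemma ramp_out:
  "t \<le> 0 \<Longrightarrow> ramp k m t = ramp k m 0" "1 \<le> t \<Longrightarrow> m < q^k \<Longrightarrow> ramp k m t = ramp k m 1"
proof -
  assume "t \<le> 0"
  then have "real (q^k) * t \<le> 0" by (simp add: mult_nonneg_nonpos)
  then have "ramp k m t = 0" using third_q(2) by (intro ramp_0) linarith
  moreover have "ramp k m 0 = 0" using third_q(2) by (intro ramp_0) linarith
  ultimately show "ramp k m t = ramp k m 0" by simp
next
  assume *: "1 \<le> t" "m < q^k"
  have m: "real m + 1 \<le> real (q^k)" using *(2) by linarith
  have "real (q^k) * 1 \<le> real (q^k) * t" using *(1) by (intro mult_left_mono) auto
  then have "ramp k m t = 1" using third_q(1) m by (intro ramp_1) linarith
  moreover have "ramp k m 1 = 1" using third_q(1) m by (intro ramp_1) linarith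
  ultimately show "ramp k m t = ramp k m 1" by simp
qed

text \<open>The window \<open>1 / (4 * real q)\<close> is shorter than the flat initial piece
  \<open>1 / (3 * real q)\<close> of a fine ramp, and the coarse path is on its plateau at every new
  interface. The bound \<open>2 * \<delta> k\<close> arises because fine and coarse path are each
  compared with \<open>f\<close> at the bottom of the coarse slab.\<close>

lemma slab_step_k:
  "\<exists>Lc. slab_step (q^Suc k) (1 / (4 * real q)) vb (2 * \<delta> k) Lc (polyline (Suc k)) (\<lambda>i. polyline k (i div q))
     (drift k) (new_jump k) (\<lambda>i j. g j (real i / real (q^Suc k)))
     (\<lambda>i j. g j (real (i div q + 1) / real (q^k))) (new k)"
proof -
  obtain Lc where Lc: "\<And>j s t. \<bar>drift k j s - drift k j t\<bar> \<le> Lc * \<bar>s - t\<bar>" using drift_lip[of k] by blast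
  have q0: "0 < real q" using q by simp
  have e: "1 / (4 * real q) \<le> 1 / 8" using q by (simp add: field_simps)
  have e3: "1 / (4 * real q) \<le> 1 / (3 * real q)" using q by (simp add: field_simps)
  have t3: "2 / (3 * real q) \<le> 1 / 3" by (rule third_q(1))
  have sc: "real (q^Suc k) * t = real q * (real (q^k) * t)" for t by simp
  have dq: "real q * real (i div q) \<le> real i \<and> real i + 1 \<le> real q * (real (i div q) + 1)" for i
    using real_div_bounds[of q i] q by simp
  have slab: "real (i div q) \<le> real (q^k) * t \<and> real (q^k) * t \<le> real (i div q) + 1"
    if "real i \<le> real (q^Suc k) * t" "real (q^Suc k) * t \<le> real i + 1" for i t
  proof -
    have "real q * real (i div q) \<le> real q * (real (q^k) * t)" "real q * (real (q^k) * t) \<le> real q * (real (i div q) + 1)"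
      using dq[of i] that unfolding sc by linarith+
    then show ?thesis using q0 by (simp only: mult_le_cancel_left_pos)
  qed
  \<comment> \<open>A new interface is at least one fine slab above the bottom of its coarse slab.
    In units of fine slabs, allowing 1/8 for the window leaves 7/8, more than the 2/3 at which the
    coarse ramp is complete.\<close>
  have plateau: "polyline k (i div q) j t = g j (real (i div q + 1) / real (q^k))"
    if i: "i \<in> new k" and t: "\<bar>real (q^Suc k) * t - real i\<bar> \<le> 1 / (4 * real q)" for i j t
  proof -
    have "\<not> q dvd i" using i by (simp add: new_def)
    then have "q * (i div q) \<noteq> i" by (metis dvd_triv_left)
    then have "real q * real (i div q) + 1 \<le> real i"
    proof -
      have "q * (i div q) < i" using \<open>q * (i div q) \<noteq> i\<close> by (simp add: le_neq_implies_less)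
      then have "q * (i div q) + 1 \<le> i" by simp
      then have "real (q * (i div q) + 1) \<le> real i" by (simp only: of_nat_le_iff)
      then show ?thesis by simp
    qed
    then have "7 / 8 \<le> real q * (real (q^k) * t - real (i div q))"
      using t e unfolding sc right_diff_distrib by linarith
    then have "2 / 3 \<le> real q * (real (q^k) * t - real (i div q))" by linarith
    then have "2 / 3 / real q \<le> real (q^k) * t - real (i div q)"
      using q0 by (simp only: pos_divide_le_eq mult.commute)
    then have "ramp k (i div q) t = 1" by (intro ramp_1) simp
    then show ?thesis by (simp add: polyline_def rise_def)
  qed
  have "slab_step (q^Suc k) (1 / (4 * real q)) vb (2 * \<delta> k) Lc (polyline (Suc k)) (\<lambda>i. polyline k (i div q))
     (drift k) (new_jump k) (\<lambda>i j. g j (real i / real (q^Suc k)))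
     (\<lambda>i j. g j (real (i div q + 1) / real (q^k))) (new k)"
  proof
    show "0 < q^Suc k" by (rule qn_pos)
    show "0 < 1 / (4 * real q)" "1 / (4 * real q) \<le> 1 / 4" using q0 e by simp_all
    show "0 \<le> vb" "vb < 1" by (rule vb)+
    show "\<bar>drift k j s - drift k j t\<bar> \<le> Lc * \<bar>s - t\<bar>" for j s t by (rule Lc)
    show "drift k j t = drift k j 0" if "t \<le> 0" for j t
      unfolding drift_def by (simp only: ramp_out(1)[OF that])
    show "drift k j t = drift k j 1" if "1 \<le> t" for j t
    proof -
      have eq: "(\<Sum>m<q^i. ramp i m t * rise i m j) = (\<Sum>m<q^i. ramp i m 1 * rise i m j)" for i
        by (rule sum.cong[OF refl]) (simp only: lessThan_iff ramp_out(2)[OF that])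
      show ?thesis unfolding drift_def by (simp only: eq)
    qed
    show "new k \<subseteq> {1..<q^Suc k}" by (auto simp: new_def)
    show "new_jump k i j = 0" if "i \<notin> new k" for i j using that by (simp add: new_jump_def)
    show "\<bar>new_jump k i j\<bar> \<le> vb" for i j
      using jump_bound[of i "Suc k" j] vb by (auto simp: new_jump_def new_def)
    show "polyline (Suc k) i j t = polyline k (i div q) j t + drift k j t + (\<Sum>m=1..i. new_jump k m j)"
      if i: "i < q^Suc k" "real i \<le> real (q^Suc k) * t" "real (q^Suc k) * t \<le> real i + 1" for i j t
      unfolding sum_new_jump[OF i(1)] polyline_eq[OF i]
      using polyline_eq[OF div_q_less[OF i(1)], of t j] slab[OF i(2,3)] unfolding drift_def by linarith
    show "\<bar>polyline (Suc k) i j t - polyline k (i div q) j t\<bar> \<le> 2 * \<delta> k"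
      if i: "i < q^Suc k" "real i \<le> real (q^Suc k) * t" "real (q^Suc k) * t \<le> real i + 1" for i j t
      using polyline_Suc_close[OF i(1), of j t] polyline_close[OF div_q_less[OF i(1)], of j t] by linarith
    show "polyline (Suc k) (i - 1) j t = g j (real i / real (q^Suc k)) \<and>
        polyline k ((i - 1) div q) j t = g j (real (i div q + 1) / real (q^k))"
      if i: "i \<in> new k" "\<bar>real (q^Suc k) * t - real i\<bar> \<le> 1 / (4 * real q)" "real (q^Suc k) * t \<le> real i" for i j t
    proof
      have i1: "1 \<le> i" "\<not> q dvd i" using i(1) by (auto simp: new_def)
      have "ramp (Suc k) (i - 1) t = 1"
      proof (rule ramp_1)
        have "real (i - 1) = real i - 1" using i1 by simp
        then show "2 / (3 * real q) \<le> real (q^Suc k) * t - real (i - 1)" using i(2) t3 e by linarith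
      qed
      then show "polyline (Suc k) (i - 1) j t = g j (real i / real (q^Suc k))"
        using i1(1) by (simp add: polyline_def rise_def)
      \<comment> \<open>As \<open>i\<close> is no multiple of \<open>q\<close>, both fine slabs at
        the interface lie in the same coarse slab.\<close>
      have "(i - 1) div q = i div q" using i1 div_Suc[of "i - 1" q] by (simp add: dvd_eq_mod_eq_0)
      then show "polyline k ((i - 1) div q) j t = g j (real (i div q + 1) / real (q^k))"
        using plateau[OF i(1,2)] by metis
    qed
    show "polyline (Suc k) i j t = g j (real i / real (q^Suc k)) + new_jump k i j \<and>
        polyline k (i div q) j t = g j (real (i div q + 1) / real (q^k))"
      if i: "i \<in> new k" "\<bar>real (q^Suc k) * t - real i\<bar> \<le> 1 / (4 * real q)" "real i \<le> real (q^Suc k) * t" for i j t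
    proof
      have "ramp (Suc k) i t = 0" by (rule ramp_0) (use i(2) e3 in linarith)
      then show "polyline (Suc k) i j t = g j (real i / real (q^Suc k)) + new_jump k i j"
        using i(1) by (simp add: polyline_def new_jump_def jump_def)
      show "polyline k (i div q) j t = g j (real (i div q + 1) / real (q^k))" by (rule plateau[OF i(1,2)])
    qed
  qed
  then show ?thesis by blast
qed

lemma tower_step:
  assumes "0 < K"
  obtains H :: "real^'n \<Rightarrow> real^'n" where "autohomeo H" "\<exists>L. L-lipschitz_on UNIV H"
    "\<And>z. z \<in> tower (Suc k) \<longleftrightarrow> H z \<in> tower k"
    "\<And>z j. j \<noteq> l \<Longrightarrow> \<bar>H z $ j - z $ j\<bar> \<le> 6 * \<delta> k" "\<And>z. \<bar>H z $ l - z $ l\<bar> \<le> 1 / K"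
    "\<And>z w j. z $ l = w $ l \<Longrightarrow> j \<noteq> l \<Longrightarrow> \<bar>H z $ j - H w $ j\<bar> \<le> (3 + 1 / (1 - vb)) * norm (z - w)"
    "\<And>z w. z $ l = w $ l \<Longrightarrow> \<bar>H z $ l - H w $ l\<bar> \<le> 1 / K * norm (z - w)"
proof -
  obtain Lc where "slab_step (q^Suc k) (1 / (4 * real q)) vb (2 * \<delta> k) Lc (polyline (Suc k)) (\<lambda>i. polyline k (i div q))
     (drift k) (new_jump k) (\<lambda>i j. g j (real i / real (q^Suc k)))
     (\<lambda>i j. g j (real (i div q + 1) / real (q^k))) (new k)"
    using slab_step_k by blast
  from slab_step.refining_homeo[OF this assms, where l = l] obtain H :: "real^'n \<Rightarrow> real^'n" where
    "autohomeo H" "\<exists>L. L-lipschitz_on UNIV H"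
    "\<And>z. z \<in> stack l (q^Suc k) (polyline (Suc k)) \<longleftrightarrow> H z \<in> stack l (q^Suc k) (\<lambda>i. polyline k (i div q))"
    "\<And>z j. j \<noteq> l \<Longrightarrow> \<bar>H z $ j - z $ j\<bar> \<le> 3 * (2 * \<delta> k)" "\<And>z. \<bar>H z $ l - z $ l\<bar> \<le> 1 / K"
    "\<And>z w j. z $ l = w $ l \<Longrightarrow> j \<noteq> l \<Longrightarrow> \<bar>H z $ j - H w $ j\<bar> \<le> (3 + 1 / (1 - vb)) * norm (z - w)"
    "\<And>z w. z $ l = w $ l \<Longrightarrow> \<bar>H z $ l - H w $ l\<bar> \<le> 1 / K * norm (z - w)" by metis
  then show ?thesis using that[of H] unfolding stack_coarsen tower_def[of "Suc k", symmetric] by simp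
qed

text \<open>The factor by which one step may enlarge the horizontal Lipschitz constant: the constant
  per coordinate in \<open>tower_step\<close>, summed over the coordinates, plus 1 for the vertical
  motion. Its powers are the weights in \<open>\<delta>_summable\<close>.\<close>

definition \<kappa> :: real where
  "\<kappa> = 1 + real CARD('n) * (3 + 1 / (1 - vb))"

lemma \<kappa>_ge_1: "1 \<le> \<kappa>" "1 \<le> \<kappa>^k"
proof -
  show "1 \<le> \<kappa>" using vb by (simp add: \<kappa>_def)
  then show "1 \<le> \<kappa>^k" by (rule one_le_power)
qed

text \<open>The homeomorphisms straightening the towers have horizontal Lipschitz constants that grow
  only like \<open>\<kappa>\<^sup>k\<close>; their vertical constants are not controlled, but the vertical displacement of
  the next step may be chosen small depending on them.\<close>

definition straightener :: "nat \<Rightarrow> (real^'n \<Rightarrow> real^'n) \<Rightarrow> bool" where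
  "straightener k E \<longleftrightarrow> autohomeo E \<and> (\<exists>L. L-lipschitz_on UNIV E) \<and>
     (\<forall>z w. z$l = w$l \<longrightarrow> norm (E z - E w) \<le> \<kappa>^k * norm (z - w)) \<and>
     (\<forall>z. z \<in> tower k \<longleftrightarrow> E z \<in> {w. \<forall>i. 0 \<le> w$i \<and> w$i \<le> 1})"

text \<open>It bounds the change of both \<open>E\<close> and its inverse in one step; the geometric
  term pays for the vertical motion.\<close>

definition gap :: "nat \<Rightarrow> real" where
  "gap k = real CARD('n) * 6 * (\<kappa>^k * \<delta> k) + 2 * (1/2)^k"

lemma gap_summable: "summable gap"
  unfolding gap_def using \<delta>_summable unfolding \<kappa>_def[symmetric]
  by (intro summable_add summable_mult) auto

lemma norm_horizontal:
  fixes x y :: "real^'n"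
  assumes "x$l = y$l" "\<And>j. j \<noteq> l \<Longrightarrow> \<bar>x$j - y$j\<bar> \<le> b" "0 \<le> b"
  shows "norm (x - y) \<le> real CARD('n) * b"
proof -
  have "norm (x - y) \<le> (\<Sum>j\<in>UNIV. \<bar>(x - y)$j\<bar>)" by (rule norm_le_l1_cart)
  also have "\<dots> \<le> (\<Sum>j\<in>(UNIV::'n set). b)"
    by (rule sum_mono) (use assms in \<open>metis abs_zero right_minus_eq vector_minus_component\<close>)
  finally show ?thesis by simp
qed

lemma norm_vertical:
  fixes x y :: "real^'n"
  assumes "\<And>j. j \<noteq> l \<Longrightarrow> x$j = y$j"
  shows "norm (x - y) \<le> \<bar>x$l - y$l\<bar>"
proof -
  have "norm (x - y) \<le> (\<Sum>j\<in>UNIV. \<bar>(x - y)$j\<bar>)" by (rule norm_le_l1_cart)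
  also have "\<dots> = (\<Sum>j\<in>UNIV. if j = l then \<bar>x$l - y$l\<bar> else 0)"
    by (rule sum.cong) (use assms in auto)
  finally show ?thesis by simp
qed

text \<open>Tower 0 is a single prism along one path, so a shear straightens it, preserving
  distances between points of equal height.\<close>

lemma straightener_0: "\<exists>E. straightener 0 E"
proof -
  define E where "E = (\<lambda>z::real^'n. (\<chi> j. if j = l then z$l else z$j - polyline 0 0 j (z$l)) :: real^'n)"
  have El: "E z $ l = z$l" for z by (simp add: E_def)
  have Ej: "E z $ j = z$j - polyline 0 0 j (z$l)" if "j \<noteq> l" for z j using that by (simp add: E_def)
  have lipE: "\<exists>L. L-lipschitz_on UNIV E"
  proof (rule lip_vector)
    fix j
    have "lip (\<lambda>z. polyline 0 0 j (z$l))"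
    proof (rule lip_combine[OF lip_component[of l] lip_const[of 0]])
      show "0 \<le> 3 * real q * \<bar>rise 0 0 j\<bar>" by simp
      fix x y :: "real^'n"
      have "polyline 0 0 j (x$l) - polyline 0 0 j (y$l) = (ramp 0 0 (x$l) - ramp 0 0 (y$l)) * rise 0 0 j"
        by (simp add: polyline_def algebra_simps)
      then have "\<bar>polyline 0 0 j (x$l) - polyline 0 0 j (y$l)\<bar> = \<bar>ramp 0 0 (x$l) - ramp 0 0 (y$l)\<bar> * \<bar>rise 0 0 j\<bar>"
        by (simp add: abs_mult)
      also have "\<dots> \<le> (3 * real q * real (q^0) * \<bar>x$l - y$l\<bar>) * \<bar>rise 0 0 j\<bar>"
        by (rule mult_right_mono[OF ramp_lip]) simp
      finally show "\<bar>polyline 0 0 j (x$l) - polyline 0 0 j (y$l)\<bar>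
         \<le> 3 * real q * \<bar>rise 0 0 j\<bar> * \<bar>x$l - y$l\<bar> + 0 * \<bar>0 - (0::real)\<bar>" by (simp add: mult_ac)
    qed simp
    then show "lip (\<lambda>z. E z $ j)"
      using lip_diff[OF lip_component[of j]] lip_component[of l] by (cases "j = l") (auto simp: El Ej)
  qed
  moreover have "autohomeo E"
  proof (rule autohomeoI)
    show "continuous_on UNIV E" using lipE lipschitz_on_continuous_on by blast
    show "inj E"
    proof (rule injI)
      fix z w assume eq: "E z = E w"
      then have l: "z$l = w$l" using El by metis
      have "z$j = w$j" for j
        using arg_cong[OF eq, of "\<lambda>x. x$j"] l Ej[of j] by (cases "j = l") auto
      then show "z = w" by (simp add: vec_eq_iff)
    qed
    show "surj E" unfolding surj_def
    proof
      fix y :: "real^'n"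
      have "y = E (\<chi> j. if j = l then y$l else y$j + polyline 0 0 j (y$l))"
        by (simp add: E_def vec_eq_iff)
      then show "\<exists>x. y = E x" by blast
    qed
  qed
  moreover have "norm (E z - E w) \<le> \<kappa>^0 * norm (z - w)" if "z$l = w$l" for z w
  proof -
    have "E z - E w = z - w" unfolding vec_eq_iff
    proof
      fix j show "(E z - E w)$j = (z - w)$j" using that by (cases "j = l") (auto simp: El Ej)
    qed
    then show ?thesis by simp
  qed
  moreover have "z \<in> tower 0 \<longleftrightarrow> E z \<in> {w. \<forall>i. 0 \<le> w$i \<and> w$i \<le> 1}" for z
  proof -
    have "z \<in> tower 0 \<longleftrightarrow> 0 \<le> z$l \<and> z$l \<le> 1 \<and>
       (\<forall>j. j \<noteq> l \<longrightarrow> polyline 0 0 j (z$l) \<le> z$j \<and> z$j \<le> polyline 0 0 j (z$l) + 1)"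
      by (simp add: tower_def stack_def)
    also have "\<dots> \<longleftrightarrow> (\<forall>i. 0 \<le> E z $ i \<and> E z $ i \<le> 1)"
    proof -
      have "(0 \<le> E z $ j \<and> E z $ j \<le> 1) \<longleftrightarrow> polyline 0 0 j (z$l) \<le> z$j \<and> z$j \<le> polyline 0 0 j (z$l) + 1"
        if "j \<noteq> l" for j using Ej[OF that, of z] by auto
      then show ?thesis using El by metis
    qed
    finally show ?thesis by simp
  qed
  ultimately show ?thesis unfolding straightener_def by blast
qed

text \<open>The new map is \<open>E\<close> after the step \<open>H\<close>. A displacement is split
  at \<open>mix\<close> into a vertical leg, measured by the full Lipschitz constant
  \<open>L\<close> of \<open>E\<close>, and a horizontal leg, measured by
  \<open>\<kappa>^k\<close>.\<close>

lemma straightener_Suc: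
  assumes "straightener k E"
  shows "\<exists>E'. straightener (Suc k) E' \<and> (\<forall>z. norm (E' z - E z) \<le> gap k) \<and> (\<forall>w. norm (inv E' w - inv E w) \<le> gap k)"
proof -
  have E: "autohomeo E" "\<And>z w. z$l = w$l \<Longrightarrow> norm (E z - E w) \<le> \<kappa>^k * norm (z - w)"
    "\<And>z. z \<in> tower k \<longleftrightarrow> E z \<in> {w. \<forall>i. 0 \<le> w$i \<and> w$i \<le> 1}"
    and "\<exists>L. L-lipschitz_on UNIV E" using assms unfolding straightener_def by blast+
  then obtain L where L: "L-lipschitz_on UNIV E" by blast
  have L0: "0 \<le> L" using lipschitz_on_nonneg[OF L] .
  \<comment> \<open>Chosen after \<open>E\<close>: the vertical move of \<open>H\<close> costs at
    most \<open>(1/2)^k\<close>, even when magnified by \<open>L\<close>. Adding 1 keeps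
    \<open>K\<close> positive if \<open>L = 0\<close>.\<close>
  define K where "K = (L + 1) * 2^k"
  have K: "0 < K" using L0 by (simp add: K_def)
  have LK: "L * (1 / K) \<le> (1/2)^k" "1 / K \<le> (1/2)^k"
  proof -
    have e: "1 / K = 1 / (L + 1) * (1/2)^k" by (simp add: K_def power_one_over)
    have "L * (1 / K) = L / (L + 1) * (1/2)^k" by (simp add: e)
    also have "\<dots> \<le> 1 * (1/2)^k" using L0 by (intro mult_right_mono) auto
    finally show "L * (1 / K) \<le> (1/2)^k" by simp
    have "1 / (L + 1) * (1/2)^k \<le> 1 * (1/2::real)^k" using L0 by (intro mult_right_mono) auto
    then show "1 / K \<le> (1/2)^k" unfolding e by simp
  qed
  have L1: "L * (1 / K) \<le> 1" using LK(1) by (rule order_trans) (simp add: power_le_one)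
  from tower_step[OF K, of k] obtain H :: "real^'n \<Rightarrow> real^'n" where H: "autohomeo H" "\<exists>L. L-lipschitz_on UNIV H"
    "\<And>z. z \<in> tower (Suc k) \<longleftrightarrow> H z \<in> tower k"
    "\<And>z j. j \<noteq> l \<Longrightarrow> \<bar>H z $ j - z $ j\<bar> \<le> 6 * \<delta> k" "\<And>z. \<bar>H z $ l - z $ l\<bar> \<le> 1 / K"
    "\<And>z w j. z $ l = w $ l \<Longrightarrow> j \<noteq> l \<Longrightarrow> \<bar>H z $ j - H w $ j\<bar> \<le> (3 + 1 / (1 - vb)) * norm (z - w)"
    "\<And>z w. z $ l = w $ l \<Longrightarrow> \<bar>H z $ l - H w $ l\<bar> \<le> 1 / K * norm (z - w)" by metis
  define mix where "mix = (\<lambda>a b::real^'n. (\<chi> j. if j = l then b$l else a$j) :: real^'n)"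
  have mix: "mix a b $ l = b$l" "j \<noteq> l \<Longrightarrow> mix a b $ j = a$j" for a b j by (auto simp: mix_def)
  have vert: "norm (E a - E (mix a b)) \<le> L * \<bar>a$l - b$l\<bar>" for a b
  proof -
    have "norm (E a - E (mix a b)) \<le> L * norm (a - mix a b)"
      using lipschitz_on_normD[OF L] by simp
    also have "\<dots> \<le> L * \<bar>a$l - b$l\<bar>"
      using norm_vertical[of a "mix a b"] mix L0 by (intro mult_left_mono) auto
    finally show ?thesis .
  qed
  have horiz: "norm (E (mix a b) - E b) \<le> \<kappa>^k * (real CARD('n) * r)"
    if "\<And>j. j \<noteq> l \<Longrightarrow> \<bar>a$j - b$j\<bar> \<le> r" "0 \<le> r" for a b r
  proof -
    have "norm (E (mix a b) - E b) \<le> \<kappa>^k * norm (mix a b - b)" by (rule E(2)) (simp add: mix)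
    also have "\<dots> \<le> \<kappa>^k * (real CARD('n) * r)"
      using \<kappa>_ge_1(2)[of k] that mix by (intro mult_left_mono norm_horizontal) auto
    finally show ?thesis .
  qed
  have split: "norm (E a - E b) \<le> L * \<bar>a$l - b$l\<bar> + \<kappa>^k * (real CARD('n) * r)"
    if "\<And>j. j \<noteq> l \<Longrightarrow> \<bar>a$j - b$j\<bar> \<le> r" "0 \<le> r" for a b r
    using vert[of a b] horiz[OF that] norm_triangle_ineq[of "E a - E (mix a b)" "E (mix a b) - E b"] by simp
  define E' where "E' = (\<lambda>z. E (H z))"
  have disp: "norm (E' z - E z) \<le> gap k" for z
  proof -
    have "norm (E' z - E z) \<le> L * \<bar>H z $ l - z$l\<bar> + \<kappa>^k * (real CARD('n) * (6 * \<delta> k))"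
      unfolding E'_def by (rule split) (use H(4) \<delta>_nonneg in auto)
    moreover have "L * \<bar>H z $ l - z$l\<bar> \<le> L * (1 / K)" using H(5) L0 by (intro mult_left_mono) auto
    moreover have "\<kappa>^k * (real CARD('n) * (6 * \<delta> k)) = real CARD('n) * 6 * (\<kappa>^k * \<delta> k)" by simp
    moreover have "0 \<le> (1/2::real)^k" by simp
    ultimately show ?thesis using LK(1) unfolding gap_def by linarith
  qed
  have "norm (E' z - E' w) \<le> \<kappa>^Suc k * norm (z - w)" if zw: "z$l = w$l" for z w
  proof -
    let ?r = "(3 + 1 / (1 - vb)) * norm (z - w)"
    have "norm (E' z - E' w) \<le> L * \<bar>H z $ l - H w $ l\<bar> + \<kappa>^k * (real CARD('n) * ?r)"
      unfolding E'_def by (rule split) (use H(6)[OF zw] vb in auto)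
    moreover have "L * \<bar>H z $ l - H w $ l\<bar> \<le> L * (1 / K * norm (z - w))"
      using H(7)[OF zw] L0 by (intro mult_left_mono) auto
    moreover have "L * (1 / K * norm (z - w)) \<le> 1 * norm (z - w)"
      unfolding mult.assoc[symmetric] by (rule mult_right_mono[OF L1]) simp
    moreover have "1 * norm (z - w) \<le> \<kappa>^k * norm (z - w)" by (rule mult_right_mono[OF \<kappa>_ge_1(2)]) simp
    ultimately have "norm (E' z - E' w) \<le> \<kappa>^k * norm (z - w) + \<kappa>^k * (real CARD('n) * ?r)" by linarith
    also have "\<dots> = \<kappa>^Suc k * norm (z - w)" by (simp add: \<kappa>_def algebra_simps)
    finally show ?thesis .
  qed
  moreover have "\<exists>L. L-lipschitz_on UNIV E'"
  proof -
    obtain L2 where "L2-lipschitz_on UNIV H" using H(2) by blast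
    then have "(L * L2)-lipschitz_on UNIV (\<lambda>z. E (H z))"
      by (rule lipschitz_on_compose2) (rule lipschitz_on_subset[OF L], simp)
    then show ?thesis unfolding E'_def by blast
  qed
  moreover have "autohomeo E'" unfolding E'_def by (rule autohomeo_comp[OF E(1) H(1)])
  moreover have "z \<in> tower (Suc k) \<longleftrightarrow> E' z \<in> {w. \<forall>i. 0 \<le> w$i \<and> w$i \<le> 1}" for z
    unfolding H(3) E(3) E'_def ..
  ultimately have "straightener (Suc k) E'" unfolding straightener_def by blast
  moreover have "norm (inv E' w - inv E w) \<le> gap k" for w
  proof -
    have bE: "bij E" and bH: "bij H"
      using E(1) H(1) by (auto simp: autohomeo_def homeomorphism_def bij_def intro: inj_on_inverseI)
    \<comment> \<open>The two inverses at \<open>w\<close> are \<open>y\<close> and the point that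
      \<open>H\<close> sends to \<open>y\<close>; they differ by a displacement of \<open>H\<close>
      alone, so no Lipschitz constant enters.\<close>
    define y where "y = inv E w"
    define x where "x = inv H y"
    have Hx: "H x = y" unfolding x_def by (rule surj_f_inv_f[OF bij_is_surj[OF bH]])
    have "inv E' w = x"
      unfolding E'_def x_def y_def using o_inv_distrib[OF bE bH] by (simp add: o_def fun_eq_iff)
    then have "norm (inv E' w - inv E w) = norm (x - H x)" by (simp add: Hx y_def)
    also have "\<dots> \<le> norm (x - mix x (H x)) + norm (mix x (H x) - H x)"
      using norm_triangle_ineq[of "x - mix x (H x)" "mix x (H x) - H x"] by simp
    also have "\<dots> \<le> \<bar>x$l - H x $ l\<bar> + real CARD('n) * (6 * \<delta> k)"
    proof (rule add_mono)
      show "norm (x - mix x (H x)) \<le> \<bar>x$l - H x $ l\<bar>"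
        using norm_vertical[of x "mix x (H x)"] mix by simp
      show "norm (mix x (H x) - H x) \<le> real CARD('n) * (6 * \<delta> k)"
        by (rule norm_horizontal) (use mix H(4) \<delta>_nonneg in \<open>auto simp: abs_minus_commute\<close>)
    qed
    also have "\<dots> \<le> gap k"
    proof -
      have "\<bar>x$l - H x $ l\<bar> \<le> (1/2)^k" using H(5)[of x] LK(2) by (simp add: abs_minus_commute)
      moreover have "real CARD('n) * 6 * (1 * \<delta> k) \<le> real CARD('n) * 6 * (\<kappa>^k * \<delta> k)"
        using \<kappa>_ge_1(2)[of k] \<delta>_nonneg[of k] by (intro mult_left_mono mult_right_mono) auto
      moreover have "0 \<le> (1/2::real)^k" by simp
      moreover have "real CARD('n) * (6 * \<delta> k) = real CARD('n) * 6 * (1 * \<delta> k)" by simp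
      ultimately show ?thesis unfolding gap_def by linarith
    qed
    finally show ?thesis .
  qed
  ultimately show ?thesis using disp by blast
qed

theorem tame_ball_column: "tame_ball (column l f g)"
proof -
  obtain E where E: "\<And>k. straightener k (E k)"
    "\<And>k. (\<forall>z. norm (E (Suc k) z - E k z) \<le> gap k) \<and> (\<forall>w. norm (inv (E (Suc k)) w - inv (E k) w) \<le> gap k)"
    using dependent_nat_choice[of straightener "\<lambda>k E E'. (\<forall>z. norm (E' z - E z) \<le> gap k) \<and> (\<forall>w. norm (inv E' w - inv E w) \<le> gap k)"]
      straightener_0 straightener_Suc by metis
  let ?Q = "{w::real^'n. \<forall>i. 0 \<le> w$i \<and> w$i \<le> 1}"
  have hom: "homeomorphism UNIV UNIV (E k) (inv (E k))" for k
  proof -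
    obtain F where F: "homeomorphism UNIV UNIV (E k) F"
      using E(1)[of k] by (auto simp: straightener_def autohomeo_def)
    then have "inv (E k) = F" by (intro inv_equality) (auto simp: homeomorphism_def)
    then show ?thesis using F by simp
  qed
  have "closed ?Q"
  proof -
    have "?Q = (\<Inter>i. {w. 0 \<le> w$i} \<inter> {w. w$i \<le> 1})" by auto
    then show ?thesis
      by (simp only:) (intro closed_INT closed_Int ballI closed_Collect_le continuous_intros)
  qed
  have lim: "(\<lambda>k. real CARD('n) * (2 * \<delta> k)) \<longlonglongrightarrow> 0"
    using tendsto_mult_right_zero[OF tendsto_mult_right_zero[OF \<delta>_lim]] by simp
  have tk: "z \<in> tower k \<longleftrightarrow> E k z \<in> ?Q" for k z using E(1)[of k] unfolding straightener_def by blast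
  have dE: "norm (E (Suc k) z - E k z) \<le> gap k" and dF: "norm (inv (E (Suc k)) z - inv (E k) z) \<le> gap k" for k z
    using E(2)[of k] by blast+
  obtain H where H: "autohomeo H" "H ` column l f g = ?Q"
    by (rule limit_of_autohomeos[where E = E and F = "\<lambda>k. inv (E k)" and M = gap and T = tower
        and Q = ?Q and U = "column l f g" and e = "\<lambda>k. real CARD('n) * (2 * \<delta> k)",
        OF hom dE dF gap_summable tk \<open>closed ?Q\<close> closed_column lim column_near_tower tower_near_column])
  have "tame_ball (H ` column l f g)" unfolding H(2) by (rule tame_ball_unit_cube)
  then show ?thesis unfolding tame_ball_autohomeo_image[OF H(1)] .
qed

end

section \<open>Uniqueness of the tile\<close>

lemma tile_matrix_nth:
  fixes x :: "real^('n::{finite,linorder})"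
  shows "(tile_matrix p s *v x) $ i =
    of_int (p i) * x$i - (if i = last_index then 0 else s i * x$last_index)"
proof -
  have "(tile_matrix p s *v x) $ i = (\<Sum>j\<in>UNIV. (if i = j then of_int (p i)
      else if j = last_index then - s i else 0) * x$j)"
    by (simp add: matrix_vector_mult_def tile_matrix_def)
  also have "\<dots> = (\<Sum>j\<in>UNIV. (if j = i then of_int (p i) * x$i else 0)
      + (if j = last_index then (if i = last_index then 0 else - s i * x$last_index) else 0))"
    by (rule sum.cong[OF refl]) auto
  finally show ?thesis by (simp add: sum.distrib)
qed

definition is_tile :: "real^'n^'n \<Rightarrow> (real^'n) set \<Rightarrow> (real^'n) set \<Rightarrow> bool" where
  "is_tile A D T \<longleftrightarrow> T \<noteq> {} \<and> compact T \<and> (\<lambda>x. A *v x) ` T = {t + d |t d. t \<in> T \<and> d \<in> D}"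

text \<open>If \<open>A x = x' + d\<close>, approximate \<open>x'\<close> by a point of
  \<open>Y\<close> and reuse the digit \<open>d\<close>; going back through \<open>A\<close> shrinks
  the error \<open>M\<close> by 3/4. Iteration and closedness of \<open>Y\<close> give the
  inclusion, and exchanging the two sets gives uniqueness.\<close>

lemma tile_subset:
  fixes p :: "'n::{finite,linorder} \<Rightarrow> int" and X Y D :: "(real^('n::{finite,linorder})) set"
  assumes p: "\<And>i. \<bar>p i\<bar> \<ge> 2"
    and X: "is_tile (tile_matrix p s) D X" and Y: "is_tile (tile_matrix p s) D Y"
  shows "X \<subseteq> Y"
proof
  let ?A = "tile_matrix p s"
  define l :: 'n where "l = last_index"
  \<comment> \<open>The weight \<open>2 * \<bar>s j\<bar>\<close> on the last coordinate lets its
    growth by a factor of at least 2 pay for the off-diagonal entry \<open>- s j\<close>, however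
    large.\<close>
  define M :: "real^('n::{finite,linorder}) \<Rightarrow> real" where "M e = (\<Sum>j\<in>UNIV. \<bar>e$j\<bar> + 2 * \<bar>s j\<bar> * \<bar>e$l\<bar>)" for e
  have contract: "M e \<le> 3/4 * M (?A *v e)" for e
  proof -
    have pr: "2 \<le> \<bar>of_int (p i) :: real\<bar>" for i using p[of i] by linarith
    have pe: "2 * \<bar>e$i\<bar> \<le> \<bar>of_int (p i) * e$i\<bar>" for i
      unfolding abs_mult using pr[of i] by (intro mult_right_mono) auto
    have el: "2 * \<bar>e$l\<bar> \<le> \<bar>(?A *v e)$l\<bar>"
      using pe[of l] by (simp add: tile_matrix_nth l_def)
    have "\<bar>e$j\<bar> + 2 * \<bar>s j\<bar> * \<bar>e$l\<bar> \<le> 3/4 * (\<bar>(?A *v e)$j\<bar> + 2 * \<bar>s j\<bar> * \<bar>(?A *v e)$l\<bar>)" for j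
    proof -
      have a: "2 * \<bar>s j\<bar> * (2 * \<bar>e$l\<bar>) \<le> 2 * \<bar>s j\<bar> * \<bar>(?A *v e)$l\<bar>"
        using el by (intro mult_left_mono) auto
      have b: "2 * \<bar>e$j\<bar> - \<bar>s j\<bar> * \<bar>e$l\<bar> \<le> \<bar>(?A *v e)$j\<bar>"
      proof (cases "j = l")
        case True
        then show ?thesis using el by (smt (verit) abs_ge_zero mult_nonneg_nonneg)
      next
        case False
        then have "(?A *v e)$j = of_int (p j) * e$j - s j * e$l" by (simp add: tile_matrix_nth l_def)
        then show ?thesis using pe[of j] abs_triangle_ineq2[of "of_int (p j) * e$j" "s j * e$l"] by (simp add: abs_mult)
      qed
      have "0 \<le> \<bar>s j\<bar> * \<bar>e$l\<bar>" by simp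
      moreover have "2 * \<bar>s j\<bar> * (2 * \<bar>e$l\<bar>) = 4 * (\<bar>s j\<bar> * \<bar>e$l\<bar>)" "2 * \<bar>s j\<bar> * \<bar>e$l\<bar> = 2 * (\<bar>s j\<bar> * \<bar>e$l\<bar>)" by simp_all
      moreover have "3/4 * (\<bar>(?A *v e)$j\<bar> + 2 * \<bar>s j\<bar> * \<bar>(?A *v e)$l\<bar>) =
         3/4 * \<bar>(?A *v e)$j\<bar> + 3/4 * (2 * \<bar>s j\<bar> * \<bar>(?A *v e)$l\<bar>)" by (rule distrib_left)
      ultimately show ?thesis using a b by linarith
    qed
    then show ?thesis unfolding M_def sum_distrib_left by (rule sum_mono)
  qed
  have normM: "norm e \<le> M e" for e
    unfolding M_def by (rule order_trans[OF norm_le_l1_cart]) (intro sum_mono, simp)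
  have "bounded X" "bounded Y" using X Y by (auto simp: is_tile_def compact_imp_bounded)
  then obtain BX BY where B: "\<And>x. x \<in> X \<Longrightarrow> norm x \<le> BX" "\<And>x. x \<in> Y \<Longrightarrow> norm x \<le> BY"
    unfolding bounded_iff by blast
  define C where "C = (\<Sum>j\<in>(UNIV::'n set). 1 + 2 * \<bar>s j\<bar>)"
  have MC: "M e \<le> C * norm e" for e
  proof -
    have "\<bar>e$j\<bar> + 2 * \<bar>s j\<bar> * \<bar>e$l\<bar> \<le> norm e + 2 * \<bar>s j\<bar> * norm e" for j
      by (intro add_mono mult_left_mono component_le_norm_cart) auto
    then show ?thesis unfolding M_def C_def sum_distrib_right by (intro sum_mono) (simp add: distrib_right)
  qed
  have C0: "0 \<le> C" unfolding C_def by (rule sum_nonneg) simp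
  have close: "\<exists>y\<in>Y. M (x - y) \<le> (3/4)^n * (C * (BX + BY))" if "x \<in> X" for x n
    using that
  proof (induction n arbitrary: x)
    case 0
    obtain y where y: "y \<in> Y" using Y by (auto simp: is_tile_def)
    have "norm (x - y) \<le> BX + BY" using B(1)[OF 0] B(2)[OF y] norm_triangle_ineq4[of x y] by linarith
    then have "C * norm (x - y) \<le> C * (BX + BY)" using C0 by (rule mult_left_mono)
    then show ?case using MC[of "x - y"] y by (intro bexI[of _ y]) auto
  next
    case (Suc n)
    have "?A *v x \<in> {t + d |t d. t \<in> X \<and> d \<in> D}" using X Suc.prems unfolding is_tile_def by blast
    then obtain x' d where x': "x' \<in> X" "d \<in> D" "?A *v x = x' + d" by blast
    obtain y' where y': "y' \<in> Y" "M (x' - y') \<le> (3/4)^n * (C * (BX + BY))" using Suc.IH[OF x'(1)] by blast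
    have "y' + d \<in> (\<lambda>x. ?A *v x) ` Y" using Y y'(1) x'(2) unfolding is_tile_def by blast
    then obtain y where y: "y \<in> Y" "?A *v y = y' + d" by auto
    have "?A *v (x - y) = x' - y'" using x'(3) y(2) by (simp add: matrix_vector_mult_diff_distrib)
    then have "M (x - y) \<le> 3/4 * M (x' - y')" using contract[of "x - y"] by simp
    also have "\<dots> \<le> (3/4)^Suc n * (C * (BX + BY))" using y'(2) by simp
    finally show ?case using y(1) by blast
  qed
  fix x assume x: "x \<in> X"
  have "\<forall>n. \<exists>y. y \<in> Y \<and> norm (x - y) \<le> (3/4)^n * (C * (BX + BY))"
    using close[OF x] normM order_trans by blast
  then obtain y where y: "\<And>n. y n \<in> Y" "\<And>n. norm (x - y n) \<le> (3/4)^n * (C * (BX + BY))" by metis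
  have lim: "(\<lambda>n. (3/4)^n * (C * (BX + BY))) \<longlonglongrightarrow> 0"
    by (intro tendsto_mult_left_zero LIMSEQ_power_zero) simp
  have "(\<lambda>n. dist (y n) x) \<longlonglongrightarrow> 0"
    by (rule tendsto_sandwich[OF _ _ tendsto_const lim]) (use y(2) in \<open>auto simp: dist_norm norm_minus_commute\<close>)
  then have "y \<longlonglongrightarrow> x" using tendsto_dist_iff by blast
  moreover have "closed Y" using Y by (simp add: is_tile_def compact_imp_closed)
  ultimately show "x \<in> Y" using y(1) closed_sequentially by metis
qed

lemma self_affine_set_eqI:
  fixes p :: "'n::{finite,linorder} \<Rightarrow> int"
  assumes "\<And>i. \<bar>p i\<bar> \<ge> 2" "is_tile (tile_matrix p s) D T"
  shows "self_affine_set (tile_matrix p s) D = T"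
  unfolding self_affine_set_def is_tile_def[symmetric]
proof (rule the_equality)
  show "is_tile (tile_matrix p s) D T" by (rule assms(2))
  fix X assume "is_tile (tile_matrix p s) D X"
  then show "X = T" using tile_subset[of p s D X T] tile_subset[of p s D T X] assms by auto
qed

section \<open>Digit expansions\<close>

text \<open>It will be applied to tails of expansions, not to digits. Multiplying by
  \<open>p\<close> splits off \<open>y 0\<close> and shifts the sequence, the recursion obeyed by
  the horizontal position of the sections of the tile.\<close>

definition dsum :: "real \<Rightarrow> (nat \<Rightarrow> real) \<Rightarrow> real" where
  "dsum p y = (\<Sum>n. (1 / p)^Suc n * y n)"

lemma dsum_term_bound:
  fixes p :: real
  assumes "2 \<le> \<bar>p\<bar>"
  shows "\<bar>(1 / p)^Suc n * y\<bar> \<le> (1/2)^Suc n * \<bar>y\<bar>"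
proof -
  have "\<bar>1 / p\<bar> \<le> 1/2" using assms by (simp add: field_simps)
  then have "\<bar>1 / p\<bar>^Suc n \<le> (1/2)^Suc n" by (intro power_mono) auto
  then show ?thesis by (simp add: abs_mult power_abs mult_right_mono del: power_Suc)
qed

lemma dsum_summable:
  fixes p :: real
  assumes "2 \<le> \<bar>p\<bar>" "\<And>n. \<bar>y n\<bar> \<le> 1"
  shows "summable (\<lambda>n. (1 / p)^Suc n * y n)"
proof (rule summable_comparison_test')
  show "summable (\<lambda>n. (1/2::real)^Suc n)" by (subst summable_Suc_iff) (rule summable_geometric, simp)
  fix n
  have "(1/2)^Suc n * \<bar>y n\<bar> \<le> (1/2)^Suc n * 1" using assms(2) by (intro mult_left_mono) auto
  then show "norm ((1 / p)^Suc n * y n) \<le> (1/2)^Suc n"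
    using dsum_term_bound[OF assms(1), of n "y n"] unfolding real_norm_def by linarith
qed

lemma dsum_unfold:
  fixes p :: real
  assumes "2 \<le> \<bar>p\<bar>" "\<And>n. \<bar>y n\<bar> \<le> 1"
  shows "p * dsum p y = y 0 + dsum p (\<lambda>n. y (Suc n))"
proof -
  have p0: "p \<noteq> 0" using assms(1) by auto
  define F where "F = (\<lambda>n. (1 / p)^Suc n * y n)"
  have "summable F" unfolding F_def by (rule dsum_summable[OF assms])
  then have "suminf F = (\<Sum>n. F (Suc n)) + F 0" using suminf_split_head[of F] by simp
  then have "dsum p y = (\<Sum>n. (1 / p)^Suc (Suc n) * y (Suc n)) + (1 / p) * y 0"
    unfolding dsum_def F_def by simp
  moreover have "(\<Sum>n. (1 / p)^Suc (Suc n) * y (Suc n)) = (1 / p) * dsum p (\<lambda>n. y (Suc n))"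
  proof -
    have "(\<Sum>n. 1 / p * ((1 / p)^Suc n * y (Suc n))) = 1 / p * (\<Sum>n. (1 / p)^Suc n * y (Suc n))"
      by (rule suminf_mult, rule dsum_summable) (use assms in auto)
    then show ?thesis unfolding dsum_def by (simp add: mult.assoc)
  qed
  ultimately show ?thesis using p0 by (simp add: field_simps)
qed

text \<open>The growth \<open>(3/2)^n\<close> is beaten by \<open>(1/2)^Suc n\<close>: the ratio is
  3/4, and the geometric series sums to \<open>c / 2 * 4\<close>.\<close>

lemma dsum_diff_bound:
  fixes p :: real
  assumes p: "2 \<le> \<bar>p\<bar>" and y: "\<And>n. \<bar>y n\<bar> \<le> 1" "\<And>n. \<bar>y' n\<bar> \<le> 1" and d: "\<And>n. \<bar>y n - y' n\<bar> \<le> (3/2)^n * c"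
  shows "\<bar>dsum p y - dsum p y'\<bar> \<le> 2 * c"
proof -
  have tm: "(1 / p)^Suc n * y n - (1 / p)^Suc n * y' n = (1 / p)^Suc n * (y n - y' n)" for n
    by (simp add: right_diff_distrib)
  have eq: "dsum p y - dsum p y' = (\<Sum>n. (1 / p)^Suc n * (y n - y' n))"
    unfolding dsum_def suminf_diff[OF dsum_summable[OF p y(1)] dsum_summable[OF p y(2)]] tm ..
  have b: "norm ((1 / p)^Suc n * (y n - y' n)) \<le> c / 2 * (3/4)^n" for n
  proof -
    have "norm ((1 / p)^Suc n * (y n - y' n)) \<le> (1/2)^Suc n * \<bar>y n - y' n\<bar>"
      using dsum_term_bound[OF p, of n "y n - y' n"] by simp
    also have "\<dots> \<le> (1/2)^Suc n * ((3/2)^n * c)" using d by (intro mult_left_mono) auto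
    also have "\<dots> = c / 2 * ((1/2) * (3/2))^n" by (simp only: power_mult_distrib) simp
    finally show ?thesis by simp
  qed
  have g: "(\<lambda>n. c / 2 * (3/4::real)^n) sums (c / 2 * (1 / (1 - 3/4)))"
    by (intro sums_mult geometric_sums) simp
  have "norm (\<Sum>n. (1 / p)^Suc n * (y n - y' n)) \<le> (\<Sum>n. c / 2 * (3/4)^n)"
    by (rule norm_suminf_le[OF b]) (use g in \<open>simp add: sums_iff\<close>)
  then show ?thesis using g unfolding eq by (simp add: sums_iff)
qed

text \<open>For \<open>t \<in> [0, 1]\<close> the \<open>q\<close>-adic expansions of \<open>t\<close> have the tails \<open>rdig q t n\<close> (never equal to
  \<open>1\<close>) and \<open>ldig q t n\<close> (never equal to \<open>0\<close>); these are the one-sided limits of each other.\<close>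

definition rdig :: "nat \<Rightarrow> real \<Rightarrow> nat \<Rightarrow> real" where
  "rdig q t n = frac (real (q^n) * t)"

definition ldig :: "nat \<Rightarrow> real \<Rightarrow> nat \<Rightarrow> real" where
  "ldig q t n = 1 - frac (- (real (q^n) * t))"

lemma dig_bound: "\<bar>rdig q t n\<bar> \<le> 1" "\<bar>ldig q t n\<bar> \<le> 1"
  using frac_ge_0[of "real (q^n) * t"] frac_lt_1[of "real (q^n) * t"]
    frac_ge_0[of "- (real (q^n) * t)"] frac_lt_1[of "- (real (q^n) * t)"]
  by (auto simp: rdig_def ldig_def)

lemma dig_Suc: "rdig q t (Suc n) = rdig q (real q * t) n" "ldig q t (Suc n) = ldig q (real q * t) n"
  by (simp_all add: rdig_def ldig_def mult_ac)

lemma frac_add_int: "frac (x + of_int k) = frac x" for x :: real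
  by (simp add: frac_def)

lemma dig_add_int: "rdig q (t + of_int k) = rdig q t" "ldig q (t + of_int k) = ldig q t"
proof -
  have e: "real (q^n) * (t + of_int k) = real (q^n) * t + of_int (int (q^n) * k)"
    "- (real (q^n) * (t + of_int k)) = - (real (q^n) * t) + of_int (- (int (q^n) * k))" for n
    by (simp_all add: algebra_simps)
  show "rdig q (t + of_int k) = rdig q t" unfolding rdig_def e(1) frac_add_int ..
  show "ldig q (t + of_int k) = ldig q t" unfolding ldig_def e(2) frac_add_int ..
qed

lemma rdig_0: "0 \<le> t \<Longrightarrow> t < 1 \<Longrightarrow> rdig q t 0 = t"
  by (simp add: rdig_def frac_eq)

lemma ldig_0: "0 < t \<Longrightarrow> t \<le> 1 \<Longrightarrow> ldig q t 0 = t"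
proof -
  assume t: "0 < t" "t \<le> 1"
  then have "\<lfloor>- t\<rfloor> = - 1" by linarith
  then show ?thesis by (simp add: ldig_def frac_def)
qed

lemma dig_int:
  assumes "t \<in> \<int>"
  shows "rdig q t n = 0" "ldig q t n = 1"
proof -
  have "real (q^n) * t \<in> \<int>" using assms by (intro Ints_mult) auto
  then show "rdig q t n = 0" "ldig q t n = 1" by (auto simp: rdig_def ldig_def)
qed

lemma dig_not_int: "t \<notin> \<int> \<Longrightarrow> rdig q t 0 = ldig q t 0"
  by (simp add: rdig_def ldig_def frac_neg)

text \<open>The tails differ by at most \<open>min 1 (q\<^sup>i / q\<^sup>n)\<close>; the weaker bound by a single geometric
  progression makes the series in \<open>dsum\<close> summable in closed form.\<close>

lemma dig_close:
  fixes q m n :: nat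
  assumes q: "2 \<le> q"
  shows "real m \<le> real (q^n) * t \<Longrightarrow> real (q^n) * t < real m + 1 \<Longrightarrow>
      \<bar>rdig q t i - rdig q (real m / real (q^n)) i\<bar> \<le> (3/2)^i * (2/3)^n"
    "real m < real (q^n) * t \<Longrightarrow> real (q^n) * t \<le> real m + 1 \<Longrightarrow>
      \<bar>ldig q t i - rdig q (real m / real (q^n)) i\<bar> \<le> (3/2)^i * (2/3)^n"
proof -
  let ?r = "real m / real (q^n)"
  have big: "\<bar>x - y\<bar> \<le> (3/2)^i * (2/3)^n" if "n \<le> i" "0 \<le> x" "x \<le> 1" "0 \<le> y" "y \<le> 1" for x y :: real
  proof -
    have "(3/2::real)^n \<le> (3/2)^i" using that(1) by (intro power_increasing) auto
    then have "(3/2::real)^n * (2/3)^n \<le> (3/2)^i * (2/3)^n" by (intro mult_right_mono) auto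
    moreover have "(3/2::real)^n * (2/3)^n = 1" by (simp flip: power_mult_distrib)
    ultimately show ?thesis using that by (smt (verit))
  qed
  have rng: "0 \<le> rdig q u i" "rdig q u i \<le> 1" "0 \<le> ldig q u i" "ldig q u i \<le> 1" for u
    using frac_ge_0[of "real (q^i) * u"] frac_lt_1[of "real (q^i) * u"]
      frac_ge_0[of "- (real (q^i) * u)"] frac_lt_1[of "- (real (q^i) * u)"]
    by (auto simp: rdig_def ldig_def)
  have small: "(real m \<le> real (q^n) * t \<longrightarrow> real (q^n) * t < real m + 1 \<longrightarrow> \<bar>rdig q t i - rdig q ?r i\<bar> \<le> (3/2)^i * (2/3)^n) \<and>
      (real m < real (q^n) * t \<longrightarrow> real (q^n) * t \<le> real m + 1 \<longrightarrow> \<bar>ldig q t i - rdig q ?r i\<bar> \<le> (3/2)^i * (2/3)^n)"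
    if i: "i < n"
  proof -
    define h where "h = q^(n - i)"
    have hn: "q^n = q^i * h" using i by (simp add: h_def flip: power_add)
    have h0: "0 < h" using q by (simp add: h_def)
    \<comment> \<open>Slab \<open>m\<close> of level \<open>n\<close> lies in slab \<open>a\<close>
      of level \<open>i\<close>, so throughout it the same integer \<open>a\<close> is subtracted
      from \<open>q^i * t\<close>.\<close>
    define a where "a = m div h"
    have ah: "real a * real h \<le> real m" "real m + 1 \<le> (real a + 1) * real h"
      using real_div_bounds[OF h0, of m] by (simp_all add: a_def mult.commute)
    define x where "x = real (q^i) * t"
    define y where "y = real (q^i) * ?r"
    have hx: "real (q^n) * t = x * real h" by (simp add: x_def hn)
    have hy: "y * real h = real m" using q h0 by (simp add: y_def hn)
    have hr: "0 < real h" using h0 by simp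
    have ay: "real a \<le> y" "y < real a + 1"
    proof -
      have "real a * real h \<le> y * real h" "y * real h < (real a + 1) * real h" using ah hy by linarith+
      then show "real a \<le> y" "y < real a + 1" using hr by (simp_all only: mult_le_cancel_right_pos mult_less_cancel_right_pos)
    qed
    then have "\<lfloor>y\<rfloor> = int a" by linarith
    then have ry: "rdig q ?r i = y - real a" unfolding rdig_def y_def[symmetric] frac_def by simp
    have hsmall: "1 / real h \<le> (3/2)^i * (2/3)^n"
    proof -
      have "(3/2::real)^(n - i) \<le> real q^(n - i)" using q by (intro power_mono) auto
      then have "1 / real h \<le> 1 / (3/2)^(n - i)" unfolding h_def by (intro frac_le) auto
      also have "1 / (3/2::real)^(n - i) = (2/3)^(n - i)" by (simp add: power_divide)
      also have "\<dots> = (3/2)^i * (2/3)^n"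
      proof -
        have "(2/3::real)^n = (2/3)^i * (2/3)^(n - i)" using i by (simp flip: power_add)
        moreover have "(3/2::real)^i * (2/3)^i = 1" by (simp flip: power_mult_distrib)
        ultimately show ?thesis by (simp add: mult.assoc[symmetric])
      qed
      finally show ?thesis .
    qed
    have xy: "\<bar>x - y\<bar> \<le> 1 / real h" if "real m \<le> x * real h" "x * real h \<le> real m + 1"
    proof -
      have "(x - y) * real h \<le> 1" "0 \<le> (x - y) * real h" using that hy by (simp_all add: left_diff_distrib)
      then show ?thesis using hr by (simp add: pos_le_divide_eq zero_le_mult_iff abs_if)
    qed
    have "\<bar>rdig q t i - rdig q ?r i\<bar> \<le> (3/2)^i * (2/3)^n" if "real m \<le> x * real h" "x * real h < real m + 1"
    proof -
      have "real a * real h \<le> x * real h" "x * real h < (real a + 1) * real h" using ah that by linarith+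
      then have "real a \<le> x" "x < real a + 1" using hr by (simp_all only: mult_le_cancel_right_pos mult_less_cancel_right_pos)
      then have "\<lfloor>x\<rfloor> = int a" by linarith
      then have "rdig q t i = x - real a" unfolding rdig_def x_def[symmetric] frac_def by simp
      then show ?thesis using ry xy that hsmall by simp
    qed
    moreover have "\<bar>ldig q t i - rdig q ?r i\<bar> \<le> (3/2)^i * (2/3)^n" if "real m < x * real h" "x * real h \<le> real m + 1"
    proof -
      have "real a * real h < x * real h" "x * real h \<le> (real a + 1) * real h" using ah that by linarith+
      then have "real a < x" "x \<le> real a + 1" using hr by (simp_all only: mult_le_cancel_right_pos mult_less_cancel_right_pos)
      then have "\<lfloor>- x\<rfloor> = - int a - 1" by linarith
      then have "ldig q t i = x - real a" unfolding ldig_def x_def[symmetric] frac_def by simp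
      then show ?thesis using ry xy that hsmall by simp
    qed
    ultimately show ?thesis unfolding hx by blast
  qed
  show "\<bar>rdig q t i - rdig q ?r i\<bar> \<le> (3/2)^i * (2/3)^n" if "real m \<le> real (q^n) * t" "real (q^n) * t < real m + 1"
    using small big rng that by (cases "i < n") auto
  show "\<bar>ldig q t i - rdig q ?r i\<bar> \<le> (3/2)^i * (2/3)^n" if "real m < real (q^n) * t" "real (q^n) * t \<le> real m + 1"
    using small big rng that by (cases "i < n") auto
qed

lemma dsum_const_1:
  fixes p :: real
  assumes "2 \<le> \<bar>p\<bar>"
  shows "dsum p (\<lambda>n. 1) = 1 / (p - 1)"
proof -
  have "p * dsum p (\<lambda>n. 1) = 1 + dsum p (\<lambda>n. 1)" using dsum_unfold[OF assms, of "\<lambda>n. 1"] by simp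
  then have "dsum p (\<lambda>n. 1) * (p - 1) = 1" by (simp add: algebra_simps)
  moreover have "p - 1 \<noteq> 0" using assms by auto
  ultimately show ?thesis by (simp add: field_simps)
qed

text \<open>At an integer \<open>rdig\<close> is constantly 0 and \<open>ldig\<close> constantly 1,
  which leaves a geometric series. Elsewhere the first tails agree, and the rest is the jump at
  \<open>q * t\<close> divided by \<open>p\<close>.\<close>

lemma dsum_jump:
  fixes p t :: real
  assumes p: "2 \<le> \<bar>p\<bar>"
  shows "t \<in> \<int> \<Longrightarrow> dsum p (rdig q t) - dsum p (ldig q t) = - 1 / (p - 1)"
    "t \<notin> \<int> \<Longrightarrow> dsum p (rdig q t) - dsum p (ldig q t) =
        (dsum p (rdig q (real q * t)) - dsum p (ldig q (real q * t))) / p"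
proof -
  assume t: "t \<in> \<int>"
  have "rdig q t = (\<lambda>n. 0)" "ldig q t = (\<lambda>n. 1)" using dig_int[OF t] by auto
  moreover have "dsum p (\<lambda>n. 0) = 0" by (simp add: dsum_def)
  ultimately show "dsum p (rdig q t) - dsum p (ldig q t) = - 1 / (p - 1)"
    using dsum_const_1[OF p] by simp
next
  assume t: "t \<notin> \<int>"
  have "p * dsum p (rdig q t) = rdig q t 0 + dsum p (rdig q (real q * t))"
    using dsum_unfold[OF p, of "rdig q t"] dig_bound(1) by (simp add: dig_Suc)
  moreover have "p * dsum p (ldig q t) = ldig q t 0 + dsum p (ldig q (real q * t))"
    using dsum_unfold[OF p, of "ldig q t"] dig_bound(2) by (simp add: dig_Suc)
  ultimately have "p * (dsum p (rdig q t) - dsum p (ldig q t)) =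
      dsum p (rdig q (real q * t)) - dsum p (ldig q (real q * t))"
    using dig_not_int[OF t] by (simp add: right_diff_distrib)
  moreover have "p \<noteq> 0" using p by auto
  ultimately show "dsum p (rdig q t) - dsum p (ldig q t) =
        (dsum p (rdig q (real q * t)) - dsum p (ldig q (real q * t))) / p"
    by (simp add: field_simps)
qed

text \<open>After at most \<open>n\<close> multiplications by \<open>q\<close> the height is an
  integer; each earlier stage only divides the jump by \<open>p\<close>.\<close>

lemma dsum_jump_bound:
  fixes p t :: real
  assumes p: "2 \<le> \<bar>p\<bar>" and "real (q^n) * t \<in> \<int>"
  shows "\<bar>dsum p (rdig q t) - dsum p (ldig q t)\<bar> \<le> 1 / \<bar>p - 1\<bar>"
  using assms(2)
proof (induction n arbitrary: t)
  case 0
  then show ?case using dsum_jump(1)[OF p, where t = t and q = q] by simp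
next
  case (Suc n)
  show ?case
  proof (cases "t \<in> \<int>")
    case True
    then show ?thesis using dsum_jump(1)[OF p, where t = t and q = q] by simp
  next
    case False
    let ?d = "\<bar>dsum p (rdig q (real q * t)) - dsum p (ldig q (real q * t))\<bar>"
    have "real (q^n) * (real q * t) \<in> \<int>" using Suc.prems by (simp add: mult_ac)
    then have "?d \<le> 1 / \<bar>p - 1\<bar>" by (rule Suc.IH)
    moreover have "?d / \<bar>p\<bar> \<le> ?d / 1" using p by (intro divide_left_mono) auto
    ultimately show ?thesis using dsum_jump(2)[OF p False, where q = q] by simp
  qed
qed

lemma is_tileI:
  assumes "T \<noteq> {}" "compact T"
    and "\<And>x. x \<in> T \<Longrightarrow> \<exists>t\<in>T. \<exists>d\<in>D. A *v x = t + d"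
    and "\<And>t d. t \<in> T \<Longrightarrow> d \<in> D \<Longrightarrow> \<exists>x\<in>T. A *v x = t + d"
  shows "is_tile A D T"
proof -
  have "(\<lambda>x. A *v x) ` T = {t + d |t d. t \<in> T \<and> d \<in> D}"
  proof (intro equalityI subsetI)
    fix y assume "y \<in> (\<lambda>x. A *v x) ` T"
    then show "y \<in> {t + d |t d. t \<in> T \<and> d \<in> D}" using assms(3) by blast
  next
    fix y assume "y \<in> {t + d |t d. t \<in> T \<and> d \<in> D}"
    then obtain t d where "t \<in> T" "d \<in> D" "y = t + d" by blast
    then show "y \<in> (\<lambda>x. A *v x) ` T" using assms(4)[of t d] by (metis image_eqI)
  qed
  then show ?thesis using assms(1,2) by (simp add: is_tile_def)
qed

lemma is_tileD:
  assumes "is_tile A D T"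
  shows "T \<noteq> {}" "compact T" "x \<in> T \<Longrightarrow> \<exists>t\<in>T. \<exists>d\<in>D. A *v x = t + d"
    "t \<in> T \<Longrightarrow> d \<in> D \<Longrightarrow> \<exists>x\<in>T. A *v x = t + d"
proof -
  have eq: "(\<lambda>x. A *v x) ` T = {t + d |t d. t \<in> T \<and> d \<in> D}" using assms by (simp add: is_tile_def)
  show "T \<noteq> {}" "compact T" using assms by (simp_all add: is_tile_def)
  show "\<exists>t\<in>T. \<exists>d\<in>D. A *v x = t + d" if "x \<in> T"
  proof -
    have "A *v x \<in> {t + d |t d. t \<in> T \<and> d \<in> D}" unfolding eq[symmetric] using that by blast
    then show ?thesis by blast
  qed
  show "\<exists>x\<in>T. A *v x = t + d" if "t \<in> T" "d \<in> D"
  proof -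
    have "t + d \<in> (\<lambda>x. A *v x) ` T" unfolding eq using that by blast
    then show ?thesis by (metis imageE)
  qed
qed

lemma digit_exists:
  fixes L y :: real and m :: int
  assumes "L \<le> y" "y \<le> L + of_int m" "0 < m"
  shows "\<exists>i. 0 \<le> i \<and> i < m \<and> L \<le> y - of_int i \<and> y - of_int i \<le> L + 1"
proof (cases "y < L + of_int m")
  case True
  then show ?thesis using assms(1) by (intro exI[of _ "\<lfloor>y - L\<rfloor>"] conjI) linarith+
next
  case False
  \<comment> \<open>At the right end the floor would be \<open>m\<close>, one more than the largest
    digit.\<close>
  then show ?thesis using assms by (intro exI[of _ "m - 1"]) auto
qed

section \<open>The tile as a column\<close>

text \<open>The interval \<open>I = [base p, base p + 1]\<close> solves \<open>p I = I + {0, \<dots>, \<bar>p\<bar> - 1}\<close>.\<close>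

definition base :: "real \<Rightarrow> real" where
  "base p = (if 0 < p then 0 else p / (1 - p))"

lemma base_scale:
  fixes p y :: real
  assumes "2 \<le> \<bar>p\<bar>"
  shows "base p \<le> y \<and> y \<le> base p + 1 \<longleftrightarrow> base p \<le> p * y \<and> p * y \<le> base p + \<bar>p\<bar>"
proof (cases "0 < p")
  case True
  then show ?thesis by (auto simp: base_def zero_le_mult_iff)
next
  case False
  then have p: "p \<le> -2" using assms by linarith
  define b where "b = base p"
  have b: "b = p / (1 - p)" using False by (simp add: b_def base_def)
  \<comment> \<open>For negative \<open>p\<close> multiplication reverses the interval:
    \<open>b\<close> goes to the upper end \<open>b + \<bar>p\<bar>\<close> and \<open>b + 1\<close>
    to the lower end \<open>b\<close>.\<close>
  have e1: "p * b = b - p" "p * (b + 1) = b" using p by (simp_all add: b field_simps)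
  have "b \<le> y \<longleftrightarrow> p * y \<le> p * b" "y \<le> b + 1 \<longleftrightarrow> p * (b + 1) \<le> p * y" using p by simp_all
  then show ?thesis using p unfolding b_def[symmetric] e1 by auto
qed

locale pos_tile =
  fixes p :: "'n::{finite,linorder} \<Rightarrow> int" and s :: "'n \<Rightarrow> real" and q :: nat
  assumes p2: "\<And>i. \<bar>p i\<bar> \<ge> 2" and pq: "p last_index = int q"
begin

abbreviation rsum :: "real \<Rightarrow> 'n \<Rightarrow> real" where
  "rsum t j \<equiv> dsum (of_int (p j)) (rdig q t)"

abbreviation lsum :: "real \<Rightarrow> 'n \<Rightarrow> real" where
  "lsum t j \<equiv> dsum (of_int (p j)) (ldig q t)"

text \<open>The default 0 at \<open>last_index\<close> lets the oscillation and jump bounds hold for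
  all indices.\<close>

definition rprof :: "'n \<Rightarrow> real \<Rightarrow> real" where
  "rprof j t = (if j = last_index then 0 else base (of_int (p j)) + s j * rsum t j)"

definition lprof :: "'n \<Rightarrow> real \<Rightarrow> real" where
  "lprof j t = (if j = last_index then 0 else base (of_int (p j)) + s j * lsum t j)"

definition fits :: "('n \<Rightarrow> real) \<Rightarrow> real^('n::{finite,linorder}) \<Rightarrow> bool" where
  "fits h z \<longleftrightarrow> (\<forall>j. j \<noteq> last_index \<longrightarrow>
     base (of_int (p j)) + s j * h j \<le> z$j \<and> z$j \<le> base (of_int (p j)) + s j * h j + 1)"

abbreviation K :: "(real^('n::{finite,linorder})) set" where
  "K \<equiv> column last_index rprof lprof"

definition C :: real where
  "C = 2 * (\<Sum>j\<in>UNIV. \<bar>s j\<bar>)"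

lemma p2r: "2 \<le> \<bar>of_int (p i) :: real\<bar>"
  using p2[of i] by linarith

lemma q2: "2 \<le> q"
  using p2[of last_index] pq by simp

lemma s_le_C: "2 * \<bar>s j\<bar> \<le> C" "0 \<le> C"
  unfolding C_def by (auto intro!: member_le_sum sum_nonneg)

lemma prof_osc:
  "real m \<le> real (q^n) * t \<Longrightarrow> real (q^n) * t < real m + 1 \<Longrightarrow>
      \<bar>rprof j t - rprof j (real m / real (q^n))\<bar> \<le> C * (2/3)^n"
  "real m < real (q^n) * t \<Longrightarrow> real (q^n) * t \<le> real m + 1 \<Longrightarrow>
      \<bar>lprof j t - rprof j (real m / real (q^n))\<bar> \<le> C * (2/3)^n"
proof -
  have fin: "\<bar>s j * (dsum (of_int (p j)) y - dsum (of_int (p j)) y')\<bar> \<le> C * (2/3)^n"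
    if "\<And>i. \<bar>y i\<bar> \<le> 1" "\<And>i. \<bar>y' i\<bar> \<le> 1" "\<And>i. \<bar>y i - y' i\<bar> \<le> (3/2)^i * (2/3)^n" for y y'
  proof -
    have "\<bar>s j\<bar> * \<bar>dsum (of_int (p j)) y - dsum (of_int (p j)) y'\<bar> \<le> \<bar>s j\<bar> * (2 * (2/3)^n)"
      by (intro mult_left_mono dsum_diff_bound[OF p2r that]) simp
    also have "\<dots> = (2 * \<bar>s j\<bar>) * (2/3)^n" by simp
    also have "\<dots> \<le> C * (2/3)^n" using s_le_C by (intro mult_right_mono) auto
    finally show ?thesis by (simp add: abs_mult)
  qed
  have nn: "0 \<le> C * (2/3::real)^n" using s_le_C(2) by simp
  show "\<bar>rprof j t - rprof j (real m / real (q^n))\<bar> \<le> C * (2/3)^n"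
    if "real m \<le> real (q^n) * t" "real (q^n) * t < real m + 1"
    using nn fin[OF dig_bound(1) dig_bound(1) dig_close(1)[OF q2 that]]
    unfolding rprof_def by (auto simp: right_diff_distrib)
  show "\<bar>lprof j t - rprof j (real m / real (q^n))\<bar> \<le> C * (2/3)^n"
    if "real m < real (q^n) * t" "real (q^n) * t \<le> real m + 1"
    using nn fin[OF dig_bound(2) dig_bound(1) dig_close(2)[OF q2 that]]
    unfolding rprof_def lprof_def by (auto simp: right_diff_distrib)
qed

text \<open>Keeping only every \<open>N\<close>-th q-adic level makes the oscillation bound drop by
  \<open>(2/3)^N\<close> from one level to the next.\<close>

lemma regulated_power:
  assumes "0 < N"
  shows "regulated rprof lprof (q^N) (\<lambda>k. C * (2/3)^(N * k))"
proof
  show "2 \<le> q^N"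
  proof -
    have "2^1 \<le> (2::nat)^N" using assms by (intro power_increasing) auto
    also have "\<dots> \<le> q^N" using q2 by (intro power_mono) auto
    finally show ?thesis by simp
  qed
  show "\<bar>rprof j t - rprof j (real m / real ((q^N)^n))\<bar> \<le> C * (2/3)^(N * n)"
    if "real m \<le> real ((q^N)^n) * t" "real ((q^N)^n) * t < real m + 1" for n m t j
    using that unfolding power_mult[symmetric] by (rule prof_osc(1))
  show "\<bar>lprof j t - rprof j (real m / real ((q^N)^n))\<bar> \<le> C * (2/3)^(N * n)"
    if "real m < real ((q^N)^n) * t" "real ((q^N)^n) * t \<le> real m + 1" for n m t j
    using that unfolding power_mult[symmetric] by (rule prof_osc(2))
  have "(\<lambda>k. C * ((2/3)^N)^k) \<longlonglongrightarrow> 0"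
    by (intro tendsto_mult_right_zero LIMSEQ_power_zero) (use assms in \<open>simp add: power_less_one_iff\<close>)
  then show "(\<lambda>k. C * (2/3)^(N * k)) \<longlonglongrightarrow> 0" by (simp add: power_mult)
qed

lemma digit_box_iff: "d \<in> digit_box p \<longleftrightarrow> (\<forall>j. \<exists>i. d$j = of_int i \<and> 0 \<le> i \<and> i < \<bar>p j\<bar>)"
proof
  assume "\<forall>j. \<exists>i. d$j = of_int i \<and> 0 \<le> i \<and> i < \<bar>p j\<bar>"
  then obtain i where "\<And>j. d$j = of_int (i j) \<and> 0 \<le> i j \<and> i j < \<bar>p j\<bar>" by metis
  then show "d \<in> digit_box p" unfolding digit_box_def by (auto intro!: exI[of _ i] simp: vec_eq_iff)
qed (auto simp: digit_box_def)

lemma dsum_rdig: "of_int (p j) * rsum t j = rdig q t 0 + rsum (real q * t) j"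
  using dsum_unfold[OF p2r, of "rdig q t" j] dig_bound(1) by (simp add: dig_Suc)

lemma dsum_ldig: "of_int (p j) * lsum t j = ldig q t 0 + lsum (real q * t) j"
  using dsum_unfold[OF p2r, of "ldig q t" j] dig_bound(2) by (simp add: dig_Suc)

lemma compact_K: "compact K"
proof -
  interpret regulated last_index rprof lprof "q^1" "\<lambda>k. C * (2/3)^(1 * k)" by (rule regulated_power) simp
  have b1: "\<bar>dsum (of_int (p j)) y\<bar> \<le> 2" if "\<And>n. \<bar>y n\<bar> \<le> 1" for y j
  proof -
    have "\<bar>dsum (of_int (p j)) y - dsum (of_int (p j)) (\<lambda>n. 0)\<bar> \<le> 2 * 1"
    proof (rule dsum_diff_bound[OF p2r that])
      fix n
      have "1 \<le> (3/2::real)^n" by (rule one_le_power) simp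
      then show "\<bar>y n - 0\<bar> \<le> (3/2)^n * 1" unfolding diff_zero mult_1_right by (rule order_trans[OF that])
    qed simp_all
    then show ?thesis by (simp add: dsum_def)
  qed
  define B where "B = (\<lambda>j. \<bar>base (of_int (p j))\<bar> + 2 * \<bar>s j\<bar> + 1)"
  have B: "\<bar>rprof j t\<bar> + 1 \<le> B j" "\<bar>lprof j t\<bar> + 1 \<le> B j" for j t
  proof -
    have "\<bar>s j * rsum t j\<bar> \<le> \<bar>s j\<bar> * 2" "\<bar>s j * lsum t j\<bar> \<le> \<bar>s j\<bar> * 2"
      unfolding abs_mult by (intro mult_left_mono b1 dig_bound abs_ge_zero)+
    then show "\<bar>rprof j t\<bar> + 1 \<le> B j" "\<bar>lprof j t\<bar> + 1 \<le> B j" unfolding rprof_def lprof_def B_def by auto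
  qed
  have "norm z \<le> (\<Sum>j\<in>UNIV. B j)" if z: "z \<in> K" for z
  proof -
    have "\<bar>z$j\<bar> \<le> B j" for j
    proof (cases "j = last_index")
      case True
      then have "\<bar>z$j\<bar> \<le> 1" using z by (auto simp: column_def)
      then show ?thesis unfolding B_def by (simp add: add_increasing)
    next
      case False
      then have "(rprof j (z$last_index) \<le> z$j \<and> z$j \<le> rprof j (z$last_index) + 1) \<or>
         (lprof j (z$last_index) \<le> z$j \<and> z$j \<le> lprof j (z$last_index) + 1)" using z unfolding column_def by blast
      then show ?thesis using B[where j = j and t = "z$last_index"] by linarith
    qed
    then show ?thesis using norm_le_l1_cart[of z] sum_mono[of UNIV "\<lambda>j. \<bar>z$j\<bar>" B] by force
  qed
  then have "bounded K" by (auto simp: bounded_iff)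
  then show ?thesis using closed_column compact_eq_bounded_closed by blast
qed

text \<open>By \<open>D\<close>, scaling by \<open>p j\<close> sends \<open>x$j - s j * h j\<close>
  to coordinate \<open>j\<close> of \<open>A x\<close> minus \<open>s j * h' j\<close>, so
  \<open>base_scale\<close> and \<open>digit_exists\<close> supply the horizontal digits. The
  offsets \<open>h\<close> and \<open>h'\<close> stay abstract to serve both one-sided
  expansions.\<close>

lemma K_step_down:
  fixes x :: "real^('n::{finite,linorder})"
  assumes t: "x$last_index = t" and e: "0 \<le> e" "e < int q" "0 \<le> real q * t - of_int e" "real q * t - of_int e \<le> 1"
    and D: "\<And>j. j \<noteq> last_index \<Longrightarrow> of_int (p j) * h j = t + h' j"
    and b: "fits h x"
  shows "\<exists>w d. d \<in> digit_box p \<and> tile_matrix p s *v x = w + d \<and> w$last_index = real q * t - of_int e \<and> fits h' w"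
proof -
  have "\<exists>i. 0 \<le> i \<and> i < \<bar>p j\<bar> \<and> base (of_int (p j)) \<le> of_int (p j) * (x$j - s j * h j) - of_int i \<and>
      of_int (p j) * (x$j - s j * h j) - of_int i \<le> base (of_int (p j)) + 1" if "j \<noteq> last_index" for j
  proof (rule digit_exists)
    have "base (of_int (p j)) \<le> x$j - s j * h j \<and> x$j - s j * h j \<le> base (of_int (p j)) + 1"
      using b that unfolding fits_def by force
    then show "base (of_int (p j)) \<le> of_int (p j) * (x$j - s j * h j)"
      "of_int (p j) * (x$j - s j * h j) \<le> base (of_int (p j)) + of_int \<bar>p j\<bar>"
      unfolding base_scale[OF p2r] by simp_all
    show "0 < \<bar>p j\<bar>" using p2[of j] by linarith
  qed
  then obtain i where i: "\<And>j. j \<noteq> last_index \<Longrightarrow> 0 \<le> i j \<and> i j < \<bar>p j\<bar> \<and>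
      base (of_int (p j)) \<le> of_int (p j) * (x$j - s j * h j) - of_int (i j) \<and>
      of_int (p j) * (x$j - s j * h j) - of_int (i j) \<le> base (of_int (p j)) + 1" by metis
  define d where "d = ((\<chi> j. of_int (if j = last_index then e else i j)) :: real^('n::{finite,linorder}))"
  define w where "w = tile_matrix p s *v x - d"
  have "\<exists>k. d$j = of_int k \<and> 0 \<le> k \<and> k < \<bar>p j\<bar>" for j
    by (intro exI[of _ "if j = last_index then e else i j"]) (use e pq i in \<open>auto simp: d_def\<close>)
  then have "d \<in> digit_box p" unfolding digit_box_iff by blast
  moreover have "tile_matrix p s *v x = w + d" by (simp add: w_def)
  moreover have "w$last_index = real q * t - of_int e"
    by (simp add: w_def tile_matrix_nth d_def pq t)
  moreover have "base (of_int (p j)) + s j * h' j \<le> w$j \<and> w$j \<le> base (of_int (p j)) + s j * h' j + 1"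
    if j: "j \<noteq> last_index" for j
  proof -
    have "w$j = of_int (p j) * x$j - s j * t - of_int (i j)" using j by (simp add: w_def tile_matrix_nth d_def t)
    moreover have "s j * (of_int (p j) * h j) = s j * t + s j * h' j" unfolding D[OF j] by (rule distrib_left)
    moreover have "of_int (p j) * (x$j - s j * h j) = of_int (p j) * x$j - s j * (of_int (p j) * h j)" by (simp add: algebra_simps)
    ultimately show ?thesis using i[OF j] by linarith
  qed
  ultimately show ?thesis unfolding fits_def by blast
qed

lemma K_step_up:
  fixes w d :: "real^('n::{finite,linorder})"
  assumes d: "d \<in> digit_box p" and t: "real q * t = w$last_index + d$last_index"
    and D: "\<And>j. j \<noteq> last_index \<Longrightarrow> of_int (p j) * h j = t + h' j"
    and b: "fits h' w"
  shows "\<exists>x. tile_matrix p s *v x = w + d \<and> x$last_index = t \<and> fits h x"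
proof -
  define x where "x = ((\<chi> j. if j = last_index then t else (w$j + d$j + s j * t) / of_int (p j)) :: real^('n::{finite,linorder}))"
  have p0: "of_int (p j) \<noteq> (0::real)" for j using p2r[of j] by auto
  have xj: "of_int (p j) * x$j = w$j + d$j + s j * t" if "j \<noteq> last_index" for j
    using that p0[of j] by (simp add: x_def)
  have xl: "x$last_index = t" by (simp add: x_def)
  have "tile_matrix p s *v x = w + d" unfolding vec_eq_iff
  proof
    fix j show "(tile_matrix p s *v x)$j = (w + d)$j"
      using xj[of j] xl t pq by (cases "j = last_index") (auto simp: tile_matrix_nth)
  qed
  moreover have "base (of_int (p j)) + s j * h j \<le> x$j \<and> x$j \<le> base (of_int (p j)) + s j * h j + 1" if j: "j \<noteq> last_index" for j
  proof -
    obtain i where i: "d$j = of_int i" "0 \<le> i" "i < \<bar>p j\<bar>" using d unfolding digit_box_iff by blast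
    have ir: "0 \<le> d$j" "d$j + 1 \<le> \<bar>of_int (p j)\<bar>" using i by linarith+
    have "s j * (of_int (p j) * h j) = s j * t + s j * h' j" unfolding D[OF j] by (rule distrib_left)
    moreover have "of_int (p j) * (x$j - s j * h j) = of_int (p j) * x$j - s j * (of_int (p j) * h j)" by (simp add: algebra_simps)
    ultimately have "base (of_int (p j)) \<le> of_int (p j) * (x$j - s j * h j) \<and>
       of_int (p j) * (x$j - s j * h j) \<le> base (of_int (p j)) + \<bar>of_int (p j)\<bar>"
      using xj[OF j] b[unfolded fits_def, rule_format, OF j] ir by linarith
    then have "base (of_int (p j)) \<le> x$j - s j * h j \<and> x$j - s j * h j \<le> base (of_int (p j)) + 1"
      using base_scale[OF p2r] by blast
    then show ?thesis by linarith
  qed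
  ultimately show ?thesis using xl unfolding fits_def by blast
qed

lemma K_iff:
  "z \<in> K \<longleftrightarrow> (0 \<le> z$last_index \<and> z$last_index < 1 \<and> fits (rsum (z$last_index)) z) \<or>
     (0 < z$last_index \<and> z$last_index \<le> 1 \<and> fits (lsum (z$last_index)) z)"
  unfolding column_def rprof_def lprof_def fits_def by (simp cong: conj_cong imp_cong)

lemma tile_K: "is_tile (tile_matrix p s) (digit_box p) K"
proof (rule is_tileI[OF _ compact_K])
  have q0: "0 < real q" using q2 by simp
  have "(\<chi> j. if j = last_index then 0 else base (of_int (p j)) + s j * rsum 0 j) \<in> K"
    unfolding K_iff by (simp add: fits_def)
  then show "K \<noteq> {}" by blast
  fix x assume "x \<in> K"
  then consider (r) "0 \<le> x$last_index" "x$last_index < 1" "fits (rsum (x$last_index)) x"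
    | (l) "0 < x$last_index" "x$last_index \<le> 1" "fits (lsum (x$last_index)) x" unfolding K_iff by blast
  then show "\<exists>w\<in>K. \<exists>d\<in>digit_box p. tile_matrix p s *v x = w + d"
  proof cases
    case r
    define t where "t = x$last_index"
    define e where "e = \<lfloor>real q * t\<rfloor>"
    have qt: "0 \<le> real q * t" "real q * t < real q" using r(1,2) q0 by (simp_all add: t_def)
    have e: "0 \<le> e" "e < int q" "0 \<le> real q * t - of_int e" "real q * t - of_int e < 1"
      using qt unfolding e_def by linarith+
    have D: "of_int (p j) * rsum t j = t + rsum (real q * t - of_int e) j" for j
      using dsum_rdig[of j t] rdig_0[of t q] r(1,2) dig_add_int(1)[of q "real q * t - of_int e" e] by (simp add: t_def)
    obtain w d where w: "d \<in> digit_box p" "tile_matrix p s *v x = w + d" "w$last_index = real q * t - of_int e"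
      "fits (rsum (real q * t - of_int e)) w"
      using K_step_down[OF t_def[symmetric] e(1-3) less_imp_le[OF e(4)] D r(3)[folded t_def]] by blast
    have "w \<in> K" unfolding K_iff w(3) using w(4) e by blast
    then show ?thesis using w by blast
  next
    case l
    define t where "t = x$last_index"
    \<comment> \<open>With left tails the digit is the ceiling minus 1, so that the remainder stays
      in (0, 1] instead of [0, 1).\<close>
    define e where "e = \<lceil>real q * t\<rceil> - 1"
    have qt: "0 < real q * t" "real q * t \<le> real q" using l(1,2) q0 by (simp_all add: t_def)
    have e: "0 \<le> e" "e < int q" "0 < real q * t - of_int e" "real q * t - of_int e \<le> 1"
      using qt unfolding e_def by linarith+
    have D: "of_int (p j) * lsum t j = t + lsum (real q * t - of_int e) j" for j
      using dsum_ldig[of j t] ldig_0[of t q] l(1,2) dig_add_int(2)[of q "real q * t - of_int e" e] by (simp add: t_def)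
    obtain w d where w: "d \<in> digit_box p" "tile_matrix p s *v x = w + d" "w$last_index = real q * t - of_int e"
      "fits (lsum (real q * t - of_int e)) w"
      using K_step_down[OF t_def[symmetric] e(1,2) less_imp_le[OF e(3)] e(4) D l(3)[folded t_def]] by blast
    have "w \<in> K" unfolding K_iff w(3) using w(4) e by blast
    then show ?thesis using w by blast
  qed
next
  have q0: "0 < real q" using q2 by simp
  fix w d assume w: "w \<in> K" and d: "d \<in> digit_box p"
  obtain e where "d$last_index = of_int e" "0 \<le> e" "e < \<bar>p last_index\<bar>" using d unfolding digit_box_iff by blast
  then have e: "d$last_index = of_int e" "0 \<le> (of_int e :: real)" "of_int e + 1 \<le> real q" using pq by auto
  define t where "t = (w$last_index + of_int e) / real q"
  have qt: "real q * t = w$last_index + of_int e" using q0 by (simp add: t_def)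
  then have qt': "real q * t = w$last_index + d$last_index" using e(1) by simp
  from w consider (r) "0 \<le> w$last_index" "w$last_index < 1" "fits (rsum (w$last_index)) w"
    | (l) "0 < w$last_index" "w$last_index \<le> 1" "fits (lsum (w$last_index)) w" unfolding K_iff by blast
  then show "\<exists>x\<in>K. tile_matrix p s *v x = w + d"
  proof cases
    case r
    have t: "0 \<le> t" "t < 1" using r(1,2) e q0 unfolding t_def by simp_all
    have D: "of_int (p j) * rsum t j = t + rsum (w$last_index) j" for j
      using dsum_rdig[of j t] rdig_0[of t q] t dig_add_int(1)[of q "w$last_index" e] by (simp add: qt)
    obtain x where x: "tile_matrix p s *v x = w + d" "x$last_index = t" "fits (rsum t) x"
      using K_step_up[OF d qt' D r(3)] by blast
    have "x \<in> K" unfolding K_iff x(2) using x(3) t by blast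
    then show ?thesis using x by blast
  next
    case l
    have t: "0 < t" "t \<le> 1" using l(1,2) e q0 unfolding t_def by simp_all
    have D: "of_int (p j) * lsum t j = t + lsum (w$last_index) j" for j
      using dsum_ldig[of j t] ldig_0[of t q] t dig_add_int(2)[of q "w$last_index" e] by (simp add: qt)
    obtain x where x: "tile_matrix p s *v x = w + d" "x$last_index = t" "fits (lsum t) x"
      using K_step_up[OF d qt' D l(3)] by blast
    have "x \<in> K" unfolding K_iff x(2) using x(3) t by blast
    then show ?thesis using x by blast
  qed
qed

lemma prof_jump: "j \<noteq> last_index \<Longrightarrow> rprof j t - lprof j t =
    s j * (rsum t j - lsum t j)"
  by (simp add: rprof_def lprof_def right_diff_distrib)

lemma tame_ball_K:
  assumes "\<And>j. j \<noteq> last_index \<Longrightarrow> \<bar>s j\<bar> < \<bar>of_int (p j * (p j - 1))\<bar>"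
  shows "tame_ball K"
proof -
  \<comment> \<open>Inserting 0 makes the maximum defined and nonnegative in every
    dimension.\<close>
  define vb where "vb = Max (insert 0 ((\<lambda>j. \<bar>s j\<bar> / \<bar>of_int (p j * (p j - 1))\<bar>) ` (UNIV - {last_index})))"
  have vb: "0 \<le> vb" "vb < 1" "\<And>j. j \<noteq> last_index \<Longrightarrow> \<bar>s j\<bar> / \<bar>of_int (p j * (p j - 1))\<bar> \<le> vb"
  proof -
    show "0 \<le> vb" unfolding vb_def by (rule Max_ge) auto
    show "\<bar>s j\<bar> / \<bar>of_int (p j * (p j - 1))\<bar> \<le> vb" if "j \<noteq> last_index" for j
      unfolding vb_def by (rule Max_ge) (use that in auto)
    have "\<bar>s j\<bar> / \<bar>of_int (p j * (p j - 1))\<bar> < 1" if "j \<noteq> last_index" for j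
    proof -
      have "0 < \<bar>of_int (p j * (p j - 1)) :: real\<bar>" using assms[OF that] by linarith
      then show ?thesis using assms[OF that] by (simp only: pos_divide_less_eq mult_1)
    qed
    then show "vb < 1" unfolding vb_def by (subst Max_less_iff) auto
  qed
  define \<kappa> where "\<kappa> = 1 + real CARD('n) * (3 + 1 / (1 - vb))"
  have k1: "1 \<le> \<kappa>" using vb by (simp add: \<kappa>_def)
  \<comment> \<open>\<open>\<kappa>\<close> depends on the dimension and \<open>vb\<close> only, so
    the base may be chosen afterwards as \<open>q^N\<close> with
    \<open>\<kappa> * (2/3)^N < 1\<close>.\<close>
  obtain N where N: "(2/3)^N < 1 / \<kappa>" using real_arch_pow_inv[of "1 / \<kappa>" "2/3"] k1 by auto
  have N0: "0 < N"
  proof (rule ccontr)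
    assume "\<not> 0 < N"
    then have "1 < 1 / \<kappa>" using N by simp
    then show False using k1 by (simp add: field_simps)
  qed
  interpret regulated last_index rprof lprof "q^N" "\<lambda>k. C * (2/3)^(N * k)" by (rule regulated_power[OF N0])
  have "tame_regulated rprof lprof (q^N) (\<lambda>k. C * (2/3)^(N * k)) vb"
  proof (intro tame_regulated.intro tame_regulated_axioms.intro)
    show "regulated rprof lprof (q^N) (\<lambda>k. C * (2/3)^(N * k))" by (rule regulated_power[OF N0])
    show "0 \<le> vb" "vb < 1" by (rule vb)+
    show "\<bar>regulated.jump rprof lprof (q^N) k i j\<bar> \<le> vb" if i: "0 < i" "i < (q^N)^k" for k i j
    proof (cases "j = last_index")
      case True
      then show ?thesis using vb unfolding jump_def by (simp add: rprof_def lprof_def)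
    next
      case False
      define P where "P = (of_int (p j) :: real)"
      have P: "2 \<le> \<bar>P\<bar>" unfolding P_def by (rule p2r)
      define M where "M = real ((q^N)^k)"
      have "real i < M" unfolding M_def using i(2) by (simp only: of_nat_less_iff)
      then have M: "0 < M" "real i < M" by linarith+
      define r where "r = real i / M"
      have r: "0 < r" "r < 1" using i(1) M by (simp_all add: r_def)
      have rint: "r \<notin> \<int>"
      proof
        assume "r \<in> \<int>"
        then obtain z where z: "r = of_int z" by (rule Ints_cases)
        then have "0 < z" "z < 1" using r by simp_all
        then show False by simp
      qed
      have "real (q^(N * k)) * r \<in> \<int>"
      proof -
        have "M * r = real i" using M by (simp add: r_def)
        moreover have "real (q^(N * k)) = M" by (simp add: M_def power_mult)
        ultimately show ?thesis by simp
      qed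
      \<comment> \<open>As \<open>r\<close> is no integer, \<open>dsum_jump(2)\<close> gives a
        factor \<open>1 / \<bar>P\<bar>\<close>, and the jump at \<open>q * r\<close> is at most
        \<open>1 / \<bar>P - 1\<bar>\<close>: together the denominator of condition (3).\<close>
      then have "real (q^(N * k)) * (real q * r) \<in> \<int>"
        using Ints_mult[of "real q" "real (q^(N * k)) * r"] by (simp add: mult_ac)
      then have "\<bar>dsum P (rdig q (real q * r)) - dsum P (ldig q (real q * r))\<bar> \<le> 1 / \<bar>P - 1\<bar>"
        by (rule dsum_jump_bound[OF P])
      then have "\<bar>dsum P (rdig q (real q * r)) - dsum P (ldig q (real q * r))\<bar> / \<bar>P\<bar> \<le> 1 / \<bar>P - 1\<bar> / \<bar>P\<bar>"
        by (rule divide_right_mono) simp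
      then have "\<bar>dsum P (rdig q r) - dsum P (ldig q r)\<bar> \<le> 1 / \<bar>P - 1\<bar> / \<bar>P\<bar>"
        unfolding dsum_jump(2)[OF P rint] by simp
      then have "\<bar>s j\<bar> * \<bar>dsum P (rdig q r) - dsum P (ldig q r)\<bar> \<le> \<bar>s j\<bar> * (1 / \<bar>P - 1\<bar> / \<bar>P\<bar>)"
        by (rule mult_left_mono) simp
      also have "\<dots> = \<bar>s j\<bar> / \<bar>of_int (p j * (p j - 1))\<bar>" by (simp add: P_def abs_mult)
      also have "\<dots> \<le> vb" by (rule vb(3)[OF False])
      finally show ?thesis unfolding jump_def using prof_jump[OF False, of r]
        by (simp add: abs_mult r_def M_def P_def)
    qed
    have "\<kappa> * (2/3)^N < 1" using N k1 by (simp add: field_simps)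
    then have "summable (\<lambda>k. C * (\<kappa> * (2/3)^N)^k)"
      using k1 by (intro summable_mult summable_geometric) (simp add: abs_mult)
    moreover have "C * (\<kappa> * (2/3)^N)^k = \<kappa>^k * (C * (2/3)^(N * k))" for k
      by (simp add: power_mult_distrib power_mult)
    ultimately show "summable (\<lambda>k. (1 + real CARD('n) * (3 + 1 / (1 - vb)))^k * (C * (2/3)^(N * k)))"
      unfolding \<kappa>_def[symmetric] by simp
  qed
  then show ?thesis by (rule tame_regulated.tame_ball_column)
qed

section \<open>Disconnected interior when two cubes fail to overlap\<close>

lemma interior_slab_point:
  assumes small: "C * (2/3)^n \<le> 1/4" and m: "m < q^n"
  shows "\<exists>z\<in>interior K. z$last_index = (real m + 1/2) / real (q^n)"
proof -
  let ?r = "real m / real (q^n)"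
  have qn: "0 < real (q^n)" using q2 by simp
  define z where "z = ((\<chi> j. if j = last_index then (real m + 1/2) / real (q^n) else rprof j ?r + 1/2)
      :: real^('n::{finite,linorder}))"
  \<comment> \<open>The profile moves by at most 1/4 within the slab, so the middle half of the cube
    at its lower end lies in every section.\<close>
  define W where "W = {w. real m < real (q^n) * w$last_index} \<inter> {w. real (q^n) * w$last_index < real m + 1} \<inter>
     (\<Inter>j\<in>UNIV - {last_index}. {w. rprof j ?r + 1/4 < w$j} \<inter> {w. w$j < rprof j ?r + 3/4} :: (real^('n::{finite,linorder})) set)"
  have "open W" unfolding W_def
    by (intro open_Int open_INT ballI open_Collect_less continuous_intros finite_Diff finite)
  moreover have "W \<subseteq> K"
  proof
    fix w assume w: "w \<in> W"
    define t where "t = w$last_index"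
    have t: "real m < real (q^n) * t" "real (q^n) * t < real m + 1" using w by (auto simp: W_def t_def)
    have "real m + 1 \<le> real (q^n)" using m by linarith
    then have "real (q^n) * t < real (q^n) * 1" "0 < real (q^n) * t" using t by linarith+
    then have t01: "0 < t" "t < 1" using qn by (simp_all only: mult_less_cancel_left_pos zero_less_mult_pos)
    have "rprof j t \<le> w$j \<and> w$j \<le> rprof j t + 1" if "j \<noteq> last_index" for j
    proof -
      have "rprof j ?r + 1/4 < w$j" "w$j < rprof j ?r + 3/4" using w that by (auto simp: W_def)
      then show ?thesis using prof_osc(1)[OF less_imp_le[OF t(1)] t(2), of j] small by linarith
    qed
    then show "w \<in> K" using t01 unfolding column_def t_def by auto
  qed
  moreover have "z \<in> W" using qn by (auto simp: W_def z_def)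
  ultimately have "z \<in> interior K" by (metis interiorI)
  then show ?thesis by (intro bexI[of _ z]) (simp_all add: z_def)
qed

lemma prof_small: "0 < r \<Longrightarrow> \<exists>n\<ge>1. C * (2/3)^n \<le> r"
proof -
  assume r: "0 < r"
  have "(\<lambda>n. C * (2/3::real)^n) \<longlonglongrightarrow> 0"
    by (intro tendsto_mult_right_zero LIMSEQ_power_zero) simp
  then have "\<forall>\<^sub>F n in sequentially. C * (2/3)^n < r" using order_tendstoD(2) r by blast
  then obtain n0 where "\<And>n. n \<ge> n0 \<Longrightarrow> C * (2/3)^n < r" by (auto simp: eventually_sequentially)
  then show ?thesis by (intro exI[of _ "max 1 n0"]) (simp add: less_imp_le)
qed

text \<open>An interior point may be moved slightly up and down. Sections just above
  \<open>1 / q\<close> are close to the cube at the right limit, those just below to the cube at the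
  left limit; letting the tolerance tend to 0 gives both memberships.\<close>

lemma interior_in_both_sections:
  assumes z: "z \<in> interior K" and zl: "z$last_index = 1 / real q" and j: "j \<noteq> last_index"
  shows "rprof j (1 / real q) \<le> z$j \<and> z$j \<le> rprof j (1 / real q) + 1"
    "lprof j (1 / real q) \<le> z$j \<and> z$j \<le> lprof j (1 / real q) + 1"
proof -
  have q0: "0 < real q" using q2 by simp
  obtain \<epsilon> where \<epsilon>: "0 < \<epsilon>" "ball z \<epsilon> \<subseteq> K" using z mem_interior by blast
  have mv: "(\<chi> i. if i = last_index then z$last_index + \<kappa> else z$i) \<in> K" if "\<bar>\<kappa>\<bar> < \<epsilon>" for \<kappa>
  proof -
    let ?w = "(\<chi> i. if i = last_index then z$last_index + \<kappa> else z$i) :: real^('n::{finite,linorder})"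
    have "dist z ?w \<le> (\<Sum>i\<in>UNIV. \<bar>(z - ?w)$i\<bar>)" unfolding dist_norm by (rule norm_le_l1_cart)
    also have "\<dots> = (\<Sum>i\<in>(UNIV::'n set). if i = last_index then \<bar>\<kappa>\<bar> else 0)" by (rule sum.cong) auto
    finally have "?w \<in> ball z \<epsilon>" using that by simp
    then show ?thesis using \<epsilon>(2) by blast
  qed
  have box: "(rprof j t \<le> z$j \<and> z$j \<le> rprof j t + 1) \<or> (lprof j t \<le> z$j \<and> z$j \<le> lprof j t + 1)"
    if "\<bar>t - 1 / real q\<bar> < \<epsilon>" for t
    using mv[of "t - 1 / real q"] that j zl unfolding column_def by auto
  have eps: "rprof j (1 / real q) - e \<le> z$j \<and> z$j \<le> rprof j (1 / real q) + 1 + e \<and>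
     lprof j (1 / real q) - e \<le> z$j \<and> z$j \<le> lprof j (1 / real q) + 1 + e" if e: "0 < e" for e
  proof -
    obtain n where n: "1 \<le> n" "C * (2/3)^n \<le> e / 2" using prof_small[of "e / 2"] e by auto
    define M where "M = real (q^n)"
    define m where "m = q^(n - 1)"
    have M: "0 < M" using q2 by (simp add: M_def)
    have qm: "real q * real m = M" unfolding M_def m_def using n(1) by (metis of_nat_mult power_eq_if not_one_le_zero)
    have m0: "1 \<le> m" using q2 by (simp add: m_def)
    have r: "1 / real q = real m / M" using qm q0 M by (simp add: field_simps)
    have Mr: "M * (1 / real q) = real m" unfolding r using M by simp
    \<comment> \<open>Small enough to stay in the ball around \<open>z\<close> and in the slabs of
      level \<open>n\<close> next to the height \<open>1 / q\<close>, which is an interface of that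
      level because \<open>n\<close> is at least 1.\<close>
    define \<kappa> where "\<kappa> = min (\<epsilon> / 2) (1 / (2 * M))"
    have k: "0 < \<kappa>" "\<kappa> < \<epsilon>" using \<epsilon>(1) M by (auto simp: \<kappa>_def min_def)
    have "M * \<kappa> \<le> M * (1 / (2 * M))" using M by (intro mult_left_mono) (auto simp: \<kappa>_def)
    then have Mk: "0 < M * \<kappa>" "M * \<kappa> \<le> 1/2" using M k by simp_all
    define t where "t = 1 / real q + \<kappa>"
    have t: "real m < real (q^n) * t" "real (q^n) * t < real m + 1"
      unfolding t_def M_def[symmetric] distrib_left Mr using Mk by linarith+
    have "\<bar>rprof j t - rprof j (1 / real q)\<bar> \<le> e / 2" "\<bar>lprof j t - rprof j (1 / real q)\<bar> \<le> e / 2"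
      unfolding r M_def using prof_osc(1)[OF less_imp_le[OF t(1)] t(2), of j] prof_osc(2)[OF t(1) less_imp_le[OF t(2)], of j] n(2)
      by linarith+
    moreover have "\<bar>t - 1 / real q\<bar> < \<epsilon>" using k by (simp add: t_def)
    ultimately have R: "rprof j (1 / real q) - e \<le> z$j \<and> z$j \<le> rprof j (1 / real q) + 1 + e"
      using box[of t] e by linarith
    define u where "u = 1 / real q - \<kappa>"
    have rm: "real (m - 1) = real m - 1" using m0 by simp
    have u: "real (m - 1) < real (q^n) * u" "real (q^n) * u < real (m - 1) + 1"
      unfolding u_def M_def[symmetric] right_diff_distrib Mr rm using Mk by linarith+
    have v: "real (m - 1) < real (q^n) * (1 / real q)" "real (q^n) * (1 / real q) \<le> real (m - 1) + 1"
      unfolding M_def[symmetric] Mr rm by linarith+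
    have "\<bar>rprof j u - lprof j (1 / real q)\<bar> \<le> e" "\<bar>lprof j u - lprof j (1 / real q)\<bar> \<le> e"
      using prof_osc(1)[OF less_imp_le[OF u(1)] u(2), of j] prof_osc(2)[OF u(1) less_imp_le[OF u(2)], of j]
        prof_osc(2)[OF v, of j] n(2) by linarith+
    moreover have "\<bar>u - 1 / real q\<bar> < \<epsilon>" using k by (simp add: u_def)
    ultimately have "lprof j (1 / real q) - e \<le> z$j \<and> z$j \<le> lprof j (1 / real q) + 1 + e"
      using box[of u] by linarith
    then show ?thesis using R by blast
  qed
  have "rprof j (1 / real q) \<le> z$j" "z$j \<le> rprof j (1 / real q) + 1"
    "lprof j (1 / real q) \<le> z$j" "z$j \<le> lprof j (1 / real q) + 1"
    by (rule field_le_epsilon, use eps in force)+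
  then show "rprof j (1 / real q) \<le> z$j \<and> z$j \<le> rprof j (1 / real q) + 1"
    "lprof j (1 / real q) \<le> z$j \<and> z$j \<le> lprof j (1 / real q) + 1" by auto
qed

text \<open>The jump at height \<open>1 / q\<close> attains the bound. If it is at least 1 in
  direction \<open>j\<close>, the two intervals there meet in at most one point, whereas an interior
  point could still be moved along \<open>j\<close>. So the interior misses this height but has
  points on both sides.\<close>

lemma not_connected_interior_K:
  assumes j: "j \<noteq> last_index" and big: "\<bar>of_int (p j * (p j - 1))\<bar> \<le> \<bar>s j\<bar>"
  shows "\<not> connected (interior K)"
proof
  assume con: "connected (interior K)"
  define t0 where "t0 = 1 / real q"
  have q0: "2 \<le> real q" using q2 by simp
  have t0: "0 < t0" "t0 \<le> 1/2" using q0 by (auto simp: t0_def field_simps)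
  define P where "P = (of_int (p j) :: real)"
  have P: "2 \<le> \<bar>P\<bar>" unfolding P_def by (rule p2r)
  have "t0 \<notin> \<int>"
  proof
    assume "t0 \<in> \<int>"
    then obtain z where z: "t0 = of_int z" by (rule Ints_cases)
    then have "(0::real) < of_int z" "of_int z < (1::real)" using t0 by linarith+
    then show False by simp
  qed
  moreover have "real q * t0 = 1" using q0 by (simp add: t0_def)
  ultimately have "dsum P (rdig q t0) - dsum P (ldig q t0) = - 1 / (P - 1) / P"
    using dsum_jump(1)[OF P, where t = 1 and q = q] dsum_jump(2)[OF P, where t = t0 and q = q] by simp
  then have "\<bar>rprof j t0 - lprof j t0\<bar> = \<bar>s j\<bar> / \<bar>P * (P - 1)\<bar>"
    using prof_jump[OF j, of t0] by (simp add: P_def[symmetric] abs_mult)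
  moreover have "P * (P - 1) = of_int (p j * (p j - 1))" by (simp add: P_def)
  moreover have "0 < \<bar>P * (P - 1)\<bar>" using P by auto
  ultimately have jump1: "1 \<le> \<bar>rprof j t0 - lprof j t0\<bar>"
    using big by (simp add: pos_le_divide_eq)
  have avoid: "z$last_index \<noteq> t0" if z: "z \<in> interior K" for z
  proof
    assume zl: "z$last_index = t0"
    obtain \<epsilon> where \<epsilon>: "0 < \<epsilon>" "ball z \<epsilon> \<subseteq> interior K" using z open_interior open_contains_ball by metis
    define w where "w = z + axis j (\<epsilon> / 2)"
    have "norm (axis j (\<epsilon> / 2)) \<le> (\<Sum>i\<in>UNIV. \<bar>axis j (\<epsilon> / 2) $ i\<bar>)" by (rule norm_le_l1_cart)
    also have "\<dots> = (\<Sum>i\<in>(UNIV::'n set). if i = j then \<epsilon> / 2 else 0)"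
      by (rule sum.cong) (use \<epsilon>(1) in \<open>auto simp: axis_def\<close>)
    finally have "w \<in> ball z \<epsilon>" using \<epsilon>(1) by (simp add: w_def dist_norm)
    then have w: "w \<in> interior K" using \<epsilon>(2) by blast
    have "w$last_index = t0" using j zl by (simp add: w_def axis_def)
    moreover have "w$j = z$j + \<epsilon> / 2" by (simp add: w_def)
    ultimately show False
      using interior_in_both_sections[OF z zl[unfolded t0_def] j] interior_in_both_sections[OF w _ j] jump1 \<epsilon>(1)
      unfolding t0_def by linarith
  qed
  obtain n where n: "1 \<le> n" "C * (2/3)^n \<le> 1/4" using prof_small[of "1/4"] by auto
  define M where "M = real (q^n)"
  have "q^1 \<le> q^n" using q2 n(1) by (intro power_increasing) auto
  then have M: "real q \<le> M" by (simp add: M_def)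
  obtain z1 where z1: "z1 \<in> interior K" "z1$last_index = (real 0 + 1/2) / real (q^n)"
    using interior_slab_point[OF n(2), of 0] q2 by auto
  have "z1$last_index < t0"
  proof -
    have "z1$last_index = 1/2 / M" by (simp add: z1 M_def)
    also have "\<dots> \<le> 1/2 / real q" using M q0 by (intro divide_left_mono) auto
    also have "\<dots> < t0" using q0 by (simp add: t0_def field_simps)
    finally show ?thesis .
  qed
  obtain z2 where z2: "z2 \<in> interior K" "z2$last_index = (real (q^n - 1) + 1/2) / real (q^n)"
    using interior_slab_point[OF n(2), of "q^n - 1"] q2 by auto
  have "t0 < z2$last_index"
  proof -
    have "real (q^n - 1) = M - 1" using q2 by (simp add: M_def of_nat_diff)
    then have "z2$last_index = (M - 1/2) / M" using z2(2) unfolding M_def[symmetric] by simp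
    moreover have "1/2 < (M - 1/2) / M" using M q0 by (simp add: pos_less_divide_eq)
    ultimately show ?thesis using t0 by linarith
  qed
  have "open {z::real^('n::{finite,linorder}). z$last_index < t0}" "open {z::real^('n::{finite,linorder}). t0 < z$last_index}"
    by (intro open_Collect_less continuous_intros)+
  then have "{z. z$last_index < t0} \<inter> interior K = {} \<or> {z. t0 < z$last_index} \<inter> interior K = {}"
    by (intro connectedD[OF con]) (use avoid in \<open>auto simp: not_less less_le\<close>)
  then show False using z1(1) z2(1) \<open>z1$last_index < t0\<close> \<open>t0 < z2$last_index\<close> by blast
qed

lemma characterization:
  "(connected (interior K) \<longleftrightarrow> tame_ball K) \<and>
   (tame_ball K \<longleftrightarrow> (\<forall>j. j \<noteq> last_index \<longrightarrow> \<bar>s j\<bar> < \<bar>of_int (p j * (p j - 1))\<bar>))"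
  using tame_ball_connected_interior[of K] tame_ball_K not_connected_interior_K by (meson not_less)

end

section \<open>Reduction to a positive last entry\<close>

lemma translation_vector:
  fixes p :: "'n::{finite,linorder} \<Rightarrow> int" and c :: "real^('n::{finite,linorder})"
  assumes "\<And>i. \<bar>p i\<bar> \<ge> 2"
  obtains b where "tile_matrix p s *v b = b + c"
proof -
  \<comment> \<open>No diagonal entry is 1, so the triangular matrix \<open>A\<close> minus the
    identity is invertible; the witness below is back substitution.\<close>
  have p1: "of_int (p i) - 1 \<noteq> (0::real)" for i
  proof -
    have "p i \<noteq> 1" using assms[of i] by auto
    then show ?thesis by simp
  qed
  define bl where "bl = c$last_index / (of_int (p last_index) - 1)"
  define b where "b = ((\<chi> j. if j = last_index then bl else (c$j + s j * bl) / (of_int (p j) - 1)) :: real^('n::{finite,linorder}))"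
  have bl: "(of_int (p last_index) - 1) * bl = c$last_index" using p1 by (simp add: bl_def)
  have bj: "(of_int (p j) - 1) * b$j = c$j + s j * bl" if "j \<noteq> last_index" for j
    using p1 that by (simp add: b_def)
  have "tile_matrix p s *v b = b + c" unfolding vec_eq_iff
  proof
    fix j show "(tile_matrix p s *v b)$j = (b + c)$j"
    proof (cases "j = last_index")
      case True
      then show ?thesis using bl by (simp add: tile_matrix_nth b_def algebra_simps)
    next
      case False
      moreover have "b$last_index = bl" by (simp add: b_def)
      ultimately show ?thesis using bj[OF False] by (simp add: tile_matrix_nth algebra_simps)
    qed
  qed
  then show ?thesis using that by blast
qed

lemma tile_matrix_uminus:
  fixes x :: "real^('n::{finite,linorder})"
  shows "tile_matrix (\<lambda>i. - p i) (\<lambda>i. - s i) *v x = - (tile_matrix p s *v x)"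
  by (simp add: vec_eq_iff tile_matrix_nth)

lemma digit_box_reflect:
  assumes "d \<in> digit_box p"
  shows "(\<chi> j. of_int (\<bar>p j\<bar> - 1)) - d \<in> digit_box p"
proof -
  obtain i where i: "d = (\<chi> j. of_int (i j))" "\<And>j. 0 \<le> i j \<and> i j < \<bar>p j\<bar>"
    using assms unfolding digit_box_def by blast
  then have "(\<chi> j. of_int (\<bar>p j\<bar> - 1)) - d = (\<chi> j. of_int (\<bar>p j\<bar> - 1 - i j))"
    by (simp add: vec_eq_iff)
  moreover have "0 \<le> \<bar>p j\<bar> - 1 - i j \<and> \<bar>p j\<bar> - 1 - i j < \<bar>p j\<bar>" for j using i(2)[of j] by linarith
  ultimately show ?thesis
    unfolding digit_box_def mem_Collect_eq by (intro exI[of _ "\<lambda>j. \<bar>p j\<bar> - 1 - i j"]) simp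
qed

text \<open>The digit box is centrally symmetric, hence so are the tiles, and replacing \<open>A\<close> by \<open>- A\<close>
  only translates the tile.\<close>

lemma is_tile_uminus:
  fixes p :: "'n::{finite,linorder} \<Rightarrow> int" and K :: "(real^('n::{finite,linorder})) set"
  assumes p: "\<And>i. \<bar>p i\<bar> \<ge> 2"
    and K: "is_tile (tile_matrix (\<lambda>i. - p i) (\<lambda>i. - s i)) (digit_box p) K"
  shows "\<exists>a. is_tile (tile_matrix p s) (digit_box p) ((\<lambda>x. x + a) ` K)"
proof -
  let ?A = "tile_matrix p s" and ?A' = "tile_matrix (\<lambda>i. - p i) (\<lambda>i. - s i)"
  let ?D = "digit_box p"
  define \<delta> where "\<delta> = ((\<chi> j. of_int (\<bar>p j\<bar> - 1)) :: real^('n::{finite,linorder}))"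
  have refl: "\<delta> - d \<in> ?D" if "d \<in> ?D" for d using digit_box_reflect[OF that] by (simp add: \<delta>_def)
  have neg: "?A' *v x = - (?A *v x)" for x by (rule tile_matrix_uminus)
  have p': "\<bar>- p i\<bar> \<ge> 2" for i using p[of i] by simp
  \<comment> \<open>Chosen so that reflecting \<open>x\<close> to \<open>b - x\<close> replaces a
    digit \<open>d\<close> by \<open>\<delta> - d\<close>. The reflected set solves the same
    equation, hence lies in \<open>K\<close>.\<close>
  obtain b where b: "?A' *v b = b + \<delta>" 
    by (rule translation_vector[where p = "\<lambda>i. - p i" and s = "\<lambda>i. - s i" and c = \<delta>, OF p'])
  have "is_tile ?A' ?D ((\<lambda>x. b - x) ` K)"
  proof (rule is_tileI)
    show "(\<lambda>x. b - x) ` K \<noteq> {}" using is_tileD(1)[OF K] by simp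
    show "compact ((\<lambda>x. b - x) ` K)"
      by (intro compact_continuous_image is_tileD(2)[OF K] continuous_intros)
    fix x assume "x \<in> (\<lambda>x. b - x) ` K"
    then obtain k where k: "k \<in> K" "x = b - k" by blast
    obtain t d where t: "t \<in> K" "d \<in> ?D" "?A' *v k = t + d" using is_tileD(3)[OF K k(1)] by blast
    have "?A' *v x = (b - t) + (\<delta> - d)" unfolding k(2) matrix_vector_mult_diff_distrib b t(3) by simp
    then show "\<exists>t\<in>(\<lambda>x. b - x) ` K. \<exists>d\<in>?D. ?A' *v x = t + d" using t refl by blast
  next
    fix t d assume "t \<in> (\<lambda>x. b - x) ` K" and d: "d \<in> ?D"
    then obtain k where k: "k \<in> K" "t = b - k" by blast
    obtain x where x: "x \<in> K" "?A' *v x = k + (\<delta> - d)" using is_tileD(4)[OF K k(1) refl[OF d]] by blast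
    have "?A' *v (b - x) = t + d" unfolding k(2) matrix_vector_mult_diff_distrib b x(2) by simp
    then show "\<exists>x\<in>(\<lambda>x. b - x) ` K. ?A' *v x = t + d" using x(1) by blast
  qed
  then have "(\<lambda>x. b - x) ` K \<subseteq> K"
    by (rule tile_subset[where p = "\<lambda>i. - p i" and s = "\<lambda>i. - s i", OF p' _ K])
  then have sym: "b - k \<in> K" if "k \<in> K" for k using that by blast
  \<comment> \<open>For \<open>k\<close> in \<open>K\<close>,
    \<open>A k = - (t + d) = (b - t) + (\<delta> - d) - (b + \<delta>)\<close>, with
    \<open>b - t\<close> in \<open>K\<close> again by symmetry; translating by \<open>a\<close>
    absorbs the constant \<open>b + \<delta>\<close>.\<close>
  obtain a where a: "?A *v a = a + (b + \<delta>)" 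
    by (rule translation_vector[where p = p and s = s and c = "b + \<delta>", OF p])
  have "is_tile ?A ?D ((\<lambda>x. x + a) ` K)"
  proof (rule is_tileI)
    show "(\<lambda>x. x + a) ` K \<noteq> {}" using is_tileD(1)[OF K] by simp
    show "compact ((\<lambda>x. x + a) ` K)"
      by (intro compact_continuous_image is_tileD(2)[OF K] continuous_intros)
    fix x assume "x \<in> (\<lambda>x. x + a) ` K"
    then obtain k where k: "k \<in> K" "x = k + a" by blast
    obtain t d where t: "t \<in> K" "d \<in> ?D" "?A' *v k = t + d" using is_tileD(3)[OF K k(1)] by blast
    have "?A *v k = - (t + d)" using neg[of k] t(3) by simp
    then have "?A *v x = (b - t) + a + (\<delta> - d)" unfolding k(2) matrix_vector_mult_add_rdistrib a by (simp add: matrix_vector_right_distrib a)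
    then show "\<exists>t\<in>(\<lambda>x. x + a) ` K. \<exists>d\<in>?D. ?A *v x = t + d" using sym[OF t(1)] refl[OF t(2)] by blast
  next
    fix t d assume "t \<in> (\<lambda>x. x + a) ` K" and d: "d \<in> ?D"
    then obtain k where k: "k \<in> K" "t = k + a" by blast
    obtain x where x: "x \<in> K" "?A' *v x = (b - k) + (\<delta> - d)" using is_tileD(4)[OF K sym[OF k(1)] refl[OF d]] by blast
    have "?A *v x = - ((b - k) + (\<delta> - d))" using neg[of x] x(2) by simp
    then have "?A *v (x + a) = t + d" unfolding k(2) by (simp add: matrix_vector_right_distrib a)
    then show "\<exists>x\<in>(\<lambda>x. x + a) ` K. ?A *v x = t + d" using x(1) by blast
  qed
  then show ?thesis by blast
qed

lemma connected_translation_iff: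
  "connected ((\<lambda>x. x + a) ` S) \<longleftrightarrow> connected (S :: 'a::euclidean_space set)"
proof
  assume "connected ((\<lambda>x. x + a) ` S)"
  then have "connected ((\<lambda>x. x - a) ` (\<lambda>x. x + a) ` S)"
    by (rule connected_continuous_image[rotated]) (intro continuous_intros)
  moreover have "(\<lambda>x. x - a) ` (\<lambda>x. x + a) ` S = S" by (simp only: image_image add_diff_cancel image_ident)
  ultimately show "connected S" by (simp only:)
qed (intro connected_continuous_image continuous_intros)

theorem theorem1p6:
  fixes p :: "'n::{finite,linorder} \<Rightarrow> int"
    and s :: "'n \<Rightarrow> real"
    and T :: "(real^('n::{finite,linorder})) set"
  assumes "CARD('n) \<ge> 2"
    and "\<And>i. \<bar>p i\<bar> \<ge> 2"
  defines "T \<equiv> self_affine_set (tile_matrix p s) (digit_box p)"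
  shows "(connected (interior T) \<longleftrightarrow> tame_ball T)
       \<and> (tame_ball T \<longleftrightarrow>
            Max ((\<lambda>j. \<bar>s j / of_int (p j * (p j - sgn (p last_index)))\<bar>) ` (UNIV - {last_index})) < 1)"
proof -
  let ?l = "last_index :: 'n"
  \<comment> \<open>Dimension at least 2 makes the set under \<open>Max\<close> nonempty, so the
    maximum can be compared termwise.\<close>
  have "UNIV - {?l} \<noteq> {}"
  proof
    assume "UNIV - {?l} = {}"
    then have "UNIV = {?l}" by blast
    then have "CARD('n) = 1" by (metis card_1_singleton_iff One_nat_def)
    then show False using assms(1) by simp
  qed
  then have "Max ((\<lambda>j. \<bar>s j / of_int (p j * (p j - sgn (p ?l)))\<bar>) ` (UNIV - {?l})) < 1 \<longleftrightarrow>
    (\<forall>j. j \<noteq> ?l \<longrightarrow> \<bar>s j / of_int (p j * (p j - sgn (p ?l)))\<bar> < 1)"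
    by (subst Max_less_iff) auto
  also have "\<dots> \<longleftrightarrow> (\<forall>j. j \<noteq> ?l \<longrightarrow> \<bar>s j\<bar> < \<bar>of_int (p j * (p j - sgn (p ?l)))\<bar>)"
  proof -
    have "\<bar>s j / of_int (p j * (p j - sgn (p ?l)))\<bar> < 1 \<longleftrightarrow> \<bar>s j\<bar> < \<bar>of_int (p j * (p j - sgn (p ?l)))\<bar>" for j
    proof -
      have "p j * (p j - sgn (p ?l)) \<noteq> 0" using assms(2)[of j] by (auto simp: sgn_if)
      then have "0 < \<bar>of_int (p j * (p j - sgn (p ?l))) :: real\<bar>" by (simp only: zero_less_abs_iff of_int_eq_0_iff) simp
      then show ?thesis by (simp only: abs_divide pos_divide_less_eq mult_1)
    qed
    then show ?thesis by simp
  qed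
  finally have cond: "Max ((\<lambda>j. \<bar>s j / of_int (p j * (p j - sgn (p ?l)))\<bar>) ` (UNIV - {?l})) < 1 \<longleftrightarrow>
    (\<forall>j. j \<noteq> ?l \<longrightarrow> \<bar>s j\<bar> < \<bar>of_int (p j * (p j - sgn (p ?l)))\<bar>)" .
  show ?thesis
  proof (cases "0 < p ?l")
    case True
    then interpret pos_tile p s "nat (p ?l)" using assms(2) by unfold_locales auto
    have "T = K" unfolding T_def by (rule self_affine_set_eqI[OF assms(2) tile_K])
    then show ?thesis using characterization cond True by simp
  next
    case False
    then have neg: "p ?l < 0" using assms(2)[of ?l] by linarith
    interpret pos_tile "\<lambda>i. - p i" "\<lambda>i. - s i" "nat (- p ?l)" using assms(2) neg by unfold_locales auto
    have "digit_box (\<lambda>i. - p i) = digit_box p" by (simp add: digit_box_def)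
    then have "is_tile (tile_matrix (\<lambda>i. - p i) (\<lambda>i. - s i)) (digit_box p) K" using tile_K by simp
    then obtain a where "is_tile (tile_matrix p s) (digit_box p) ((\<lambda>x. x + a) ` K)"
      using is_tile_uminus[of p s K] assms(2) by blast
    then have T: "T = (\<lambda>x. x + a) ` K" unfolding T_def by (rule self_affine_set_eqI[OF assms(2)])
    have 1: "tame_ball T \<longleftrightarrow> tame_ball K" unfolding T by (rule tame_ball_autohomeo_image[OF autohomeo_add])
    have 2: "connected (interior T) \<longleftrightarrow> connected (interior K)"
      unfolding T interior_autohomeo_image[OF autohomeo_add] by (rule connected_translation_iff)
    \<comment> \<open>Here the sign is -1, and \<open>p (p + 1) = (- p) (- p - 1)\<close> matches
      the condition for the negated data.\<close>
    have "\<bar>- s j\<bar> < \<bar>of_int (- p j * (- p j - 1))\<bar> \<longleftrightarrow> \<bar>s j\<bar> < \<bar>of_int (p j * (p j - sgn (p ?l)))\<bar>" for j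
      using neg by (simp add: algebra_simps)
    then show ?thesis using characterization unfolding cond 1 2 by simp
  qed
qed

end
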